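(* For each of the life-like freezing cellular automata $T22$, $T23$, $S23$, $S24$, $S33$ and $S34$, the problem \textsc{AsyncUnstability} is in $\mathbf{NC}$.
   Context: Cells have two states, $0$ (inactive) and $1$ (active). In the triangular grid, $G(n)$ is a rhombus-shaped region of $2n^2$ triangular cells with periodic (torus) boundary, each cell having 3 neighbors (cells sharing an edge); in the square grid, $G(n)$ is the $n\times n$ torus, each cell having 4 neighbors (von Neumann neighborhood). $N(u)$ is the set of neighbors of $u$. For integers $0\le k_1\le k_2$, the life-like freezing rule with $\mathcal{I}_F=\{k_1,\dots,k_2\}$ is $F(x)_u=1$ if $x_u=1$ or $\sum_{w\in N(u)}x_w\in\mathcal{I}_F$, and $0$ otherwise; it is named $Tk_1k_2$ on the triangular grid and $Sk_1k_2$ on the square grid. A sequential update scheme is a map $\sigma:\mathbb{N}\to G(n)$ such that each consecutive block of $|G(n)|$ steps is a permutation of the cells; $F^{\sigma(0)}(x)=x$ and at time $t$ only cell $\sigma(t)$ is updated by the local rule. \textsc{AsyncUnstability}: given $n$, a configuration $x\in\{0,1\}^{G(n)}$ and a cell $u$, decide whether there exist a sequential update scheme $\sigma$ and $T>0$ with $F^{\sigma(T)}(x)_u\neq x_u$. $\mathbf{NC}$ is the class of decision problems solvable in polylogarithmic time on a PRAM with polynomially many processors. *)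

theory Defs
  imports Complex_Main
begin

section \<open>The class NC\<close>

text \<open>
  A PRAM with finitely many synchronous processors that all run the same program on private
  registers and a shared memory of natural numbers.  The arithmetic is addition, truncated
  subtraction and halving at unit cost.  Multiplication is deliberately absent: with it, polylogarithmic
  unit-cost time could build numbers with superpolynomially many bits.  A processor whose program
  counter has left the program has halted.
\<close>

datatype instr =
    Const nat nat      \<comment> \<open>\<open>r := c\<close>\<close>
  | Add nat nat nat    \<comment> \<open>\<open>r := r1 + r2\<close>\<close>
  | Sub nat nat nat    \<comment> \<open>\<open>r := r1 - r2\<close>, truncated\<close>
  | Half nat nat       \<comment> \<open>\<open>r := r1 div 2\<close>\<close>
  | Load nat nat       \<comment> \<open>\<open>r := mem[r1]\<close>\<close>
  | Store nat nat      \<comment> \<open>\<open>mem[r1] := r2\<close>\<close>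
  | JumpZero nat nat   \<comment> \<open>if \<open>r = 0\<close>, continue at position \<open>l\<close>\<close>

type_synonym memory = "nat \<Rightarrow> nat"

record processor =
  pc :: nat
  regs :: "nat \<Rightarrow> nat"

record pram =
  procs :: "nat \<Rightarrow> processor"
  mem :: memory

definition set_reg :: "nat \<Rightarrow> nat \<Rightarrow> processor \<Rightarrow> processor" where
  "set_reg r v p = \<lparr>pc = Suc (pc p), regs = (regs p)(r := v)\<rparr>"

fun exec :: "memory \<Rightarrow> instr \<Rightarrow> processor \<Rightarrow> processor" where
  "exec M (Const r c) p = set_reg r c p"
| "exec M (Add r a b) p = set_reg r (regs p a + regs p b) p"
| "exec M (Sub r a b) p = set_reg r (regs p a - regs p b) p"
| "exec M (Half r a) p = set_reg r (regs p a div 2) p"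
| "exec M (Load r a) p = set_reg r (M (regs p a)) p"
| "exec M (Store a b) p = p\<lparr>pc := Suc (pc p)\<rparr>"
| "exec M (JumpZero r l) p = p\<lparr>pc := (if regs p r = 0 then l else Suc (pc p))\<rparr>"

definition proc_step :: "instr list \<Rightarrow> memory \<Rightarrow> processor \<Rightarrow> processor" where
  "proc_step prog M p = (if pc p < length prog then exec M (prog ! pc p) p else p)"

text \<open>The pair (address, value) that a processor writes to the shared memory in this step, if any.\<close>

definition write_request :: "instr list \<Rightarrow> processor \<Rightarrow> (nat \<times> nat) option" where
  "write_request prog p =
    (if pc p < length prog
     then (case prog ! pc p of Store a b \<Rightarrow> Some (regs p a, regs p b) | _ \<Rightarrow> None)
     else None)"

text \<open>
  One synchronous step of processors \<open>0, \<dots>, P - 1\<close>: all reads see the old memory, and of several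
  processors writing to the same address the one with the least index succeeds (priority CRCW).
  The class NC does not depend on the convention for concurrent access.
\<close>

definition pram_step :: "instr list \<Rightarrow> nat \<Rightarrow> pram \<Rightarrow> pram" where
  "pram_step prog P s =
    (let writes = (\<lambda>i a. i < P \<and> (\<exists>v. write_request prog (procs s i) = Some (a, v)))
     in \<lparr>procs = (\<lambda>i. if i < P then proc_step prog (mem s) (procs s i) else procs s i),
         mem = (\<lambda>a. if \<exists>i. writes i a
                     then snd (the (write_request prog (procs s (LEAST i. writes i a))))
                     else mem s a)\<rparr>)"

text \<open>
  Initially, memory cell \<open>i\<close> holds the \<open>i\<close>-th input bit, register 0 of each processor its own index
  and register 1 the input length; everything else is 0.
\<close>

definition pram_init :: "bool list \<Rightarrow> pram" where
  "pram_init w =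
    \<lparr>procs = (\<lambda>i. \<lparr>pc = 0, regs = (\<lambda>_. 0)(0 := i, 1 := length w)\<rparr>),
     mem = (\<lambda>a. if a < length w then of_bool (w ! a) else 0)\<rparr>"

definition pram_halted :: "instr list \<Rightarrow> nat \<Rightarrow> pram \<Rightarrow> bool" where
  "pram_halted prog P s \<longleftrightarrow> (\<forall>i<P. length prog \<le> pc (procs s i))"

definition pram_run :: "instr list \<Rightarrow> nat \<Rightarrow> bool list \<Rightarrow> nat \<Rightarrow> pram" where
  "pram_run prog P w t = (pram_step prog P ^^ t) (pram_init w)"

text \<open>
  One program serves all input lengths.  The number of processors is the explicit polynomial
  \<open>(N + 2)\<^sup>d\<close> rather than an arbitrary polynomially bounded function of the input length \<open>N\<close>,
  which could smuggle in non-uniform advice.  The input is accepted if cell 0 is nonzero on halting.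
\<close>

definition NC :: "bool list set set" where
  "NC = {L. \<exists>prog (d::nat) (c::nat) (k::nat). \<forall>w. \<exists>t.
      real t \<le> real c * log 2 (real (length w) + 2) ^ k \<and>
      (let P = (length w + 2) ^ d; s = pram_run prog P w t
       in pram_halted prog P s \<and> (mem s 0 \<noteq> 0 \<longleftrightarrow> w \<in> L))}"


section \<open>Life-like freezing cellular automata\<close>

text \<open>
  The cells of \<open>G(n)\<close> are given as a list because the encoding of instances below needs an order;
  \<open>birth\<close> is the set of numbers of active neighbors that activate an inactive cell.
\<close>

record 'c life_like =
  cells :: "nat \<Rightarrow> 'c list"
  nbrs :: "nat \<Rightarrow> 'c \<Rightarrow> 'c set"
  birth :: "nat set"

abbreviation G :: "'c life_like \<Rightarrow> nat \<Rightarrow> 'c set" where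
  "G A n \<equiv> set (cells A n)"

text \<open>
  The triangles \<open>(i, j, False)\<close> and \<open>(i, j, True)\<close> are the two halves of the unit rhombus at
  position \<open>(i, j)\<close> of the lattice spanned by two unit vectors at an angle of 60 degrees: the
  triangle with vertices \<open>(i, j)\<close>, \<open>(i + 1, j)\<close>, \<open>(i, j + 1)\<close>, and the one with vertices
  \<open>(i + 1, j)\<close>, \<open>(i, j + 1)\<close>, \<open>(i + 1, j + 1)\<close>.
  The term \<open>i + n - 1\<close> is \<open>i - 1\<close> modulo \<open>n\<close> in natural numbers.
\<close>

fun tri_nbrs :: "nat \<Rightarrow> nat \<times> nat \<times> bool \<Rightarrow> (nat \<times> nat \<times> bool) set" where
  "tri_nbrs n (i, j, False) =
    {(i, j, True), ((i + n - 1) mod n, j, True), (i, (j + n - 1) mod n, True)}"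
| "tri_nbrs n (i, j, True) =
    {(i, j, False), ((i + 1) mod n, j, False), (i, (j + 1) mod n, False)}"

fun sq_nbrs :: "nat \<Rightarrow> nat \<times> nat \<Rightarrow> (nat \<times> nat) set" where
  "sq_nbrs n (i, j) =
    {((i + 1) mod n, j), ((i + n - 1) mod n, j), (i, (j + 1) mod n), (i, (j + n - 1) mod n)}"

text \<open>
  \<open>N(u)\<close> is a set, so on the smallest tori, where opposite neighbors coincide, the common cell
  counts once.  From \<open>n = 2\<close> (triangular) and \<open>n = 3\<close> (square) on, the neighbors are distinct.
\<close>

lemma mod_pred: "i < n \<Longrightarrow> (i + n - 1) mod n = (if i = 0 then n - 1 else i - 1)" for i n :: nat
  by (cases i) simp_all

lemma mod_succ: "i < n \<Longrightarrow> (i + 1) mod n = (if i + 1 = n then 0 else i + 1)" for i n :: nat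
  by simp

lemma card_tri_nbrs:
  assumes "2 \<le> n" "i < n" "j < n"
  shows "card (tri_nbrs n (i, j, b)) = 3"
  using assms
  by (cases b) (simp_all only: tri_nbrs.simps mod_pred mod_succ, auto simp: card_insert_if)

lemma card_sq_nbrs:
  assumes "3 \<le> n" "i < n" "j < n"
  shows "card (sq_nbrs n (i, j)) = 4"
  using assms by (simp only: sq_nbrs.simps mod_pred mod_succ) (auto simp: card_insert_if)

definition T :: "nat \<Rightarrow> nat \<Rightarrow> (nat \<times> nat \<times> bool) life_like" where
  "T k1 k2 =
    \<lparr>cells = (\<lambda>n. List.product [0..<n] (List.product [0..<n] [False, True])),
     nbrs = tri_nbrs, birth = {k1..k2}\<rparr>"

definition S :: "nat \<Rightarrow> nat \<Rightarrow> (nat \<times> nat) life_like" where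
  "S k1 k2 =
    \<lparr>cells = (\<lambda>n. List.product [0..<n] [0..<n]), nbrs = sq_nbrs, birth = {k1..k2}\<rparr>"

lemma card_G_T: "card (G (T k1 k2) n) = 2 * n\<^sup>2"
  by (simp add: T_def card_cartesian_product power2_eq_square)

lemma card_G_S: "card (G (S k1 k2) n) = n\<^sup>2"
  by (simp add: S_def card_cartesian_product power2_eq_square)

definition local_rule :: "'c life_like \<Rightarrow> nat \<Rightarrow> ('c \<Rightarrow> bool) \<Rightarrow> 'c \<Rightarrow> bool" where
  "local_rule A n x u \<longleftrightarrow> x u \<or> (\<Sum>w\<in>nbrs A n u. of_bool (x w)) \<in> birth A"


section \<open>Asynchronous instability\<close>

text \<open>
  Updates take place at times \<open>1, 2, \<dots>\<close>, so these are the steps that are divided into blocks;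
  the value of the scheme at time 0 is never used.
\<close>

definition update_scheme :: "'c life_like \<Rightarrow> nat \<Rightarrow> (nat \<Rightarrow> 'c) \<Rightarrow> bool" where
  "update_scheme A n \<sigma> \<longleftrightarrow>
    range \<sigma> \<subseteq> G A n \<and>
    (\<forall>b. bij_betw \<sigma> {b * card (G A n) + 1 .. (b + 1) * card (G A n)} (G A n))"

primrec async_run :: "'c life_like \<Rightarrow> nat \<Rightarrow> (nat \<Rightarrow> 'c) \<Rightarrow> ('c \<Rightarrow> bool) \<Rightarrow> nat \<Rightarrow> 'c \<Rightarrow> bool" where
  "async_run A n \<sigma> x 0 = x"
| "async_run A n \<sigma> x (Suc t) =
    (let y = async_run A n \<sigma> x t in y(\<sigma> (Suc t) := local_rule A n y (\<sigma> (Suc t))))"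

definition async_unstable :: "'c life_like \<Rightarrow> nat \<Rightarrow> ('c \<Rightarrow> bool) \<Rightarrow> 'c \<Rightarrow> bool" where
  "async_unstable A n x u \<longleftrightarrow>
    (\<exists>\<sigma>. update_scheme A n \<sigma> \<and> (\<exists>t>0. async_run A n \<sigma> x t u \<noteq> x u))"

text \<open>
  An instance is written as \<open>n\<close> in unary, the states of all cells, and the indicator vector of the
  cell \<open>u\<close>.  As the configuration has at least \<open>n\<^sup>2\<close> bits, binary codes for \<open>n\<close> and \<open>u\<close> would change
  the input length only by a constant factor.
\<close>

definition encode_instance :: "'c life_like \<Rightarrow> nat \<Rightarrow> ('c \<Rightarrow> bool) \<Rightarrow> 'c \<Rightarrow> bool list" where
  "encode_instance A n x u =
    replicate n True @ False # map x (cells A n) @ map (\<lambda>v. v = u) (cells A n)"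

definition AsyncUnstability :: "'c life_like \<Rightarrow> bool list set" where
  "AsyncUnstability A =
    {encode_instance A n x u | n x u. u \<in> G A n \<and> async_unstable A n x u}"

end

theory Submission
  imports Defs
begin

text \<open>
  As only finitely many cells change, \<open>u\<close> is unstable iff some order of activations reaches it.  A cell
  whose neighbors are all active cannot help any other cell, so the upper end of the birth interval
  matters only for \<open>u\<close> in the initial configuration, and the problem reduces to membership in the closure
  for a threshold rule.  For \<open>T22\<close>, \<open>T23\<close>, \<open>S33\<close> and \<open>S34\<close> the complement of this closure is the largest
  subgraph of minimum degree two of the inactive cells, which is a reachability question about walks
  without backtracking.  For \<open>S23\<close> and \<open>S24\<close> the closure is a union of rectangles on the torus that
  arise by merging; each is derived by a tree with at most \<open>n\<^sup>2\<close> leaves, and a pebble game evaluates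
  such trees in logarithmically many rounds.  Both are expressible by first-order formulas with
  inductive definitions iterated logarithmically often, and these formulas compile to PRAM programs.
\<close>

section \<open>Synchronous programs\<close>

text \<open>Three obstacles shape the proof. First, the processors have private program counters and
  no multiplication, and one program must serve all lengths. So everything runs in lockstep, with
  loop lengths that depend on the input length alone, and variables range over a power of two
  \<open>ubd w\<close>, which reduces addressing to doubling and halving. As \<open>ubd w\<close> is
  at most \<open>(length w + 2) ^ 2\<close>, a fixed power of \<open>length w + 2\<close> provides a
  processor for every assignment to the variables of a formula. Second, simulating the automaton is
  too slow: peeling off a path of inactive cells, or growing a rectangle line by line, can take
  polynomially many rounds. Walks without backtracking make the peeling a reachability question,
  open to path doubling, and derivation trees can be cut in the middle however deep they are. Third,
  on the torus intervals wrap around and can close up, so the usual bounding boxes are replaced by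
  products of arcs of a cycle; four endpoints describe such a product, which keeps the facts to be
  derived polynomial in number. Tiny tori, where neighbors coincide, need clauses of their
  own.\<close>

text \<open>
  All processors keep a common program counter, so a state consists of the registers
  (indexed by register, then processor) and the memory.  Registers 2, 3 and 4 hold 0, 1
  and the number of iterations of a loop per unit of its multiplier.
\<close>

type_synonym simd = "(nat \<Rightarrow> nat \<Rightarrow> nat) \<times> memory"

text \<open>Processors from \<open>P\<close> on never step; \<open>q\<close> carries their states
  along so that both sides of the simulation are full machine states.\<close>

definition embed :: "nat \<Rightarrow> (nat \<Rightarrow> processor) \<Rightarrow> nat \<Rightarrow> simd \<Rightarrow> pram" where
  "embed P q a s =
    \<lparr>procs = (\<lambda>i. if i < P then \<lparr>pc = a, regs = (\<lambda>r. fst s r i)\<rparr> else q i), mem = snd s\<rparr>"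

fun istep :: "nat \<Rightarrow> instr \<Rightarrow> simd \<Rightarrow> simd" where
  "istep P (Const r c) s = ((fst s)(r := \<lambda>i. c), snd s)"
| "istep P (Add r a b) s = ((fst s)(r := \<lambda>i. fst s a i + fst s b i), snd s)"
| "istep P (Sub r a b) s = ((fst s)(r := \<lambda>i. fst s a i - fst s b i), snd s)"
| "istep P (Half r a) s = ((fst s)(r := \<lambda>i. fst s a i div 2), snd s)"
| "istep P (Load r a) s = ((fst s)(r := \<lambda>i. snd s (fst s a i)), snd s)"
| "istep P (Store a b) s =
    (fst s, \<lambda>x. if \<exists>i<P. fst s a i = x then fst s b (LEAST i. i < P \<and> fst s a i = x) else snd s x)"
| "istep P (JumpZero r l) s = s"

fun is_jump :: "instr \<Rightarrow> bool" where
  "is_jump (JumpZero r l) = True"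
| "is_jump _ = False"

lemma pram_step_istep:
  assumes "a < length prog" "\<not> is_jump (prog ! a)"
  shows "pram_step prog P (embed P q a s) = embed P q (Suc a) (istep P (prog ! a) s)"
proof (cases "prog ! a")
  case (Store x y)
  have "write_request prog (procs (embed P q a s) i) = Some (b, v) \<longleftrightarrow>
      b = fst s x i \<and> v = fst s y i" if "i < P" for i b v
    using that assms Store by (auto simp: write_request_def embed_def)
  then have "(i < P \<and> (\<exists>v. write_request prog (procs (embed P q a s) i) = Some (b, v))) \<longleftrightarrow>
      i < P \<and> fst s x i = b" for i b
    by auto
  note w = this
  have l: "snd (the (write_request prog (procs (embed P q a s) (LEAST i. i < P \<and> fst s x i = b))))
      = fst s y (LEAST i. i < P \<and> fst s x i = b)" if "\<exists>i<P. fst s x i = b" for b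
  proof -
    have "(LEAST i. i < P \<and> fst s x i = b) < P"
      using that by (metis (mono_tags, lifting) LeastI)
    then show ?thesis
      using assms Store by (simp add: write_request_def embed_def)
  qed
  show ?thesis
    unfolding pram_step_def Let_def w
    using assms Store l by (auto simp: embed_def proc_step_def fun_eq_iff)
qed (use assms in \<open>auto simp: pram_step_def embed_def proc_step_def write_request_def set_reg_def
  fun_eq_iff cong: if_cong\<close>)

text \<open>Control depends on data only here. Since the tested register has the same value in all
  processors, the common program counter survives the jump.\<close>

lemma pram_step_jump:
  assumes "a < length prog" "prog ! a = JumpZero r l" "\<And>i. fst s r i = v"
  shows "pram_step prog P (embed P q a s) = embed P q (if v = 0 then l else Suc a) s"
  using assms
  by (auto simp: pram_step_def embed_def proc_step_def write_request_def fun_eq_iff cong: if_cong)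

datatype cmd =
    Blk "instr list"
  | Seq cmd cmd (infixr ";;" 60)
  | Loop nat nat cmd

fun len :: "cmd \<Rightarrow> nat" where
  "len (Blk bs) = length bs"
| "len (c ;; d) = len c + len d"
| "len (Loop n r c) = n + len c + 4"

text \<open>The counter \<open>n * k\<close> is built by \<open>n\<close> additions of register 4,
  as there is no multiplication. \<open>JumpZero 2\<close> is an unconditional jump because register
  2 holds 0.\<close>

fun compile :: "nat \<Rightarrow> cmd \<Rightarrow> instr list" where
  "compile a (Blk bs) = bs"
| "compile a (c ;; d) = compile a c @ compile (a + len c) d"
| "compile a (Loop n r c) =
    Const r 0 # replicate n (Add r r 4) @
    JumpZero r (a + n + len c + 4) # compile (a + n + 2) c @ [Sub r r 3, JumpZero 2 (a + n + 1)]"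

fun run :: "nat \<Rightarrow> nat \<Rightarrow> cmd \<Rightarrow> simd \<Rightarrow> simd" where
  "run P k (Blk bs) s = fold (istep P) bs s"
| "run P k (c ;; d) s = run P k d (run P k c s)"
| "run P k (Loop n r c) s =
    ((\<lambda>s. istep P (Sub r r 3) (run P k c s)) ^^ (n * k)) ((fst s)(r := \<lambda>i. n * k), snd s)"

fun cost :: "nat \<Rightarrow> cmd \<Rightarrow> nat" where
  "cost k (Blk bs) = length bs"
| "cost k (c ;; d) = cost k c + cost k d"
| "cost k (Loop n r c) = n + 2 + (n * k) * (cost k c + 3)"

fun target :: "instr \<Rightarrow> nat set" where
  "target (Const r c) = {r}"
| "target (Add r a b) = {r}"
| "target (Sub r a b) = {r}"
| "target (Half r a) = {r}"
| "target (Load r a) = {r}"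
| "target (Store a b) = {}"
| "target (JumpZero r l) = {}"

fun targets :: "cmd \<Rightarrow> nat set" where
  "targets (Blk bs) = (\<Union>i\<in>set bs. target i)"
| "targets (c ;; d) = targets c \<union> targets d"
| "targets (Loop n r c) = insert r (targets c)"

fun wf_cmd :: "cmd \<Rightarrow> bool" where
  "wf_cmd (Blk bs) \<longleftrightarrow> (\<forall>i\<in>set bs. \<not> is_jump i)"
| "wf_cmd (c ;; d) \<longleftrightarrow> wf_cmd c \<and> wf_cmd d"
| "wf_cmd (Loop n r c) \<longleftrightarrow> wf_cmd c \<and> r \<notin> targets c"

lemma length_compile [simp]: "length (compile a c) = len c"
  by (induction a c rule: compile.induct) auto

lemma istep_frame: "r \<notin> target i \<Longrightarrow> fst (istep P i s) r = fst s r"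
  by (cases i) auto

lemma fold_istep_frame:
  "r \<notin> (\<Union>i\<in>set bs. target i) \<Longrightarrow> fst (fold (istep P) bs s) r = fst s r"
  by (induction bs arbitrary: s) (auto simp: istep_frame)

lemma run_frame: "r \<notin> targets c \<Longrightarrow> fst (run P k c s) r = fst s r"
proof (induction c arbitrary: s)
  case (Blk bs)
  then show ?case by (simp add: fold_istep_frame)
next
  case (Loop n x c)
  have "fst (((\<lambda>s. istep P (Sub x x 3) (run P k c s)) ^^ j) s') r = fst s' r" for j s'
    by (induction j) (use Loop in auto)
  then show ?case using Loop by simp
qed auto

definition std :: "nat \<Rightarrow> simd \<Rightarrow> bool" where
  "std k s \<longleftrightarrow> fst s 2 = (\<lambda>_. 0) \<and> fst s 3 = (\<lambda>_. 1) \<and> fst s 4 = (\<lambda>_. k)"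

lemma std_run: "std k s \<Longrightarrow> {2, 3, 4} \<inter> targets c = {} \<Longrightarrow> std k (run P k' c s)"
  by (auto simp: std_def run_frame)

definition code_at :: "instr list \<Rightarrow> nat \<Rightarrow> instr list \<Rightarrow> bool" where
  "code_at prog a bs \<longleftrightarrow> a + length bs \<le> length prog \<and> (\<forall>i<length bs. prog ! (a + i) = bs ! i)"

lemma code_at_append:
  "code_at prog a (bs @ js) \<longleftrightarrow> code_at prog a bs \<and> code_at prog (a + length bs) js"
proof -
  have *: "(\<forall>i<length (bs @ js). prog ! (a + i) = (bs @ js) ! i) \<longleftrightarrow>
    (\<forall>i<length bs. prog ! (a + i) = bs ! i) \<and> (\<forall>i<length js. prog ! (a + length bs + i) = js ! i)"
    (is "?L = (?A \<and> ?B)")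
  proof safe
    fix i assume "?L" "i < length js"
    then show "prog ! (a + length bs + i) = js ! i"
      by (metis (no_types, lifting) add.assoc length_append nat_add_left_cancel_less nth_append_length_plus)
  next
    fix i assume ?L "i < length bs"
    then show "prog ! (a + i) = bs ! i" by (metis length_append nth_append trans_less_add1)
  next
    fix i assume ab: ?A ?B and i: "i < length (bs @ js)"
    show "prog ! (a + i) = (bs @ js) ! i"
    proof (cases "i < length bs")
      case True then show ?thesis using ab by (simp add: nth_append)
    next
      case False
      then have "i - length bs < length js" using i by auto
      with ab(2) have "prog ! (a + length bs + (i - length bs)) = js ! (i - length bs)" by blast
      then show ?thesis using False by (simp add: nth_append)
    qed
  qed
  show ?thesis unfolding code_at_def * by auto
qed

lemma code_at_Cons:
  "code_at prog a (i # bs) \<longleftrightarrow> a < length prog \<and> prog ! a = i \<and> code_at prog (Suc a) bs"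
  using code_at_append[of prog a "[i]" bs] by (auto simp: code_at_def)

lemma steps_blk:
  assumes "code_at prog a bs" "\<forall>i\<in>set bs. \<not> is_jump i"
  shows "(pram_step prog P ^^ length bs) (embed P q a s) =
    embed P q (a + length bs) (fold (istep P) bs s)"
  using assms
proof (induction bs arbitrary: a s)
  case (Cons i bs)
  then have "pram_step prog P (embed P q a s) = embed P q (Suc a) (istep P i s)"
    by (metis code_at_Cons list.set_intros(1) pram_step_istep)
  then show ?case
    using Cons by (simp add: funpow_swap1 code_at_Cons del: funpow.simps add: funpow_Suc_right)
qed simp

text \<open>The running time is an exact function of \<open>k\<close>, independent of the data, so
  no processor ever waits for another one.\<close>

lemma steps_compile:
  assumes "wf_cmd c" "code_at prog a (compile a c)" "std k s" "{2, 3, 4} \<inter> targets c = {}"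
  shows "(pram_step prog P ^^ cost k c) (embed P q a s) = embed P q (a + len c) (run P k c s)"
  using assms
proof (induction c arbitrary: a s)
  case (Blk bs)
  then show ?case by (simp add: steps_blk)
next
  case (Seq c d)
  have "(pram_step prog P ^^ cost k c) (embed P q a s) = embed P q (a + len c) (run P k c s)"
    using Seq.prems by (intro Seq.IH(1)) (auto simp: code_at_append)
  moreover have "(pram_step prog P ^^ cost k d) (embed P q (a + len c) (run P k c s)) =
      embed P q (a + len c + len d) (run P k d (run P k c s))"
    using Seq.prems by (intro Seq.IH(2)) (auto simp: code_at_append intro!: std_run)
  ultimately show ?case
    by (simp add: funpow_add add.commute[of "cost k c"] add.assoc)
next
  case (Loop n r c)
  let ?st = "pram_step prog P"
  let ?b = "\<lambda>s. istep P (Sub r r 3) (run P k c s)"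
  from Loop.prems have r: "r \<notin> targets c" "r \<noteq> 2" "r \<noteq> 3" "r \<noteq> 4"
    and c: "wf_cmd c" "{2, 3, 4} \<inter> targets c = {}" by auto
  from Loop.prems(2)
  have code: "code_at prog a (Const r 0 # replicate n (Add r r 4))"
    "a + n + 1 < length prog" "prog ! (a + n + 1) = JumpZero r (a + n + len c + 4)"
    "code_at prog (a + n + 2) (compile (a + n + 2) c)"
    "code_at prog (a + n + 2 + len c) [Sub r r 3]"
    "a + n + len c + 3 < length prog" "prog ! (a + n + len c + 3) = JumpZero 2 (a + n + 1)"
    by (auto simp: code_at_append code_at_Cons numeral_eq_Suc) (simp add: code_at_def)
  have adds: "fold (istep P) (replicate j (Add r r 4)) (V(r := \<lambda>i. x), M) = (V(r := \<lambda>i. x + j * k), M)"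
    if "V 4 = (\<lambda>_. k)" for j x V M
    using r that by (induction j arbitrary: x) (auto simp: add.assoc add.commute)
  have s: "fst s 4 = (\<lambda>_. k)" using Loop.prems(3) by (simp add: std_def)
  have start: "(?st ^^ (n + 1)) (embed P q a s) = embed P q (a + n + 1) ((fst s)(r := \<lambda>i. n * k), snd s)"
    using steps_blk[OF code(1), of P q s] adds[of "fst s" n 0 "snd s"] s by simp
  \<comment> \<open>An iteration adds three instructions to the body: test, decrement and jump back.
    The last summand 1 is the test that leaves the loop.\<close>
  have loop: "(?st ^^ (j * (cost k c + 3) + 1)) (embed P q (a + n + 1) s) =
      embed P q (a + n + len c + 4) ((?b ^^ j) s)"
    if "fst s r = (\<lambda>_. j)" "std k s" for j s
    using that
  proof (induction j arbitrary: s)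
    case 0
    then show ?case using pram_step_jump[OF code(2,3), of s 0 P q] by simp
  next
    case (Suc j)
    have 1: "?st (embed P q (a + n + 1) s) = embed P q (a + n + 2) s"
      using pram_step_jump[OF code(2,3), of s "Suc j" P q] Suc.prems by simp
    have 2: "(?st ^^ cost k c) (embed P q (a + n + 2) s) = embed P q (a + n + 2 + len c) (run P k c s)"
      using c code Suc.prems by (intro Loop.IH) auto
    have 3: "?st (embed P q (a + n + 2 + len c) (run P k c s)) = embed P q (a + n + len c + 3) (?b s)"
      using steps_blk[OF code(5), of P q "run P k c s"] by (simp add: numeral_eq_Suc)
    have st: "std k (run P k c s)" using Suc.prems c by (intro std_run) auto
    then have st': "std k (?b s)" using r by (auto simp: std_def)
    have 4: "?st (embed P q (a + n + len c + 3) (?b s)) = embed P q (a + n + 1) (?b s)"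
      using pram_step_jump[OF code(6,7), of "?b s" 0 P q] st' by (simp add: std_def)
    have "fst (run P k c s) r = (\<lambda>_. Suc j)" using Suc.prems r by (simp add: run_frame)
    then have "fst (?b s) r = (\<lambda>_. j)" using st by (simp add: std_def)
    from Suc.IH[OF this st']
    have 5: "(?st ^^ (j * (cost k c + 3) + 1)) (embed P q (a + n + 1) (?b s)) =
        embed P q (a + n + len c + 4) ((?b ^^ j) (?b s))" .
    have e: "Suc j * (cost k c + 3) + 1 = (j * (cost k c + 3) + 1) + (1 + (1 + (cost k c + 1)))"
      by simp
    have "(?st ^^ (Suc j * (cost k c + 3) + 1)) (embed P q (a + n + 1) s) =
        (?st ^^ (j * (cost k c + 3) + 1)) (?st (?st ((?st ^^ cost k c) (?st (embed P q (a + n + 1) s)))))"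
      unfolding e funpow_add by simp
    also have "\<dots> = embed P q (a + n + len c + 4) ((?b ^^ j) (?b s))"
      unfolding 1 2 3 4 5 ..
    finally show ?case unfolding funpow_Suc_right comp_apply .
  qed
  have "cost k (Loop n r c) = (n * k * (cost k c + 3) + 1) + (n + 1)" by simp
  then have "(?st ^^ cost k (Loop n r c)) (embed P q a s) =
      (?st ^^ (n * k * (cost k c + 3) + 1)) ((?st ^^ (n + 1)) (embed P q a s))"
    by (simp only: funpow_add comp_apply)
  also have "\<dots> = embed P q (a + n + len c + 4) ((?b ^^ (n * k)) ((fst s)(r := \<lambda>i. n * k), snd s))"
    unfolding start using Loop.prems(3) r by (intro loop) (auto simp: std_def)
  finally show ?case by (simp add: add.assoc)
qed

text \<open>The nesting depth of loops is fixed by the command, and each level raises the degree by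
  one. With \<open>k\<close> logarithmic this becomes polylogarithmic time.\<close>

lemma cost_poly: "\<exists>C D. \<forall>k. cost k c \<le> C * (k + 1) ^ D"
proof (induction c)
  case (Blk bs)
  then show ?case by (intro exI[of _ "length bs"] exI[of _ 0]) simp
next
  case (Seq c d)
  then obtain C D C' D' where *: "cost k c \<le> C * (k + 1) ^ D" "cost k d \<le> C' * (k + 1) ^ D'" for k
    by blast
  have "cost k (c ;; d) \<le> (C + C') * (k + 1) ^ (D + D')" for k
  proof -
    have "C * (k + 1) ^ D \<le> C * (k + 1) ^ (D + D')" "C' * (k + 1) ^ D' \<le> C' * (k + 1) ^ (D + D')"
      by (intro mult_left_mono power_increasing; simp)+
    then show ?thesis using *[of k] unfolding cost.simps add_mult_distrib by linarith
  qed
  then show ?case by blast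
next
  case (Loop n r c)
  then obtain C D where *: "cost k c \<le> C * (k + 1) ^ D" for k by blast
  have "cost k (Loop n r c) \<le> (n + 2 + n * (C + 3)) * (k + 1) ^ Suc D" for k
  proof -
    have "1 \<le> (k + 1) ^ D" by simp
    then have "cost k c + 3 \<le> (C + 3) * (k + 1) ^ D"
      using *[of k] unfolding add_mult_distrib by linarith
    then have "(n * k) * (cost k c + 3) \<le> (n * (k + 1)) * ((C + 3) * (k + 1) ^ D)"
      by (intro mult_mono) auto
    moreover have "(n + 2) * 1 \<le> (n + 2) * (k + 1) ^ Suc D"
      by (intro mult_le_mono2 one_le_power) simp
    ultimately show ?thesis by (simp add: algebra_simps)
  qed
  then show ?case by blast
qed

section \<open>Formulas with logarithmically iterated inductive definitions\<close>

fun bitlen :: "nat \<Rightarrow> nat" where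
  "bitlen n = (if n = 0 then 0 else Suc (bitlen (n div 2)))"

declare bitlen.simps [simp del]

lemma less_bitlen: "n < 2 ^ bitlen n"
  by (induction n rule: bitlen.induct) (subst bitlen.simps, auto)

lemma bitlen_le: "0 < n \<Longrightarrow> 2 ^ bitlen n \<le> 2 * n"
proof (induction n rule: bitlen.induct)
  case (1 n)
  show ?case
  proof (cases "n div 2 = 0")
    case True
    then have "n = 1" using 1 by auto
    then show ?thesis by (simp add: bitlen.simps)
  next
    case False
    then have "2 ^ bitlen (n div 2) \<le> 2 * (n div 2)" using 1 by auto
    moreover have "2 * (n div 2) \<le> n" by simp
    ultimately show ?thesis using 1 by (subst bitlen.simps) auto
  qed
qed

text \<open>With \<open>length w + 1\<close> the universe below \<open>2 ^ lg w\<close> contains all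
  positions of the word and also \<open>length w\<close> itself, which is needed to talk about the
  length and serves as a sentinel.\<close>

definition lg :: "bool list \<Rightarrow> nat" where
  "lg w = bitlen (length w + 1)"

abbreviation ubd :: "bool list \<Rightarrow> nat" where
  "ubd w \<equiv> 2 ^ lg w"

lemma length_less_ubd: "length w + 1 < ubd w"
  unfolding lg_def by (rule less_bitlen)

text \<open>Variables are de Bruijn indices. The body of a \<open>Fix\<close> sees only its own
  arguments and its own relation, neither outer variables nor an outer relation. Multiplication is
  not primitive; it is obtained below as a fixed point.\<close>

datatype fm =
    Plus nat nat nat
  | Is nat nat
  | Len nat
  | Bit nat
  | Nand fm fm
  | Ex fm
  | Rel "nat list"
  | Fix nat fm "nat list"

definition pad :: "nat list \<Rightarrow> nat \<Rightarrow> nat" where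
  "pad xs v = (if v < length xs then xs ! v else 0)"

text \<open>
  \<open>Fix\<close> need not reach a fixed point: it stops after logarithmically many rounds, which keeps the
  evaluation of formulas polylogarithmic.
\<close>

primrec eval :: "fm \<Rightarrow> bool list \<Rightarrow> (nat list \<Rightarrow> bool) \<Rightarrow> (nat \<Rightarrow> nat) \<Rightarrow> bool" where
  "eval (Plus a b c) w X e \<longleftrightarrow> e a + e b = e c"
| "eval (Is a c) w X e \<longleftrightarrow> e a = c"
| "eval (Len a) w X e \<longleftrightarrow> e a = length w"
| "eval (Bit a) w X e \<longleftrightarrow> e a < length w \<and> w ! e a"
| "eval (Nand f g) w X e \<longleftrightarrow> \<not> (eval f w X e \<and> eval g w X e)"
| "eval (Ex f) w X e \<longleftrightarrow> (\<exists>x<ubd w. eval f w X (case_nat x e))"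
| "eval (Rel vs) w X e \<longleftrightarrow> X (map e vs)"
| "eval (Fix c f vs) w X e \<longleftrightarrow>
    ((\<lambda>Y xs. eval f w Y (pad xs)) ^^ (c * lg w)) (\<lambda>_. False) (map e vs)"

primrec arity_ok :: "fm \<Rightarrow> nat \<Rightarrow> bool" where
  "arity_ok (Plus a b c) p \<longleftrightarrow> True"
| "arity_ok (Is a c) p \<longleftrightarrow> True"
| "arity_ok (Len a) p \<longleftrightarrow> True"
| "arity_ok (Bit a) p \<longleftrightarrow> True"
| "arity_ok (Nand f g) p \<longleftrightarrow> arity_ok f p \<and> arity_ok g p"
| "arity_ok (Ex f) p \<longleftrightarrow> arity_ok f p"
| "arity_ok (Rel vs) p \<longleftrightarrow> length vs = p"
| "arity_ok (Fix c f vs) p \<longleftrightarrow> arity_ok f (length vs)"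

text \<open>The number of digits that a processor index needs: one per variable in scope, and enough
  for the argument tuples of relations. A \<open>Fix\<close> restarts the count, because its body
  forgets the outer variables.\<close>

primrec width :: "fm \<Rightarrow> nat \<Rightarrow> nat" where
  "width (Plus a b c) l = l"
| "width (Is a c) l = l"
| "width (Len a) l = l"
| "width (Bit a) l = l"
| "width (Nand f g) l = max (width f l) (width g l)"
| "width (Ex f) l = width f (Suc l)"
| "width (Rel vs) l = max l (length vs)"
| "width (Fix c f vs) l = max l (width f (length vs))"

lemma width_ge: "l \<le> width f l"
  by (induction f arbitrary: l) (auto intro: Suc_leD simp: le_max_iff_disj)

section \<open>Tuples as numbers in base K, least significant digit first\<close>

definition hval :: "nat \<Rightarrow> nat list \<Rightarrow> nat" where
  "hval K xs = foldr (\<lambda>x a. a * K + x) xs 0"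

lemma hval_simps [simp]: "hval K [] = 0" "hval K (x # xs) = hval K xs * K + x"
  by (simp_all add: hval_def)

definition dig :: "nat \<Rightarrow> nat \<Rightarrow> nat \<Rightarrow> nat" where
  "dig K i j = i div K ^ j mod K"

lemma hval_less: "(\<And>x. x \<in> set xs \<Longrightarrow> x < K) \<Longrightarrow> hval K xs < K ^ length xs"
proof (induction xs)
  case (Cons x xs)
  then have "hval K xs + 1 \<le> K ^ length xs" "x < K" by (auto simp: Suc_leI)
  then have "(hval K xs + 1) * K \<le> K ^ length xs * K" by (intro mult_le_mono1)
  then show ?case using \<open>x < K\<close> by (simp add: algebra_simps)
qed simp

lemma dig_hval:
  "(\<And>x. x \<in> set xs \<Longrightarrow> x < K) \<Longrightarrow> 0 < K \<Longrightarrow> dig K (hval K xs) j = pad xs j"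
proof (induction xs arbitrary: j)
  case (Cons x xs)
  then have "(hval K xs * K + x) div K = hval K xs" by simp
  moreover have "(hval K xs * K + x) mod K = x" using Cons by simp
  ultimately show ?case using Cons
    by (cases j) (auto simp: dig_def pad_def div_mult2_eq)
qed (simp add: dig_def pad_def)

lemma hval_digs: "hval K (map (dig K i) [0..<m]) = i mod K ^ m"
proof (induction m arbitrary: i)
  case (Suc m)
  have "map (dig K i) [0..<Suc m] = dig K i 0 # map (dig K (i div K)) [0..<m]"
    by (simp add: map_upt_Suc dig_def div_mult2_eq del: upt_Suc)
  then have "hval K (map (dig K i) [0..<Suc m]) = hval K (map (dig K (i div K)) [0..<m]) * K + i mod K"
    by (simp only: hval_simps) (simp add: dig_def)
  also have "\<dots> = i mod K ^ Suc m"
    unfolding Suc by (simp add: mod_mult2_eq mult.commute)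
  finally show ?case .
qed simp

lemma hval_inj:
  assumes "hval K xs = hval K ys" "length xs = length ys"
    "\<And>x. x \<in> set xs \<Longrightarrow> x < K" "\<And>x. x \<in> set ys \<Longrightarrow> x < K"
  shows "xs = ys"
  using assms
proof (induction xs arbitrary: ys)
  case (Cons x xs)
  then obtain y ys' where ys: "ys = y # ys'" by (cases ys) auto
  then have e: "hval K xs * K + x = hval K ys' * K + y" "x < K" "y < K" using Cons by auto
  have "x = y" using arg_cong[OF e(1), of "\<lambda>z. z mod K"] e(2,3) by simp
  then have "hval K xs = hval K ys'" using e by auto
  then show ?case using Cons \<open>x = y\<close> ys by auto
qed simp


section \<open>Compilation of formulas\<close>

text \<open>Horner's scheme; the multiplication by the base \<open>2 ^ k\<close> is a loop of
  \<open>k\<close> doublings.\<close>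

fun addr :: "nat list \<Rightarrow> cmd" where
  "addr [] = Blk [Const 6 0]"
| "addr (r # rs) = addr rs ;; Loop 1 7 (Blk [Add 6 6 6]) ;; Blk [Add 6 6 r]"

definition base :: "nat \<Rightarrow> instr list" where
  "base d = replicate (d + 2) (Add 6 6 5)"

definition look :: "nat list \<Rightarrow> nat \<Rightarrow> nat \<Rightarrow> cmd" where
  "look rs d t = addr rs ;; Blk (base d @ [Load t 6])"

definition put :: "nat list \<Rightarrow> nat \<Rightarrow> nat \<Rightarrow> cmd" where
  "put rs d b = addr rs ;; Blk (base d @ [Store 6 b])"

abbreviation var :: "nat list \<Rightarrow> nat \<Rightarrow> nat" where
  "var ctx v \<equiv> if v < length ctx then 10 + ctx ! v else 2"

abbreviation own :: "nat \<Rightarrow> nat list" where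
  "own m \<equiv> map ((+) 10) [0..<m]"

text \<open>
  Register 5 holds the block size \<open>2 * K ^ m\<close> of the memory, where \<open>K = ubd w\<close>, and the registers
  from 10 on hold the \<open>m\<close> digits of the processor index in base \<open>K\<close>, which are the values of the
  variables.  Block 0 of the memory is the input, and block \<open>d + 2\<close> holds the relation at
  nesting depth \<open>d\<close>.  Block 1 is used for quantifiers: witnesses write to odd and the others to
  even addresses, so that no conditional write is needed.
\<close>

primrec code :: "fm \<Rightarrow> nat \<Rightarrow> nat \<Rightarrow> nat list \<Rightarrow> nat \<Rightarrow> cmd" where
  "code (Plus a b c) m d ctx t =
    Blk [Add 6 (var ctx a) (var ctx b), Sub 7 6 (var ctx c), Sub 8 (var ctx c) 6, Add 7 7 8, Sub t 3 7]"
| "code (Is a c) m d ctx t =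
    Blk [Const 6 c, Sub 7 (var ctx a) 6, Sub 8 6 (var ctx a), Add 7 7 8, Sub t 3 7]"
| "code (Len a) m d ctx t =
    Blk [Sub 7 (var ctx a) 1, Sub 8 1 (var ctx a), Add 7 7 8, Sub t 3 7]"
| "code (Bit a) m d ctx t = Blk [Load t (var ctx a)]"
| "code (Nand f g) m d ctx t =
    code f m d ctx t ;; code g m d ctx (t + 1) ;; Blk [Add 6 t (t + 1), Sub 6 6 3, Sub t 3 6]"
| "code (Ex f) m d ctx t =
    code f m d (length ctx # ctx) t ;;
    addr (map (\<lambda>j. if j = length ctx then 2 else 10 + j) [0..<m]) ;;
    Blk [Add 6 6 6, Add 6 6 5, Add 7 6 3, Store 7 2, Add 8 6 t, Store 8 3, Load t 7]"
| "code (Rel vs) m d ctx t = look (map (var ctx) vs) d t"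
| "code (Fix c f vs) m d ctx t =
    put (own m) (d + 1) 2 ;;
    Loop c t (code f m (d + 1) [0..<length vs] (t + 1) ;; put (own m) (d + 1) (t + 1)) ;;
    look (map (var ctx) vs) (d + 1) t"

lemma targets_addr: "targets (addr rs) \<subseteq> {6, 7}"
  by (induction rs) auto

lemma wf_addr [simp]: "wf_cmd (addr rs)"
  by (induction rs) auto

lemma targets_look: "targets (look rs d t) \<subseteq> {6, 7, t}"
  using targets_addr[of rs] by (auto simp: look_def base_def)

lemma targets_put: "targets (put rs d b) \<subseteq> {6, 7}"
  using targets_addr[of rs] by (auto simp: put_def base_def)

lemma wf_look [simp]: "wf_cmd (look rs d t)"
  by (auto simp: look_def base_def)

lemma wf_put [simp]: "wf_cmd (put rs d t)"
  by (auto simp: put_def base_def)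

lemma targets_code: "targets (code f m d ctx t) \<subseteq> {6, 7, 8} \<union> {t..}"
proof (induction f arbitrary: d ctx t)
  case (Nand f g)
  show ?case using Nand.IH(1)[of d ctx t] Nand.IH(2)[of d ctx "t + 1"] by auto
next
  case (Ex f)
  show ?case using Ex[of d "length ctx # ctx" t]
      targets_addr[of "map (\<lambda>j. if j = length ctx then 2 else 10 + j) [0..<m]"] by auto
next
  case (Rel vs)
  show ?case using targets_look by fastforce
next
  case (Fix c f vs)
  show ?case using Fix[of "d + 1" "[0..<length vs]" "t + 1"] targets_put[of "own m" "d + 1"]
      targets_look[of "map (var ctx) vs" "d + 1" t] by fastforce
qed auto

lemma wf_code: "10 \<le> t \<Longrightarrow> wf_cmd (code f m d ctx t)"
proof (induction f arbitrary: d ctx t)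
  case (Fix c f vs)
  have "t \<notin> targets (code f m (d + 1) [0..<length vs] (t + 1))"
    using targets_code[of f m "d + 1" "[0..<length vs]" "t + 1"] Fix.prems by auto
  moreover have "t \<notin> targets (put (own m) (d + 1) (t + 1))"
    using targets_put[of "own m" "d + 1" "t + 1"] Fix.prems by auto
  ultimately show ?case using Fix by auto
qed auto

lemma run_addr:
  assumes "set rs \<inter> {6, 7} = {}"
  shows "fst (run P k (addr rs) s) 6 = (\<lambda>i. hval (2 ^ k) (map (\<lambda>r. fst s r i) rs)) \<and>
    snd (run P k (addr rs) s) = snd s"
  using assms
proof (induction rs)
  case (Cons r rs)
  have *: "fst (((\<lambda>s. istep P (Sub 7 7 3) (run P k (Blk [Add 6 6 6]) s)) ^^ j) s) 6 = (\<lambda>i. fst s 6 i * 2 ^ j) \<and>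
    snd (((\<lambda>s. istep P (Sub 7 7 3) (run P k (Blk [Add 6 6 6]) s)) ^^ j) s) = snd s" for j s
    by (induction j) auto
  have 1: "fst (run P k (Loop 1 7 (Blk [Add 6 6 6])) s) 6 = (\<lambda>i. fst s 6 i * 2 ^ k)"
    "snd (run P k (Loop 1 7 (Blk [Add 6 6 6])) s) = snd s" for s
    using *[of k "((fst s)(7 := \<lambda>i. 1 * k), snd s)"] by simp_all
  have r: "r \<notin> targets (addr rs ;; Loop 1 7 (Blk [Add 6 6 6]))"
    using Cons.prems targets_addr[of rs] by auto
  have 2: "fst (run P k (addr rs ;; Loop 1 7 (Blk [Add 6 6 6])) s) r = fst s r"
    by (rule run_frame[OF r])
  show ?case
    using Cons 1[of "run P k (addr rs) s"] 2 by (simp add: fun_eq_iff del: run.simps(3))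
qed simp

lemma fold_base:
  "fst s 5 = (\<lambda>_. U) \<Longrightarrow>
    fold (istep P) (base d) s = ((fst s)(6 := \<lambda>i. (d + 2) * U + fst s 6 i), snd s)"
proof -
  have "fst s 5 = (\<lambda>_. U) \<Longrightarrow> fold (istep P) (replicate n (Add 6 6 5)) s =
      ((fst s)(6 := \<lambda>i. n * U + fst s 6 i), snd s)" for n
    by (induction n arbitrary: s) (auto simp: algebra_simps)
  then show "fst s 5 = (\<lambda>_. U) \<Longrightarrow> ?thesis" by (simp only: base_def)
qed

lemma run_look:
  assumes "set rs \<inter> {6, 7} = {}" "fst s 5 = (\<lambda>_. U)"
  shows "fst (run P k (look rs d t) s) t =
      (\<lambda>i. snd s ((d + 2) * U + hval (2 ^ k) (map (\<lambda>r. fst s r i) rs)))"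
    and "snd (run P k (look rs d t) s) = snd s"
proof -
  have "5 \<notin> targets (addr rs)" using targets_addr[of rs] by auto
  then have "fst (run P k (addr rs) s) 5 = (\<lambda>_. U)" using assms by (simp add: run_frame)
  note b = fold_base[OF this, of P d]
  show "fst (run P k (look rs d t) s) t =
      (\<lambda>i. snd s ((d + 2) * U + hval (2 ^ k) (map (\<lambda>r. fst s r i) rs)))"
    and "snd (run P k (look rs d t) s) = snd s"
    using run_addr[OF assms(1), of P k s] b by (simp_all add: look_def)
qed

text \<open>Concurrent writes are consistent: the value is a function \<open>g\<close> of the
  address, so the identity of the winning processor does not matter.\<close>

lemma Least_value:
  fixes P :: nat
  assumes "\<exists>i<P. a i = x" "\<And>i. i < P \<Longrightarrow> b i = g (a i)"
  shows "b (LEAST i. i < P \<and> a i = x) = g x"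
  using LeastI_ex[OF assms(1)] assms(2) by simp

lemma run_put:
  assumes "set rs \<inter> {6, 7} = {}" "fst s 5 = (\<lambda>_. U)" "b \<notin> {6, 7}"
    and "\<And>i. fst s b i = g (hval (2 ^ k) (map (\<lambda>r. fst s r i) rs))"
  shows "snd (run P k (put rs d b) s) x =
    (if \<exists>i<P. (d + 2) * U + hval (2 ^ k) (map (\<lambda>r. fst s r i) rs) = x
     then g (x - (d + 2) * U) else snd s x)"
proof -
  have "5 \<notin> targets (addr rs)" using targets_addr[of rs] by auto
  then have "fst (run P k (addr rs) s) 5 = (\<lambda>_. U)" using assms by (simp add: run_frame)
  note b = fold_base[OF this, of P d]
  have "b \<notin> targets (addr rs)" using assms(3) targets_addr[of rs] by auto
  then have v: "fst (run P k (addr rs) s) b = fst s b" by (simp add: run_frame)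
  have g: "fst s b (LEAST i. i < P \<and> (d + 2) * U + hval (2 ^ k) (map (\<lambda>r. fst s r i) rs) = x) =
      g (x - (d + 2) * U)"
    if "\<exists>i<P. (d + 2) * U + hval (2 ^ k) (map (\<lambda>r. fst s r i) rs) = x"
    by (rule Least_value[OF that, where g = "\<lambda>x. g (x - (d + 2) * U)"]) (simp add: assms(4))
  show ?thesis
    using run_addr[OF assms(1), of P k s] b v assms(3) g by (auto simp: put_def)
qed

text \<open>\<open>ctx ! v\<close> is the digit position that holds variable \<open>v\<close>. The
  default 0 agrees with register 2, which \<open>var\<close> uses for variables out of
  scope.\<close>

definition env :: "nat \<Rightarrow> nat list \<Rightarrow> nat \<Rightarrow> nat \<Rightarrow> nat" where
  "env K ctx i v = (if v < length ctx then dig K i (ctx ! v) else 0)"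

definition good :: "bool list \<Rightarrow> nat \<Rightarrow> simd \<Rightarrow> bool" where
  "good w m s \<longleftrightarrow> std (lg w) s \<and> fst s 1 = (\<lambda>_. length w) \<and> fst s 5 = (\<lambda>_. 2 * ubd w ^ m) \<and>
    (\<forall>j<m. fst s (10 + j) = (\<lambda>i. dig (ubd w) i j)) \<and>
    (\<forall>a<2 * ubd w ^ m. snd s a = of_bool (a < length w \<and> w ! a))"

definition region :: "bool list \<Rightarrow> nat \<Rightarrow> nat \<Rightarrow> nat \<Rightarrow> (nat list \<Rightarrow> bool) \<Rightarrow> memory \<Rightarrow> bool" where
  "region w m d p X M \<longleftrightarrow> (\<forall>xs. length xs = p \<and> (\<forall>x\<in>set xs. x < ubd w) \<longrightarrow>
    M ((d + 2) * (2 * ubd w ^ m) + hval (ubd w) xs) = of_bool (X xs))"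

text \<open>Code at depth \<open>d\<close> may overwrite the scratch block 1 and the blocks from
  \<open>d + 3\<close> on, which belong to deeper fixed points. Everything else, including the
  relation at depth \<open>d\<close>, must survive.\<close>

definition frame :: "nat \<Rightarrow> nat \<Rightarrow> memory \<Rightarrow> memory \<Rightarrow> bool" where
  "frame U d M M' \<longleftrightarrow> (\<forall>a. a div U \<noteq> 1 \<and> a div U < d + 3 \<longrightarrow> M' a = M a)"

lemma frame_refl [simp]: "frame U d M M"
  by (simp add: frame_def)

lemma frame_trans: "frame U d M M' \<Longrightarrow> frame U d M' M'' \<Longrightarrow> frame U d M M''"
  by (simp add: frame_def)

lemma good_run:
  assumes "good w m s" "targets c \<subseteq> {6, 7, 8} \<union> {10 + m..}"
    "frame (2 * ubd w ^ m) d (snd s) (snd (run P k c s))"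
  shows "good w m (run P k c s)"
proof -
  have "std (lg w) (run P k c s)" using assms by (intro std_run) (auto simp: good_def)
  moreover have "1 \<notin> targets c" "5 \<notin> targets c" "\<And>j. j < m \<Longrightarrow> 10 + j \<notin> targets c"
    using assms(2) by (auto dest!: subsetD)
  moreover have "snd (run P k c s) a = snd s a" if "a < 2 * ubd w ^ m" for a
    using assms(3) that by (simp add: frame_def)
  ultimately show ?thesis using assms(1) by (simp add: good_def run_frame)
qed

lemma region_address:
  fixes K :: nat
  assumes "h < K ^ m"
  shows "((d + 2) * (2 * K ^ m) + h) div (2 * K ^ m) = d + 2"
proof -
  have "0 < K ^ m" using assms by (cases "K ^ m") auto
  then show ?thesis using assms by (subst div_mult_self3) auto
qed

lemma hval_less_width:
  assumes "\<forall>x\<in>set xs. x < ubd w" "length xs \<le> m"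
  shows "hval (ubd w) xs < ubd w ^ m"
proof -
  have "hval (ubd w) xs < ubd w ^ length xs" using assms by (intro hval_less) auto
  also have "\<dots> \<le> ubd w ^ m" using assms by (intro power_increasing) auto
  finally show ?thesis .
qed

lemma region_frame:
  assumes "region w m d p X M" "frame (2 * ubd w ^ m) d M M'" "p \<le> m"
  shows "region w m d p X M'"
  unfolding region_def
proof safe
  fix xs assume xs: "p = length xs" "\<forall>x\<in>set xs. x < ubd w"
  let ?a = "(d + 2) * (2 * ubd w ^ m) + hval (ubd w) xs"
  have "hval (ubd w) xs < ubd w ^ m" using xs assms by (intro hval_less_width) auto
  then have "?a div (2 * ubd w ^ m) = d + 2" by (rule region_address)
  then have "M' ?a = M ?a" using assms(2) unfolding frame_def by simp
  then show "M' ?a = of_bool (X xs)" using assms(1) xs by (simp add: region_def)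
qed

lemma dig_less: "0 < K \<Longrightarrow> dig K i j < K"
  by (simp add: dig_def)

lemma dig_mod: "j < m \<Longrightarrow> dig K (i mod K ^ m) j = dig K i j"
proof -
  assume "j < m"
  then obtain l where "m = j + Suc l" using less_imp_Suc_add by auto
  then have "K ^ m = K ^ j * K ^ Suc l" by (simp add: power_add)
  then have "i mod K ^ m = K ^ j * (i div K ^ j mod K ^ Suc l) + i mod K ^ j"
    by (simp only: mod_mult2_eq)
  then have "i mod K ^ m div K ^ j = i div K ^ j mod K ^ Suc l" if "0 < K ^ j"
    using that by simp
  moreover have "i div K ^ j mod K ^ Suc l mod K = i div K ^ j mod K"
    by (rule mod_mod_cancel) simp
  ultimately show ?thesis by (cases "K = 0") (auto simp: dig_def power_0_left)
qed

lemma var_value: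
  assumes "good w m s" "set ctx \<subseteq> {..<length ctx}" "length ctx \<le> m"
  shows "fst s (var ctx v) = (\<lambda>i. env (ubd w) ctx i v)"
proof (cases "v < length ctx")
  case True
  then have "ctx ! v < m" using assms nth_mem by fastforce
  then show ?thesis using assms True by (simp add: good_def env_def)
qed (use assms in \<open>auto simp: good_def std_def env_def\<close>)

lemma env_less: "env (ubd w) ctx i v < ubd w"
  by (simp add: env_def dig_less)

lemma own_value:
  assumes "good w m s"
  shows "hval (ubd w) (map (\<lambda>r. fst s r i) (own m)) = i mod ubd w ^ m"
proof -
  have "map (\<lambda>r. fst s r i) (own m) = map (dig (ubd w) i) [0..<m]"
    using assms by (auto simp: good_def)
  then show ?thesis by (simp only: hval_digs)
qed

lemma env_mod:
  assumes "set ctx \<subseteq> {..<m}"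
  shows "env K ctx (i mod K ^ m) = env K ctx i"
proof
  fix v
  have "v < length ctx \<Longrightarrow> ctx ! v < m" using assms nth_mem by blast
  then show "env K ctx (i mod K ^ m) v = env K ctx i v" by (simp add: env_def dig_mod)
qed

text \<open>There may be more than \<open>K ^ m\<close> processors. Processor \<open>i\<close> then
  repeats the work of \<open>i mod K ^ m\<close>, so the value depends on that remainder only and
  the duplicates write the same thing. The block written is the one of depth
  \<open>d + 1\<close>.\<close>

lemma put_own:
  fixes d :: nat
  assumes "good w m s" "b \<notin> {6, 7}" "fst s b = (\<lambda>i. of_bool (Q (i mod ubd w ^ m)))"
    "ubd w ^ m \<le> P"
  defines "M \<equiv> snd (run P (lg w) (put (own m) (d + 1) b) s)"
  shows "a < ubd w ^ m \<Longrightarrow> M ((d + 3) * (2 * ubd w ^ m) + a) = of_bool (Q a)"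
    and "frame (2 * ubd w ^ m) d (snd s) M"
proof -
  have r: "set (own m) \<inter> {6, 7} = {}" by auto
  have 5: "fst s 5 = (\<lambda>_. 2 * ubd w ^ m)" using assms by (simp add: good_def)
  have g: "fst s b i = of_bool (Q (hval (2 ^ lg w) (map (\<lambda>r. fst s r i) (own m))))" for i
    using own_value[OF assms(1), of i] assms(3) by simp
  have M: "M x = (if \<exists>i<P. (d + 3) * (2 * ubd w ^ m) + i mod ubd w ^ m = x
      then of_bool (Q (x - (d + 3) * (2 * ubd w ^ m))) else snd s x)" for x
    unfolding M_def run_put[where g = "\<lambda>a. of_bool (Q a)", OF r 5 assms(2) g] own_value[OF assms(1)]
    by (simp only: add.assoc one_add_one[symmetric] numeral_3_eq_3 One_nat_def add_Suc_right add_0_right)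
  show "M ((d + 3) * (2 * ubd w ^ m) + a) = of_bool (Q a)" if "a < ubd w ^ m"
  proof -
    have "a < P" "a mod ubd w ^ m = a" using that assms(4) by auto
    then show ?thesis unfolding M by auto
  qed
  show "frame (2 * ubd w ^ m) d (snd s) M"
    unfolding frame_def
  proof safe
    fix a assume a: "a div (2 * ubd w ^ m) < d + 3"
    have "(d + 3) * (2 * ubd w ^ m) + i mod ubd w ^ m \<noteq> a" for i
    proof
      assume "(d + 3) * (2 * ubd w ^ m) + i mod ubd w ^ m = a"
      then have "a div (2 * ubd w ^ m) = d + 3"
        using region_address[of "i mod ubd w ^ m" "ubd w" m "d + 1"] by (auto simp: numeral_eq_Suc)
      then show False using a by simp
    qed
    then show "M a = snd s a" unfolding M by auto
  qed
qed

definition zeroed :: "nat \<Rightarrow> nat \<Rightarrow> nat \<Rightarrow> nat \<Rightarrow> nat list" where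
  "zeroed K m D i = map (\<lambda>j. if j = D then 0 else dig K i j) [0..<m]"

lemma zeroed_less: "0 < K \<Longrightarrow> \<forall>x\<in>set (zeroed K m D i). x < K"
  by (auto simp: zeroed_def dig_less)

text \<open>Clearing digit \<open>D\<close> groups the processors that agree on all other digits
  below \<open>m\<close>. The older variables occupy digits below \<open>D\<close>, and
  \<open>K ^ m \<le> P\<close> provides each group with a processor for every value of the new
  variable. So a quantifier is a disjunction over a group.\<close>

lemma ex_digit:
  assumes "set ctx \<subseteq> {..<D}" "length ctx = D" "D < m" "0 < K" "K ^ m \<le> P"
  shows "(\<exists>i'<P. zeroed K m D i' = zeroed K m D i \<and> Q (env K (D # ctx) i')) \<longleftrightarrow>
    (\<exists>x<K. Q (case_nat x (env K ctx i)))"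
proof -
  have e: "env K (D # ctx) i' = case_nat (dig K i' D) (env K ctx i)"
    if "zeroed K m D i' = zeroed K m D i" for i'
  proof
    fix v
    have d: "dig K i' j = dig K i j" if "j < m" "j \<noteq> D" for j
    proof -
      have "\<forall>x\<in>set [0..<m]. (if x = D then 0 else dig K i' x) = (if x = D then 0 else dig K i x)"
        using \<open>zeroed K m D i' = zeroed K m D i\<close> unfolding zeroed_def map_eq_conv .
      from bspec[OF this, of j] show ?thesis using that by simp
    qed
    show "env K (D # ctx) i' v = case_nat (dig K i' D) (env K ctx i) v"
    proof (cases v)
      case (Suc v')
      have "dig K i' (ctx ! v') = dig K i (ctx ! v')" if "v' < D"
      proof -
        have "ctx ! v' < D" using that assms nth_mem by blast
        then show ?thesis using assms by (intro d) auto
      qed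
      then show ?thesis using Suc assms by (simp add: env_def)
    qed (simp add: env_def)
  qed
  show ?thesis
  proof safe
    fix i' assume "zeroed K m D i' = zeroed K m D i" "Q (env K (D # ctx) i')"
    then show "\<exists>x<K. Q (case_nat x (env K ctx i))"
      using e dig_less[OF assms(4)] by auto
  next
    fix x assume x: "x < K" "Q (case_nat x (env K ctx i))"
    define xs where "xs = map (\<lambda>j. if j = D then x else dig K i j) [0..<m]"
    have xs: "\<And>y. y \<in> set xs \<Longrightarrow> y < K" using x assms by (auto simp: xs_def dig_less)
    have "length xs = m" by (simp add: xs_def)
    then have "hval K xs < K ^ m" using hval_less[of xs K] xs by auto
    then have P: "hval K xs < P" using assms by simp
    have d: "dig K (hval K xs) j = pad xs j" for j using xs assms by (intro dig_hval) auto
    have z: "zeroed K m D (hval K xs) = zeroed K m D i"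
      unfolding zeroed_def d by (auto simp: pad_def xs_def)
    have "dig K (hval K xs) D = x" unfolding d using assms by (simp add: pad_def xs_def)
    then show "\<exists>i'<P. zeroed K m D i' = zeroed K m D i \<and> Q (env K (D # ctx) i')"
      using P z x e[OF z] by auto
  qed
qed

lemma istep_Store_const:
  "fst s b = (\<lambda>_. v) \<Longrightarrow>
    istep P (Store a b) s = (fst s, \<lambda>x. if \<exists>i<P. fst s a i = x then v else snd s x)"
  by (simp cong: if_cong)

lemma run_ex:
  fixes m w
  defines "K \<equiv> ubd w"
  assumes s: "good w m s" and D: "D < m" and t: "10 + m \<le> t" and P: "K ^ m \<le> P"
    and v: "fst s t = (\<lambda>i. of_bool (Q i))"
  defines "s' \<equiv> run P (lg w) (addr (map (\<lambda>j. if j = D then 2 else 10 + j) [0..<m]) ;;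
    Blk [Add 6 6 6, Add 6 6 5, Add 7 6 3, Store 7 2, Add 8 6 t, Store 8 3, Load t 7]) s"
  shows "fst s' t = (\<lambda>i. of_bool (\<exists>i'<P. zeroed K m D i' = zeroed K m D i \<and> Q i'))"
    and "frame (2 * K ^ m) d (snd s) (snd s')"
proof -
  define rs where "rs = map (\<lambda>j. if j = D then 2 else 10 + j) [0..<m]"
  define h where "h i = hval K (zeroed K m D i)" for i
  define U where "U = 2 * K ^ m"
  have K: "0 < K" by (simp add: K_def)
  have rs: "set rs \<inter> {6, 7} = {}" by (auto simp: rs_def)
  have "map (\<lambda>r. fst s r i) rs = zeroed K m D i" for i
    using s by (auto simp: rs_def zeroed_def good_def std_def K_def)
  then have 6: "fst (run P (lg w) (addr rs) s) 6 = h" and M: "snd (run P (lg w) (addr rs) s) = snd s"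
    using run_addr[OF rs, of P "lg w" s] by (auto simp: h_def K_def)
  have fr: "fst (run P (lg w) (addr rs) s) r = fst s r" if "r \<notin> {6, 7}" for r
    using that targets_addr[of rs] by (intro run_frame) auto
  have regs: "fst s 2 = (\<lambda>_. 0)" "fst s 3 = (\<lambda>_. 1)" "fst s 5 = (\<lambda>_. U)"
    using s by (auto simp: good_def std_def U_def K_def)
  have h: "h i < K ^ m" for i
    using hval_less_width[of "zeroed K m D i" w m] zeroed_less[OF K]
    by (simp add: h_def K_def zeroed_def)
  have h_eq: "h i = h i' \<longleftrightarrow> zeroed K m D i = zeroed K m D i'" for i i'
  proof
    assume "h i = h i'"
    then show "zeroed K m D i = zeroed K m D i'"
      unfolding h_def by (rule hval_inj) (use zeroed_less[OF K] in \<open>auto simp: zeroed_def [abs_def]\<close>)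
  qed (simp add: h_def)
  \<comment> \<open>The odd cells are cleared first, since the scratch block may still hold the
    outcome of an earlier quantifier.\<close>
  define M1 where "M1 = (\<lambda>x. if \<exists>i<P. h i + h i + U + 1 = x then 0 else snd s x)"
  define M2 where "M2 = (\<lambda>x. if \<exists>i<P. h i + h i + U + of_bool (Q i) = x then 1 else M1 x)"
  define s2 where "s2 = run P (lg w) (addr rs) s"
  define s3 where "s3 = fold (istep P) [Add 6 6 6, Add 6 6 5, Add 7 6 3] s2"
  have 3: "fst s3 7 = (\<lambda>i. h i + h i + U + 1)" "fst s3 6 = (\<lambda>i. h i + h i + U)"
    "fst s3 t = (\<lambda>i. of_bool (Q i))" "fst s3 2 = (\<lambda>_. 0)" "fst s3 3 = (\<lambda>_. 1)" "snd s3 = snd s"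
    using t by (simp_all add: s3_def s2_def 6 M fr regs v)
  define s4 where "s4 = istep P (Store 7 2) s3"
  have 4: "fst s4 = fst s3" "snd s4 = M1"
    unfolding s4_def istep_Store_const[OF 3(4)] M1_def 3(1,6) by simp_all
  define s5 where "s5 = istep P (Add 8 6 t) s4"
  have 5: "fst s5 8 = (\<lambda>i. h i + h i + U + of_bool (Q i))" "fst s5 3 = (\<lambda>_. 1)"
      "fst s5 7 = (\<lambda>i. h i + h i + U + 1)" "snd s5 = M1"
    using 4 by (simp_all add: s5_def 3)
  define s6 where "s6 = istep P (Store 8 3) s5"
  have 66: "fst s6 = fst s5" "snd s6 = M2"
    unfolding s6_def istep_Store_const[OF 5(2)] M2_def 5(1,4) by simp_all
  have "s' = istep P (Load t 7) s6"
    unfolding s'_def s6_def s5_def s4_def s3_def s2_def rs_def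
    by (simp only: run.simps fold_simps)
  then have s': "fst s' t = (\<lambda>i. M2 (h i + h i + U + 1))" "snd s' = M2"
    by (simp_all add: 66 5)
  have "M2 (h i + h i + U + 1) = of_bool (\<exists>i'<P. zeroed K m D i' = zeroed K m D i \<and> Q i')" for i
  proof -
    have "zeroed K m D (i mod K ^ m) = zeroed K m D i"
      by (auto simp: zeroed_def dig_mod)
    then have "h (i mod K ^ m) = h i" by (simp add: h_eq)
    moreover have "i mod K ^ m < P" using P K by (meson less_le_trans mod_less_divisor zero_less_power)
    ultimately have "M1 (h i + h i + U + 1) = 0" by (auto simp: M1_def)
    moreover have "h i' + h i' + U + of_bool (Q i') = h i + h i + U + 1 \<longleftrightarrow>
        zeroed K m D i' = zeroed K m D i \<and> Q i'" for i'
      unfolding h_eq[symmetric] by (cases "Q i'") (auto, presburger)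
    ultimately show ?thesis by (simp add: M2_def)
  qed
  then show "fst s' t = (\<lambda>i. of_bool (\<exists>i'<P. zeroed K m D i' = zeroed K m D i \<and> Q i'))"
    by (simp add: s')
  \<comment> \<open>Two addresses for each of up to \<open>K ^ m\<close> groups stay inside block 1;
    this is why blocks have size \<open>2 * K ^ m\<close>.\<close>
  have U: "(h i + h i + U + of_bool b) div U = 1" for i b
    using h[of i] by (intro div_nat_eqI) (auto simp: U_def)
  show "frame (2 * K ^ m) d (snd s) (snd s')"
    unfolding frame_def U_def[symmetric] s'
  proof safe
    fix a assume "a div U \<noteq> 1"
    then have "h i + h i + U + of_bool b \<noteq> a" for i b using U by metis
    from this[of _ True] this show "M2 a = snd s a" by (auto simp: M2_def M1_def)
  qed
qed

lemma run_plus: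
  assumes "a \<notin> {6, 7, 8}" "b \<notin> {6, 7, 8}" "c \<notin> {6, 7, 8}" "fst s 3 = (\<lambda>_. 1)"
  shows "fst (fold (istep P) [Add 6 a b, Sub 7 6 c, Sub 8 c 6, Add 7 7 8, Sub t 3 7] s) t =
      (\<lambda>i. of_bool (fst s a i + fst s b i = fst s c i)) \<and>
    snd (fold (istep P) [Add 6 a b, Sub 7 6 c, Sub 8 c 6, Add 7 7 8, Sub t 3 7] s) = snd s"
  using assms by (auto simp: fun_eq_iff)

lemma run_is:
  assumes "a \<notin> {6, 7, 8}" "fst s 3 = (\<lambda>_. 1)"
  shows "fst (fold (istep P) [Const 6 c, Sub 7 a 6, Sub 8 6 a, Add 7 7 8, Sub t 3 7] s) t =
      (\<lambda>i. of_bool (fst s a i = c)) \<and>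
    snd (fold (istep P) [Const 6 c, Sub 7 a 6, Sub 8 6 a, Add 7 7 8, Sub t 3 7] s) = snd s"
  using assms by (auto simp: fun_eq_iff)

lemma run_len:
  assumes "a \<notin> {1, 6, 7, 8}" "fst s 3 = (\<lambda>_. 1)" "fst s 1 = (\<lambda>_. n)"
  shows "fst (fold (istep P) [Sub 7 a 1, Sub 8 1 a, Add 7 7 8, Sub t 3 7] s) t =
      (\<lambda>i. of_bool (fst s a i = n)) \<and>
    snd (fold (istep P) [Sub 7 a 1, Sub 8 1 a, Add 7 7 8, Sub t 3 7] s) = snd s"
  using assms by (auto simp: fun_eq_iff)

text \<open>Every processor evaluates the formula under the assignment coded by its own digits, so
  all assignments are treated at once and a quantifier needs no loop over the universe. The frame
  condition guarantees that the second half of a \<open>Nand\<close> still finds the relation of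
  depth \<open>d\<close>.\<close>

lemma eval_code:
  assumes "arity_ok f p" "width f (length ctx) \<le> m" "set ctx \<subseteq> {..<length ctx}" "10 + m \<le> t"
    and "ubd w ^ m \<le> P" "p \<le> m" "good w m s" "region w m d p X (snd s)"
  shows "fst (run P (lg w) (code f m d ctx t) s) t =
      (\<lambda>i. of_bool (eval f w X (env (ubd w) ctx i))) \<and>
    frame (2 * ubd w ^ m) d (snd s) (snd (run P (lg w) (code f m d ctx t) s))"
  using assms
proof (induction f arbitrary: d ctx t p X s)
  case (Plus a b c)
  have v: "fst s (var ctx v) = (\<lambda>i. env (ubd w) ctx i v)" for v
    using Plus.prems by (intro var_value) auto
  have r: "var ctx v \<notin> {6, 7, 8}" for v by auto
  have 3: "fst s 3 = (\<lambda>_. 1)" using Plus.prems by (simp add: good_def std_def)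
  show ?case
    using run_plus[OF r[of a] r[of b] r[of c] 3, of P t] unfolding v by simp
next
  case (Is a c)
  have v: "fst s (var ctx v) = (\<lambda>i. env (ubd w) ctx i v)" for v
    using Is.prems by (intro var_value) auto
  have r: "var ctx v \<notin> {6, 7, 8}" for v by auto
  have 3: "fst s 3 = (\<lambda>_. 1)" using Is.prems by (simp add: good_def std_def)
  show ?case
    using run_is[OF r[of a] 3, of P c t] unfolding v by simp
next
  case (Len a)
  have v: "fst s (var ctx v) = (\<lambda>i. env (ubd w) ctx i v)" for v
    using Len.prems by (intro var_value) auto
  have r: "var ctx v \<notin> {1, 6, 7, 8}" for v by auto
  have 3: "fst s 3 = (\<lambda>_. 1)" and 1: "fst s 1 = (\<lambda>_. length w)"
    using Len.prems by (simp_all add: good_def std_def)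
  show ?case
    using run_len[OF r[of a] 3 1, of P t] unfolding v by simp
next
  case (Bit a)
  have v: "fst s (var ctx a) = (\<lambda>i. env (ubd w) ctx i a)"
    using Bit.prems by (intro var_value) auto
  have "env (ubd w) ctx i a < 2 * ubd w ^ m" for i
  proof (cases "a < length ctx")
    case True
    then have "ubd w ^ 1 \<le> ubd w ^ m" using Bit.prems by (intro power_increasing) auto
    then show ?thesis using env_less[of w ctx i a] by simp
  qed (simp add: env_def)
  then show ?case using Bit.prems v by (auto simp: good_def fun_eq_iff)
next
  case (Nand f g)
  let ?c = "code f m d ctx t" and ?c' = "code g m d ctx (t + 1)"
  let ?s1 = "run P (lg w) ?c s"
  let ?s2 = "run P (lg w) ?c' ?s1"
  have 1: "fst ?s1 t = (\<lambda>i. of_bool (eval f w X (env (ubd w) ctx i)))"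
    "frame (2 * ubd w ^ m) d (snd s) (snd ?s1)"
    using Nand.IH(1)[of p ctx t s d X] Nand.prems by auto
  have s1: "good w m ?s1" "region w m d p X (snd ?s1)"
    using Nand.prems 1(2) targets_code[of f m d ctx t]
    by (auto intro!: good_run intro: region_frame simp: subset_iff)
  have 2: "fst ?s2 (t + 1) = (\<lambda>i. of_bool (eval g w X (env (ubd w) ctx i)))"
    "frame (2 * ubd w ^ m) d (snd ?s1) (snd ?s2)"
    using Nand.IH(2)[of p ctx "t + 1" ?s1 d X] Nand.prems s1 by auto
  have t: "t \<notin> targets ?c'" "3 \<notin> targets ?c'"
    using Nand.prems targets_code[of g m d ctx "t + 1"] by auto
  have "fst ?s2 t = fst ?s1 t" "fst ?s2 3 = (\<lambda>_. 1)"
    using t s1 by (simp_all add: run_frame good_def std_def)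
  then show ?case using Nand.prems 1 2 by (auto simp: fun_eq_iff intro: frame_trans)
next
  case (Ex f)
  let ?D = "length ctx"
  let ?c = "code f m d (?D # ctx) t"
  let ?s1 = "run P (lg w) ?c s"
  have D: "?D < m" using Ex.prems width_ge[of "Suc ?D" f] by simp
  have "set (?D # ctx) \<subseteq> {..<length (?D # ctx)}" using Ex.prems by auto
  then have 1: "fst ?s1 t = (\<lambda>i. of_bool (eval f w X (env (ubd w) (?D # ctx) i)))"
    "frame (2 * ubd w ^ m) d (snd s) (snd ?s1)"
    using Ex.IH[of p "?D # ctx" t s d X] Ex.prems by auto
  have s1: "good w m ?s1"
    using Ex.prems 1(2) targets_code[of f m d "?D # ctx" t]
    by (intro good_run[where d = d]) (auto simp: subset_iff)
  note 2 = run_ex[OF s1 D Ex.prems(4,5) 1(1)]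
  have "(\<lambda>i. of_bool (\<exists>i'<P. zeroed (ubd w) m ?D i' = zeroed (ubd w) m ?D i \<and>
        eval f w X (env (ubd w) (?D # ctx) i'))) =
      (\<lambda>i. of_bool (\<exists>x<ubd w. eval f w X (case_nat x (env (ubd w) ctx i))))"
    using ex_digit[OF Ex.prems(3) refl D _ Ex.prems(5), of _ "eval f w X"] by simp
  with 2(1) have "fst (run P (lg w) (code (Ex f) m d ctx t) s) t =
      (\<lambda>i. of_bool (eval (Ex f) w X (env (ubd w) ctx i)))" by simp
  moreover have "frame (2 * ubd w ^ m) d (snd s) (snd (run P (lg w) (code (Ex f) m d ctx t) s))"
    using frame_trans[OF 1(2) 2(2)] by simp
  ultimately show ?case by blast
next
  case (Rel vs)
  have rs: "set (map (var ctx) vs) \<inter> {6, 7} = {}" by auto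
  have v: "fst s (var ctx v) = (\<lambda>i. env (ubd w) ctx i v)" for v
    using Rel.prems by (intro var_value) auto
  have 5: "fst s 5 = (\<lambda>_. 2 * ubd w ^ m)" using Rel.prems by (simp add: good_def)
  have "map (\<lambda>r. fst s r i) (map (var ctx) vs) = map (env (ubd w) ctx i) vs" for i
    using v by (simp add: fun_eq_iff)
  moreover have "snd s ((d + 2) * (2 * ubd w ^ m) + hval (ubd w) (map (env (ubd w) ctx i) vs)) =
      of_bool (X (map (env (ubd w) ctx i) vs))" for i
    using Rel.prems by (auto simp: region_def env_less)
  ultimately show ?case
    using run_look[OF rs 5, of P "lg w" d t] by (simp only: code.simps eval.simps frame_refl)
next
  case (Fix c f vs)
  let ?U = "2 * ubd w ^ m" and ?p = "length vs"
  let ?F = "\<lambda>Y xs. eval f w Y (pad xs)"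
  let ?ctx = "[0..<?p]"
  let ?c1 = "code f m (d + 1) ?ctx (t + 1)" and ?c2 = "put (own m) (d + 1) (t + 1)"
  define X' where "X' j = (?F ^^ j) (\<lambda>_. False)" for j
  define R where "R j s' \<longleftrightarrow> good w m s' \<and> region w m (d + 1) ?p (X' j) (snd s') \<and>
    frame ?U d (snd s) (snd s')" for j s'
  have p: "?p \<le> m" "width f ?p \<le> m" using Fix.prems width_ge[of ?p f] by auto
  let ?s0 = "run P (lg w) (put (own m) (d + 1) 2) s"
  have regionI: "region w m (d + 1) ?p Y M"
    if "\<And>a. a < ubd w ^ m \<Longrightarrow> M ((d + 3) * ?U + a) = of_bool (Y (map (dig (ubd w) a) [0..<?p]))" for Y M
    unfolding region_def
  proof safe
    fix xs :: "nat list" assume xs: "length xs = ?p" "\<forall>x\<in>set xs. x < ubd w"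
    have "dig (ubd w) (hval (ubd w) xs) j = pad xs j" for j using xs by (intro dig_hval) auto
    then have "map (dig (ubd w) (hval (ubd w) xs)) [0..<?p] = xs"
      using xs by (auto intro!: nth_equalityI simp: pad_def)
    moreover have "hval (ubd w) xs < ubd w ^ m" using xs p by (intro hval_less_width) auto
    ultimately show "M ((d + 1 + 2) * ?U + hval (ubd w) xs) = of_bool (Y xs)"
      using that[of "hval (ubd w) xs"] by (simp add: numeral_3_eq_3)
  qed
  have "fst s 2 = (\<lambda>i. of_bool ((\<lambda>_. False) (i mod ubd w ^ m)))"
    using Fix.prems by (simp add: good_def std_def)
  from put_own[where Q = "\<lambda>_. False" and d = d, OF Fix.prems(7) _ this Fix.prems(5)]
  have 0: "a < ubd w ^ m \<Longrightarrow> snd ?s0 ((d + 3) * ?U + a) = of_bool False"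
    "frame ?U d (snd s) (snd ?s0)" for a by auto
  have "good w m ?s0"
    using Fix.prems(7) 0(2) targets_put[of "own m" "d + 1" 2] by (intro good_run[where d = d]) auto
  moreover have "region w m (d + 1) ?p (X' 0) (snd ?s0)"
    using 0(1) by (intro regionI) (simp add: X'_def)
  ultimately have R0: "R 0 ?s0" using 0(2) by (simp add: R_def)
  \<comment> \<open>In the body, the first \<open>length vs\<close> digits of a processor are read
    as the argument tuple. All tuples are thus evaluated against the old relation before any of the
    results is stored, and one pass through the loop is one application of the operator.\<close>
  have step: "R (Suc j) (run P (lg w) (?c1 ;; ?c2) s')" if "R j s'" for j s'
  proof -
    let ?s1 = "run P (lg w) ?c1 s'"
    let ?s2 = "run P (lg w) ?c2 ?s1"
    have 1: "fst ?s1 (t + 1) = (\<lambda>i. of_bool (eval f w (X' j) (env (ubd w) ?ctx i)))"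
      "frame ?U (d + 1) (snd s') (snd ?s1)"
      using Fix.IH[of ?p ?ctx "t + 1" s' "d + 1" "X' j"] Fix.prems p that by (simp_all add: R_def atLeast0LessThan)
    have f1: "frame ?U d (snd s') (snd ?s1)" using 1(2) by (simp add: frame_def)
    have s1: "good w m ?s1"
      using that f1 Fix.prems targets_code[of f m "d + 1" ?ctx "t + 1"]
      by (intro good_run[where d = d]) (auto simp: subset_iff R_def)
    have em: "env (ubd w) ?ctx (i mod ubd w ^ m) = env (ubd w) ?ctx i" for i
      using p by (intro env_mod) auto
    have "fst ?s1 (t + 1) = (\<lambda>i. of_bool ((\<lambda>a. eval f w (X' j) (env (ubd w) ?ctx a)) (i mod ubd w ^ m)))"
      using 1(1) em by simp
    note 2 = put_own[where d = d, OF s1 _ this Fix.prems(5)]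
    have e: "env (ubd w) ?ctx a = pad (map (dig (ubd w) a) [0..<?p])" for a
      by (auto simp: env_def pad_def)
    have "region w m (d + 1) ?p (X' (Suc j)) (snd ?s2)"
      using Fix.prems 2(1) by (intro regionI) (simp add: X'_def e)
    moreover have f2: "frame ?U d (snd ?s1) (snd ?s2)" using Fix.prems 2(2) by simp
    moreover have "good w m ?s2"
      using targets_put[of "own m" "d + 1" "t + 1"] by (intro good_run[OF s1 _ f2]) auto
    ultimately show ?thesis using f1 that by (auto simp: R_def intro: frame_trans)
  qed
  have upd: "R j ((fst s')(t := g), snd s')" if "R j s'" for j s' g
    using that Fix.prems(4) by (auto simp: R_def good_def std_def)
  let ?b = "\<lambda>s. istep P (Sub t t 3) (run P (lg w) (?c1 ;; ?c2) s)"
  have iter: "R j ((?b ^^ j) s')" if "R 0 s'" for j s'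
  proof (induction j)
    case (Suc j)
    then show ?case using upd step by simp
  qed (use that in simp)
  let ?s3 = "run P (lg w) (Loop c t (?c1 ;; ?c2)) ?s0"
  have 3: "R (c * lg w) ?s3"
    unfolding run.simps(3) by (intro iter upd R0)
  have rs: "set (map (var ctx) vs) \<inter> {6, 7} = {}" by auto
  have "length ctx \<le> m" using Fix.prems by simp
  then have v: "fst ?s3 (var ctx v) = (\<lambda>i. env (ubd w) ctx i v)" for v
    using Fix.prems 3 by (intro var_value) (auto simp: R_def)
  have 5: "fst ?s3 5 = (\<lambda>_. ?U)" using 3 by (simp add: good_def R_def)
  have "map (\<lambda>r. fst ?s3 r i) (map (var ctx) vs) = map (env (ubd w) ctx i) vs" for i
    using v by (simp add: fun_eq_iff)
  moreover have "snd ?s3 ((d + 1 + 2) * ?U + hval (ubd w) (map (env (ubd w) ctx i) vs)) =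
      of_bool (X' (c * lg w) (map (env (ubd w) ctx i) vs))" for i
    using 3 unfolding R_def region_def by (auto simp: env_less)
  moreover have "frame ?U d (snd s) (snd ?s3)" using 3 by (simp add: R_def)
  ultimately show ?case
    using run_look[OF rs 5, of P "lg w" "d + 1" t] by (simp only: code.simps run.simps(2) eval.simps X'_def)
qed

section \<open>Initialization of the registers and the resulting running time\<close>

primrec size_code :: "nat \<Rightarrow> cmd" where
  "size_code 0 = Blk [Const 5 2]"
| "size_code (Suc m) = size_code m ;; Loop 1 7 (Blk [Add 5 5 5])"

text \<open>Register 8 holds the index divided by \<open>K ^ j\<close>. A remainder modulo
  \<open>K\<close> is formed as \<open>x - K * (x div K)\<close>, by \<open>k\<close> halvings and
  \<open>k\<close> doublings.\<close>

primrec digit_code :: "nat \<Rightarrow> cmd" where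
  "digit_code 0 = Blk [Add 8 0 2]"
| "digit_code (Suc j) = digit_code j ;; Blk [Add 6 8 2] ;; Loop 1 7 (Blk [Half 6 6]) ;;
    Blk [Add 9 6 2] ;; Loop 1 7 (Blk [Add 9 9 9]) ;; Blk [Sub (10 + j) 8 9, Add 8 6 2]"

lemma run_double:
  assumes "r \<noteq> 7"
  shows "fst (run P k (Loop 1 7 (Blk [Add r r r])) s) r = (\<lambda>i. fst s r i * 2 ^ k)"
    and "snd (run P k (Loop 1 7 (Blk [Add r r r])) s) = snd s"
proof -
  have *: "fst (((\<lambda>s. istep P (Sub 7 7 3) (run P k (Blk [Add r r r]) s)) ^^ j) s) r = (\<lambda>i. fst s r i * 2 ^ j) \<and>
    snd (((\<lambda>s. istep P (Sub 7 7 3) (run P k (Blk [Add r r r]) s)) ^^ j) s) = snd s" for j s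
    using assms by (induction j) auto
  show "fst (run P k (Loop 1 7 (Blk [Add r r r])) s) r = (\<lambda>i. fst s r i * 2 ^ k)"
    and "snd (run P k (Loop 1 7 (Blk [Add r r r])) s) = snd s"
    using assms *[of k "((fst s)(7 := \<lambda>i. 1 * k), snd s)"] by simp_all
qed

lemma run_halve:
  assumes "r \<noteq> 7"
  shows "fst (run P k (Loop 1 7 (Blk [Half r r])) s) r = (\<lambda>i. fst s r i div 2 ^ k)"
    and "snd (run P k (Loop 1 7 (Blk [Half r r])) s) = snd s"
proof -
  have *: "fst (((\<lambda>s. istep P (Sub 7 7 3) (run P k (Blk [Half r r]) s)) ^^ j) s) r = (\<lambda>i. fst s r i div 2 ^ j) \<and>
    snd (((\<lambda>s. istep P (Sub 7 7 3) (run P k (Blk [Half r r]) s)) ^^ j) s) = snd s" for j s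
    using assms by (induction j) (auto simp: div_mult2_eq mult.commute[of 2])
  show "fst (run P k (Loop 1 7 (Blk [Half r r])) s) r = (\<lambda>i. fst s r i div 2 ^ k)"
    and "snd (run P k (Loop 1 7 (Blk [Half r r])) s) = snd s"
    using assms *[of k "((fst s)(7 := \<lambda>i. 1 * k), snd s)"] by simp_all
qed

lemma targets_size: "targets (size_code m) \<subseteq> {5, 7}"
  by (induction m) auto

lemma targets_digit: "targets (digit_code m) \<subseteq> {6, 7, 8, 9} \<union> {10..<10 + m}"
  by (induction m) auto

lemma wf_size: "wf_cmd (size_code m)"
  by (induction m) auto

lemma wf_digit: "wf_cmd (digit_code m)"
  by (induction m) auto

lemma run_size:
  "fst (run P k (size_code m) s) 5 = (\<lambda>_. 2 * (2 ^ k) ^ m) \<and> snd (run P k (size_code m) s) = snd s"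
proof (induction m)
  case (Suc m)
  then show ?case
    using run_double[of 5 P k "run P k (size_code m) s"] by (simp add: fun_eq_iff del: run.simps(3))
qed simp

lemma run_digit:
  fixes k P :: nat
  assumes "fst s 0 = (\<lambda>i. i)" "fst s 2 = (\<lambda>_. 0)"
  defines "s' \<equiv> \<lambda>j. run P k (digit_code j) s"
  shows "fst (s' j) 8 = (\<lambda>i. i div (2 ^ k) ^ j) \<and> snd (s' j) = snd s \<and>
    (\<forall>l<j. fst (s' j) (10 + l) = (\<lambda>i. dig (2 ^ k) i l))"
proof (induction j)
  case 0
  then show ?case using assms by (simp add: s'_def)
next
  case (Suc j)
  define s1 where "s1 = s' j"
  define s2 where "s2 = run P k (Blk [Add 6 8 2]) s1"
  define s3 where "s3 = run P k (Loop 1 7 (Blk [Half 6 6])) s2"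
  define s4 where "s4 = run P k (Blk [Add 9 6 2]) s3"
  define s5 where "s5 = run P k (Loop 1 7 (Blk [Add 9 9 9])) s4"
  have s': "s' (Suc j) = run P k (Blk [Sub (10 + j) 8 9, Add 8 6 2]) s5"
    by (simp add: s'_def s1_def s2_def s3_def s4_def s5_def del: run.simps(3))
  have "2 \<notin> targets (digit_code j)" using targets_digit[of j] by auto
  then have 1: "fst s1 2 = (\<lambda>_. 0)" using assms by (simp add: s1_def s'_def run_frame)
  have 2: "fst s2 6 = fst s1 8" "\<And>r. r \<noteq> 6 \<Longrightarrow> fst s2 r = fst s1 r" "snd s2 = snd s1"
    using 1 by (auto simp: s2_def)
  have 3: "fst s3 6 = (\<lambda>i. fst s2 6 i div 2 ^ k)" "\<And>r. r \<notin> {6, 7} \<Longrightarrow> fst s3 r = fst s2 r" "snd s3 = snd s2"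
    unfolding s3_def by (simp_all only: run_halve) (auto intro!: run_frame simp del: run.simps)
  have 4: "fst s4 9 = fst s3 6" "\<And>r. r \<noteq> 9 \<Longrightarrow> fst s4 r = fst s3 r" "snd s4 = snd s3"
    using 1 2 3 by (auto simp: s4_def)
  have 5: "fst s5 9 = (\<lambda>i. fst s4 9 i * 2 ^ k)" "\<And>r. r \<notin> {7, 9} \<Longrightarrow> fst s5 r = fst s4 r" "snd s5 = snd s4"
    unfolding s5_def by (simp_all only: run_double) (auto intro!: run_frame simp del: run.simps)
  have d: "x div a - b * (x div (b * a)) = x div a mod b" for a b x :: nat
    by (metis div_mult2_eq mult.commute minus_mult_div_eq_mod)
  have IH: "fst s1 8 = (\<lambda>i. i div (2 ^ k) ^ j)" "snd s1 = snd s"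
    "l < j \<Longrightarrow> fst s1 (10 + l) = (\<lambda>i. dig (2 ^ k) i l)" for l
    using Suc by (auto simp: s1_def)
  show ?case
    unfolding s' using 1 2 3 4 5 IH
    by (auto simp: d dig_def less_Suc_eq div_mult2_eq[symmetric] mult.commute)
qed

text \<open>A \<open>Loop\<close> needs the logarithm in register 4, so this one loop is written by
  hand. It halves \<open>length w + 1\<close>, which is the same number in all processors, until 0
  is reached.\<close>

definition prelude :: "instr list" where
  "prelude = [Const 2 0, Const 3 1, Const 4 0, Add 6 1 3, JumpZero 6 8, Half 6 6, Add 4 4 3, JumpZero 2 4]"

lemma funpow_one: "(f :: 'a \<Rightarrow> 'a) ^^ 1 = f"
  by (simp add: fun_eq_iff)

lemma steps_prelude_loop:
  assumes c: "code_at prog 0 prelude" and "fst s 6 = (\<lambda>_. n)" "fst s 4 = (\<lambda>_. a)"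
    "fst s 2 = (\<lambda>_. 0)" "fst s 3 = (\<lambda>_. 1)"
  shows "(pram_step prog P ^^ (4 * bitlen n + 1)) (embed P q 4 s) =
    embed P q 8 ((fst s)(6 := \<lambda>_. 0, 4 := \<lambda>_. a + bitlen n), snd s)"
  using assms(2-)
proof (induction n arbitrary: s a rule: bitlen.induct)
  case (1 n)
  let ?st = "pram_step prog P"
  have p: "4 < length prog" "5 < length prog" "6 < length prog" "7 < length prog"
    "prog ! 4 = JumpZero 6 8" "prog ! 5 = Half 6 6" "prog ! 6 = Add 4 4 3" "prog ! 7 = JumpZero 2 4"
    using c by (auto simp: prelude_def code_at_Cons numeral_eq_Suc)
  show ?case
  proof (cases "n = 0")
    case True
    then have "?st (embed P q 4 s) = embed P q 8 s"
      using pram_step_jump[OF p(1,5), of s 0] 1 by simp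
    moreover have "((fst s)(6 := \<lambda>_. 0, 4 := \<lambda>_. a + bitlen n), snd s) = s"
      using True 1 by (cases s) (auto simp: bitlen.simps fun_eq_iff)
    moreover have "4 * bitlen n + 1 = 1" using True by (simp add: bitlen.simps)
    ultimately show ?thesis by (simp only: funpow_one)
  next
    case False
    define s1 where "s1 = istep P (Half 6 6) s"
    define s2 where "s2 = istep P (Add 4 4 3) s1"
    have a: "?st (embed P q 4 s) = embed P q 5 s"
      using pram_step_jump[OF p(1,5), of s n] 1 False by simp
    have b: "?st (embed P q 5 s) = embed P q 6 s1"
      using pram_step_istep[OF p(2), of P q s] p by (simp add: s1_def)
    have c: "?st (embed P q 6 s1) = embed P q 7 s2"
      using pram_step_istep[OF p(3), of P q s1] p by (simp add: s2_def)
    have s2: "fst s2 6 = (\<lambda>_. n div 2)" "fst s2 4 = (\<lambda>_. Suc a)" "fst s2 2 = (\<lambda>_. 0)" "fst s2 3 = (\<lambda>_. 1)"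
      using 1 by (auto simp: s1_def s2_def)
    have d: "?st (embed P q 7 s2) = embed P q 4 s2"
      using pram_step_jump[OF p(4,8), of s2 0] s2 by simp
    have e: "bitlen n = Suc (bitlen (n div 2))" using False by (subst bitlen.simps) simp
    have "4 * bitlen n + 1 = (4 * bitlen (n div 2) + 1) + (1 + (1 + (1 + 1)))" using e by simp
    then have "(?st ^^ (4 * bitlen n + 1)) (embed P q 4 s) =
        (?st ^^ (4 * bitlen (n div 2) + 1)) (?st (?st (?st (?st (embed P q 4 s)))))"
      by (simp only: funpow_add comp_apply funpow_one)
    also have "\<dots> = embed P q 8 ((fst s2)(6 := \<lambda>_. 0, 4 := \<lambda>_. Suc a + bitlen (n div 2)), snd s2)"
      unfolding a b c d using 1(1)[OF False s2] .
    also have "\<dots> = embed P q 8 ((fst s)(6 := \<lambda>_. 0, 4 := \<lambda>_. a + bitlen n), snd s)"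
      by (simp add: e s1_def s2_def fun_upd_twist)
    finally show ?thesis .
  qed
qed

definition start :: "bool list \<Rightarrow> simd" where
  "start w = (\<lambda>r i. if r = 0 then i else if r = 1 then length w else 0,
    \<lambda>a. of_bool (a < length w \<and> w ! a))"

lemma pram_init_embed: "pram_init w = embed P (procs (pram_init w)) 0 (start w)"
  by (auto simp: pram_init_def embed_def start_def fun_eq_iff)

lemma steps_prelude:
  assumes c: "code_at prog 0 prelude"
  shows "\<exists>s. (pram_step prog P ^^ (4 * lg w + 5)) (embed P q 0 (start w)) = embed P q 8 s \<and>
    std (lg w) s \<and> fst s 0 = (\<lambda>i. i) \<and> fst s 1 = (\<lambda>_. length w) \<and> snd s = snd (start w)"
proof -
  let ?is = "[Const 2 0, Const 3 1, Const 4 0, Add 6 1 3]"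
  define s where "s = fold (istep P) ?is (start w)"
  have "code_at prog 0 ?is"
    using c code_at_append[of prog 0 ?is "drop 4 prelude"] by (simp add: prelude_def)
  moreover have "\<forall>i\<in>set ?is. \<not> is_jump i" "length ?is = 4" by simp_all
  ultimately have 1: "(pram_step prog P ^^ 4) (embed P q 0 (start w)) = embed P q 4 s"
    using steps_blk[of prog 0 ?is P q "start w"] unfolding s_def by (simp only: add_0)
  have s: "fst s 6 = (\<lambda>_. length w + 1)" "fst s 4 = (\<lambda>_. 0)" "fst s 2 = (\<lambda>_. 0)" "fst s 3 = (\<lambda>_. 1)"
    "fst s 0 = (\<lambda>i. i)" "fst s 1 = (\<lambda>_. length w)" "snd s = snd (start w)"
    by (auto simp: s_def start_def)
  let ?s = "((fst s)(6 := \<lambda>_. 0, 4 := \<lambda>_. 0 + lg w), snd s)"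
  have "4 * lg w + 5 = (4 * lg w + 1) + 4" by simp
  then have "(pram_step prog P ^^ (4 * lg w + 5)) (embed P q 0 (start w)) = embed P q 8 ?s"
    using steps_prelude_loop[OF c s(1-4), of P q] unfolding lg_def by (simp only: funpow_add comp_apply 1)
  moreover have "std (lg w) ?s \<and> fst ?s 0 = (\<lambda>i. i) \<and> fst ?s 1 = (\<lambda>_. length w) \<and> snd ?s = snd (start w)"
    using s by (simp add: std_def)
  ultimately show ?thesis by blast
qed

text \<open>The logarithm of \<open>length w + 2\<close> is at least 1 and so absorbs the additive
  constants into the factor 3.\<close>

lemma bitlen_log: "real (lg w) + 1 \<le> 3 * log 2 (real (length w) + 2)"
proof -
  have "2 ^ lg w \<le> 2 * (length w + 1)" unfolding lg_def by (rule bitlen_le) simp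
  then have "real (2 ^ lg w) \<le> real (2 * (length w + 1))" by (rule of_nat_mono)
  then have "2 ^ lg w \<le> 2 * (real (length w) + 2)" by simp
  then have "real (lg w) \<le> log 2 (2 * (real (length w) + 2))"
    by (simp add: le_log_iff powr_realpow)
  also have "\<dots> = 1 + log 2 (real (length w) + 2)"
    by (subst log_mult) auto
  finally have "real (lg w) \<le> 1 + log 2 (real (length w) + 2)" .
  moreover have "1 \<le> log 2 (real (length w) + 2)" by (subst le_log_iff) auto
  ultimately show ?thesis by linarith
qed

theorem fm_in_NC:
  assumes "arity_ok f 0"
  shows "{w. eval f w (\<lambda>_. False) (\<lambda>_. 0)} \<in> NC"
proof -
  \<comment> \<open>The successor makes \<open>m\<close> positive, so that block 0 has room for the
    whole input.\<close>
  define m where "m = Suc (width f 0)"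
  define c where "c = size_code m ;; digit_code m ;; code f m 0 [] (10 + m) ;; Blk [Const 6 0, Store 6 (10 + m)]"
  define prog where "prog = prelude @ compile 8 c"
  obtain C D where CD: "cost k c \<le> C * (k + 1) ^ D" for k using cost_poly[of c] by blast
  have len8: "length prelude = 8" by (simp add: prelude_def)
  have code: "code_at prog 0 prelude" "code_at prog 8 (compile 8 c)"
    using code_at_append[of prog 0 prelude "compile 8 c"] len8
    by (auto simp: prog_def code_at_def)
  have wf: "wf_cmd c" using wf_size wf_digit wf_code by (simp add: c_def)
  have tg: "{2, 3, 4} \<inter> targets c = {}"
    using targets_size[of m] targets_digit[of m] targets_code[of f m 0 "[]" "10 + m"]
    by (auto simp: c_def)
  have main: "\<exists>t. real t \<le> real ((C + 5) * 3 ^ Suc D) * log 2 (real (length w) + 2) ^ Suc D \<and>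
      (let P = (length w + 2) ^ (2 * m); s = pram_run prog P w t
       in pram_halted prog P s \<and> (mem s 0 \<noteq> 0 \<longleftrightarrow> w \<in> {w. eval f w (\<lambda>_. False) (\<lambda>_. 0)}))" for w
  proof -
    let ?P = "(length w + 2) ^ (2 * m)" and ?k = "lg w"
    let ?t = "cost ?k c + (4 * ?k + 5)"
    obtain q where q: "pram_init w = embed ?P q 0 (start w)"
      using pram_init_embed by blast
    let ?U = "2 * ubd w ^ m"
    obtain s where s: "(pram_step prog ?P ^^ (4 * ?k + 5)) (embed ?P q 0 (start w)) = embed ?P q 8 s"
      "std ?k s" "fst s 0 = (\<lambda>i. i)" "snd s = snd (start w)" "fst s 1 = (\<lambda>_. length w)"
      using steps_prelude[OF code(1)] by blast
    define s' where "s' = run ?P ?k c s"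
    have "pram_run prog ?P w ?t = (pram_step prog ?P ^^ cost ?k c) (embed ?P q 8 s)"
      unfolding pram_run_def q by (simp only: funpow_add[of "cost ?k c"] comp_apply s)
    also have "\<dots> = embed ?P q (8 + len c) s'"
      unfolding s'_def by (rule steps_compile[OF wf code(2) s(2) tg])
    finally have final: "pram_run prog ?P w ?t = embed ?P q (8 + len c) s'" .
    have "length prog = 8 + len c" by (simp add: prog_def len8)
    then have halted: "pram_halted prog ?P (pram_run prog ?P w ?t)"
      unfolding final by (simp add: pram_halted_def embed_def)
    \<comment> \<open>The origin of the exponent \<open>2 * m\<close>: \<open>ubd w\<close> is at
      most the square of \<open>length w + 2\<close>.\<close>
    have "ubd w \<le> 2 * (length w + 1)" unfolding lg_def by (rule bitlen_le) simp
    also have "\<dots> \<le> (length w + 2) ^ 2" by (simp add: power2_eq_square)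
    finally have "ubd w ^ m \<le> ((length w + 2) ^ 2) ^ m" by (rule power_mono) simp
    then have P: "ubd w ^ m \<le> ?P" by (simp only: power_mult)
    define s1 where "s1 = run ?P ?k (size_code m) s"
    define s2 where "s2 = run ?P ?k (digit_code m) s1"
    define s3 where "s3 = run ?P ?k (code f m 0 [] (10 + m)) s2"
    have s1: "fst s1 5 = (\<lambda>_. ?U)" "snd s1 = snd (start w)" "fst s1 0 = (\<lambda>i. i)" "std ?k s1"
      "fst s1 1 = (\<lambda>_. length w)"
      using run_size[of ?P ?k m s] s targets_size[of m]
      by (auto simp: s1_def std_def intro!: run_frame[THEN trans])
    then have s2: "snd s2 = snd (start w)" "\<forall>l<m. fst s2 (10 + l) = (\<lambda>i. dig (ubd w) i l)"
      using run_digit[of s1 ?P ?k m] by (auto simp: s2_def std_def)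
    have s2': "std ?k s2" "fst s2 5 = (\<lambda>_. ?U)" "fst s2 1 = (\<lambda>_. length w)"
      using s1 targets_digit[of m] by (auto simp: s2_def std_def intro!: run_frame[THEN trans])
    have "ubd w ^ 1 \<le> ubd w ^ m" by (rule power_increasing) (auto simp: m_def)
    then have lU: "length w < ?U" using length_less_ubd[of w] by simp
    have good: "good w m s2"
      using s2 s2' by (simp add: good_def start_def)
    have reg: "region w m 0 0 (\<lambda>_. False) (snd s2)"
      using lU s2(1) by (simp add: region_def start_def)
    have "fst s3 (10 + m) = (\<lambda>i. of_bool (eval f w (\<lambda>_. False) (env (ubd w) [] i)))"
      using eval_code[OF assms _ _ _ P _ good reg, of "[]" "10 + m"] by (simp add: s3_def m_def)
    moreover have "env (ubd w) [] i = (\<lambda>_. 0)" for i by (auto simp: env_def)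
    ultimately have s3: "fst s3 (10 + m) = (\<lambda>i. of_bool (eval f w (\<lambda>_. False) (\<lambda>_. 0)))" by simp
    have "s' = fold (istep ?P) [Const 6 0, Store 6 (10 + m)] s3"
      by (simp add: s'_def c_def s1_def s2_def s3_def)
    moreover have "\<exists>i. i < ?P" by (rule exI[of _ 0]) simp
    ultimately have "snd s' 0 = of_bool (eval f w (\<lambda>_. False) (\<lambda>_. 0))"
      using s3 by (auto split: if_splits)
    then have acc: "mem (pram_run prog ?P w ?t) 0 \<noteq> 0 \<longleftrightarrow> eval f w (\<lambda>_. False) (\<lambda>_. 0)"
      unfolding final by (simp add: embed_def)
    have "?t \<le> C * (?k + 1) ^ D + 5 * (?k + 1)" using CD[of ?k] by simp
    also have "\<dots> \<le> C * (?k + 1) ^ Suc D + 5 * (?k + 1) ^ Suc D"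
    proof (intro add_mono mult_le_mono2)
      show "(?k + 1) ^ D \<le> (?k + 1) ^ Suc D" by (rule power_increasing) auto
      show "?k + 1 \<le> (?k + 1) ^ Suc D" using power_increasing[of 1 "Suc D" "?k + 1"] by simp
    qed
    finally have "real ?t \<le> real ((C + 5) * (?k + 1) ^ Suc D)"
      by (subst of_nat_le_iff) (simp only: add_mult_distrib)
    also have "\<dots> = real (C + 5) * (real ?k + 1) ^ Suc D"
      by (simp only: of_nat_mult of_nat_power of_nat_add of_nat_1)
    also have "\<dots> \<le> real (C + 5) * (3 * log 2 (real (length w) + 2)) ^ Suc D"
      using bitlen_log[of w] by (intro mult_left_mono power_mono) auto
    also have "\<dots> = real ((C + 5) * 3 ^ Suc D) * log 2 (real (length w) + 2) ^ Suc D"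
      by (simp only: power_mult_distrib of_nat_mult of_nat_power of_nat_numeral mult.assoc)
    finally show ?thesis
      using halted acc by (intro exI[of _ ?t]) (simp add: Let_def)
  qed
  show ?thesis unfolding NC_def by (rule CollectI, rule exI, rule exI, rule exI, rule exI, rule allI, rule main)
qed

section \<open>Definable predicates\<close>

text \<open>Definability is a property of the predicate, not of a formula, so formulas never have to
  be written out: the rules collected in \<open>fo_intros\<close> build them along the structure of
  the predicate. The number \<open>p\<close> is the arity of the relation variable.\<close>

definition fo :: "nat \<Rightarrow> (bool list \<Rightarrow> (nat list \<Rightarrow> bool) \<Rightarrow> (nat \<Rightarrow> nat) \<Rightarrow> bool) \<Rightarrow> bool" where
  "fo p Q \<longleftrightarrow> (\<exists>f. arity_ok f p \<and> (\<forall>w X e. (\<forall>v. e v < ubd w) \<longrightarrow> eval f w X e = Q w X e))"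

lemma foI: "arity_ok f p \<Longrightarrow> (\<And>w X e. (\<And>v. e v < ubd w) \<Longrightarrow> eval f w X e = Q w X e) \<Longrightarrow> fo p Q"
  by (auto simp: fo_def)

lemma foE:
  assumes "fo p Q"
  obtains f where "arity_ok f p" "\<And>w X e. (\<And>v. e v < ubd w) \<Longrightarrow> eval f w X e = Q w X e"
  using assms by (auto simp: fo_def)

lemma fo_cong: "fo p Q \<Longrightarrow> (\<And>w X e. (\<And>v. e v < ubd w) \<Longrightarrow> Q w X e = R w X e) \<Longrightarrow> fo p R"
  by (auto simp: fo_def)

named_theorems fo_intros

lemma fo_plus [fo_intros]: "fo p (\<lambda>w X e. e a + e b = e c)"
  by (rule foI[where f = "Plus a b c"]) auto

lemma fo_is [fo_intros]: "fo p (\<lambda>w X e. e a = c)"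
  by (rule foI[where f = "Is a c"]) auto

lemma fo_len [fo_intros]: "fo p (\<lambda>w X e. e a = length w)"
  by (rule foI[where f = "Len a"]) auto

lemma fo_bit: "fo p (\<lambda>w X e. e a < length w \<and> w ! e a)"
  by (rule foI[where f = "Bit a"]) auto

lemma fo_nand: "fo p Q \<Longrightarrow> fo p R \<Longrightarrow> fo p (\<lambda>w X e. \<not> (Q w X e \<and> R w X e))"
proof (elim foE)
  fix f g
  assume "arity_ok f p" "arity_ok g p"
    "\<And>w X e. (\<And>v. e v < ubd w) \<Longrightarrow> eval f w X e = Q w X e"
    "\<And>w X e. (\<And>v. e v < ubd w) \<Longrightarrow> eval g w X e = R w X e"
  then show ?thesis by (intro foI[where f = "Nand f g"]) simp_all
qed

lemma fo_not [fo_intros]: "fo p Q \<Longrightarrow> fo p (\<lambda>w X e. \<not> Q w X e)"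
  using fo_nand[of p Q Q] by simp

lemma fo_and [fo_intros]: "fo p Q \<Longrightarrow> fo p R \<Longrightarrow> fo p (\<lambda>w X e. Q w X e \<and> R w X e)"
  using fo_not[OF fo_nand[of p Q R]] by simp

lemma fo_or [fo_intros]: "fo p Q \<Longrightarrow> fo p R \<Longrightarrow> fo p (\<lambda>w X e. Q w X e \<or> R w X e)"
  using fo_nand[OF fo_not fo_not, of p Q R] by simp

lemma fo_imp [fo_intros]:
  assumes "fo p Q" "fo p R"
  shows "fo p (\<lambda>w X e. Q w X e \<longrightarrow> R w X e)"
proof (rule fo_cong)
  show "fo p (\<lambda>w X e. \<not> Q w X e \<or> R w X e)"
    by (intro fo_or fo_not assms)
qed blast

lemma fo_iff [fo_intros]:
  assumes "fo p Q" "fo p R"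
  shows "fo p (\<lambda>w X e. Q w X e \<longleftrightarrow> R w X e)"
proof (rule fo_cong)
  show "fo p (\<lambda>w X e. (Q w X e \<longrightarrow> R w X e) \<and> (R w X e \<longrightarrow> Q w X e))"
    by (intro fo_and fo_imp assms)
qed blast

lemma fo_if [fo_intros]:
  assumes "fo p B" "fo p Q" "fo p R"
  shows "fo p (\<lambda>w X e. if B w X e then Q w X e else R w X e)"
proof (rule fo_cong)
  show "fo p (\<lambda>w X e. (B w X e \<longrightarrow> Q w X e) \<and> (\<not> B w X e \<longrightarrow> R w X e))"
    by (intro fo_and fo_imp fo_not assms)
qed simp

text \<open>\<open>Q\<close> takes the bound value as a separate argument; unification with a
  quantifier of the logic then performs the shift of de Bruijn indices.\<close>

lemma fo_ex [fo_intros]: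
  assumes "fo p (\<lambda>w X e. Q w X (\<lambda>i. e (Suc i)) (e 0))"
  shows "fo p (\<lambda>w X e. \<exists>x<ubd w. Q w X e x)"
  using assms
proof (rule foE)
  fix f
  assume f: "arity_ok f p" "\<And>w X e. (\<And>v. e v < ubd w) \<Longrightarrow> eval f w X e = Q w X (\<lambda>i. e (Suc i)) (e 0)"
  have b: "case_nat x e v < ubd w" if "x < ubd w" "\<And>v. e v < ubd w" for x e v w
    using that by (cases v) auto
  show ?thesis
    by (rule foI[where f = "Ex f"]) (use f b in auto)
qed

lemma fo_all [fo_intros]:
  assumes "fo p (\<lambda>w X e. Q w X (\<lambda>i. e (Suc i)) (e 0))"
  shows "fo p (\<lambda>w X e. \<forall>x<ubd w. Q w X e x)"
  using fo_not[OF fo_ex[OF fo_not[OF assms]]] by simp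

lemma fo_rel: "length vs = p \<Longrightarrow> fo p (\<lambda>w X e. X (map e vs))"
  by (rule foI[where f = "Rel vs"]) auto

lemma fo_rel3 [fo_intros]: "fo 3 (\<lambda>w X e. X [e a, e b, e c])"
  using fo_rel[of "[a, b, c]"] by (simp add: numeral_eq_Suc)

lemma fo_rel4 [fo_intros]: "fo 4 (\<lambda>w X e. X [e a, e b, e c, e d])"
  using fo_rel[of "[a, b, c, d]"] by (simp add: numeral_eq_Suc)

lemma fo_rel8 [fo_intros]: "fo 8 (\<lambda>w X e. X [e a, e b, e c, e d, e a', e b', e c', e d'])"
  using fo_rel[of "[a, b, c, d, a', b', c', d']"] by (simp add: numeral_eq_Suc)

text \<open>A formula queries the relation only at tuples of the right length with entries in the
  universe. Hence \<open>fo_fix\<close> may identify operators that agree on such tuples.\<close>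

lemma eval_rel_cong:
  assumes "arity_ok f p" "\<And>v. e v < ubd w"
    "\<And>xs. length xs = p \<Longrightarrow> \<forall>x\<in>set xs. x < ubd w \<Longrightarrow> X xs = Y xs"
  shows "eval f w X e = eval f w Y e"
  using assms
proof (induction f arbitrary: e)
  case (Ex f)
  have b: "case_nat x e v < ubd w" if "x < ubd w" for x v
    using that Ex.prems by (cases v) auto
  show ?case using Ex.IH[OF _ b] Ex.prems by auto
next
  case (Nand f g)
  then show ?case by (metis arity_ok.simps(5) eval.simps(5))
qed auto

lemma fo_fix:
  assumes "fo p (\<lambda>w X e. F w X (map e [0..<p]))" "length vs = p"
  shows "fo q (\<lambda>w X e. (F w ^^ (c * lg w)) (\<lambda>_. False) (map e vs))"
proof -
  obtain f where f: "arity_ok f p"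
    "\<And>w X e. (\<And>v. e v < ubd w) \<Longrightarrow> eval f w X e = F w X (map e [0..<p])"
    using assms(1) unfolding fo_def by blast
  have "((\<lambda>Y xs. eval f w Y (pad xs)) ^^ j) (\<lambda>_. False) xs = (F w ^^ j) (\<lambda>_. False) xs"
    if "length xs = p" "\<forall>x\<in>set xs. x < ubd w" for w j xs
    using that
  proof (induction j arbitrary: xs)
    case (Suc j)
    have p: "pad xs v < ubd w" for v using Suc.prems by (simp add: pad_def)
    have m: "map (pad xs) [0..<p] = xs" using Suc.prems by (auto intro!: nth_equalityI simp: pad_def)
    have "eval f w (((\<lambda>Y xs. eval f w Y (pad xs)) ^^ j) (\<lambda>_. False)) (pad xs) =
        eval f w ((F w ^^ j) (\<lambda>_. False)) (pad xs)"
      using Suc.IH by (intro eval_rel_cong[OF f(1) p])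
    also have "\<dots> = F w ((F w ^^ j) (\<lambda>_. False)) xs"
      using f(2)[OF p, of "(F w ^^ j) (\<lambda>_. False)"] m by simp
    finally show ?case by simp
  qed simp
  then show ?thesis
    by (intro foI[where f = "Fix c f vs"]) (use f assms in auto)
qed

section \<open>Order, successor and multiplication\<close>

lemma one_less_ubd: "1 < ubd w" and zero_less_ubd: "0 < ubd w"
  using length_less_ubd[of w] by auto

lemma fo_eq [fo_intros]: "fo p (\<lambda>w X e. e a = e b)"
proof (rule fo_cong)
  show "fo p (\<lambda>w X e. \<exists>x<ubd w. x = 0 \<and> e a + x = e b)"
    by (intro fo_intros)
qed auto

lemma fo_le [fo_intros]: "fo p (\<lambda>w X e. e a \<le> e b)"
proof (rule fo_cong)
  show "fo p (\<lambda>w X e. \<exists>x<ubd w. e a + x = e b)"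
    by (intro fo_intros)
qed (metis le_add1 le_add2 le_Suc_ex order.strict_trans1)

lemma fo_less [fo_intros]: "fo p (\<lambda>w X e. e a < e b)"
  unfolding not_le[symmetric] by (intro fo_intros)

lemma fo_suc [fo_intros]: "fo p (\<lambda>w X e. Suc (e a) = e b)"
proof (rule fo_cong)
  show "fo p (\<lambda>w X e. \<exists>x<ubd w. x = 1 \<and> e a + x = e b)"
    by (intro fo_intros)
qed (use one_less_ubd in auto)

text \<open>Recursion on the binary digits of the first factor.\<close>

definition mult_op :: "bool list \<Rightarrow> (nat list \<Rightarrow> bool) \<Rightarrow> nat list \<Rightarrow> bool" where
  "mult_op w X xs \<longleftrightarrow> xs ! 0 = 0 \<and> xs ! 2 = 0 \<or>
    (\<exists>a<ubd w. \<exists>b<ubd w. \<exists>c<ubd w. \<exists>d<ubd w. b = xs ! 1 \<and> X [a, b, c] \<and> c + c = d \<and>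
      (a + a = xs ! 0 \<and> d = xs ! 2 \<or> (\<exists>z<ubd w. a + a = z \<and> Suc z = xs ! 0) \<and> d + b = xs ! 2))"

lemma mult_op_pair:
  assumes "b < ubd w"
  shows "mult_op w X [a, b, c] \<longleftrightarrow> a = 0 \<and> c = 0 \<or>
    (\<exists>a'<ubd w. \<exists>c'<ubd w. X [a', b, c'] \<and> c' + c' < ubd w \<and>
      (a' + a' = a \<and> c' + c' = c \<or> a' + a' < ubd w \<and> Suc (a' + a') = a \<and> c' + c' + b = c))"
  using assms by (auto simp: mult_op_def)

text \<open>One round per binary digit of \<open>a\<close>, plus one for the case
  \<open>a = 0\<close>. All intermediate products are at most \<open>c\<close> and thus stay in the
  universe.\<close>

lemma mult_op_iter:
  assumes "a < 2 ^ j" "a < ubd w" "b < ubd w" "c < ubd w"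
  shows "(mult_op w ^^ Suc j) (\<lambda>_. False) [a, b, c] \<longleftrightarrow> a * b = c"
  using assms
proof (induction j arbitrary: a c)
  case 0
  then show ?case by (auto simp: mult_op_def)
next
  case (Suc j)
  define Y where "Y = (mult_op w ^^ Suc j) (\<lambda>_. False)"
  have sub: "Y [a', b, c'] \<longleftrightarrow> a' * b = c'" if "a' < 2 ^ j" "a' < ubd w" "c' < ubd w" for a' c'
    using Suc that by (auto simp: Y_def)
  have "mult_op w Y [a, b, c] \<longleftrightarrow> a * b = c"
  proof
    assume "mult_op w Y [a, b, c]"
    then consider "a = 0" "c = 0"
      | a' c' where "a' < ubd w" "c' < ubd w" "Y [a', b, c']"
          "a' + a' = a \<and> c' + c' = c \<or> Suc (a' + a') = a \<and> c' + c' + b = c"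
      using Suc.prems by (auto simp: mult_op_pair)
    then show "a * b = c"
    proof cases
      case 2
      then have "a' < 2 ^ j" using Suc.prems by auto
      then have "c' = a' * b" using sub 2 by simp
      then show ?thesis using 2 by (auto simp: algebra_simps)
    qed simp
  next
    assume c: "a * b = c"
    let ?a = "a div 2"
    have a: "?a < 2 ^ j" "?a < ubd w" using Suc.prems by auto
    have ab: "?a * b + ?a * b + (if even a then 0 else b) = c"
    proof -
      have "?a + ?a + (if even a then 0 else 1) = a"
        by (cases "even a"; simp; presburger)
      then have "(?a + ?a + (if even a then 0 else 1)) * b = c" using c by argo
      then show ?thesis by (cases "even a") (auto simp: algebra_simps)
    qed
    then have "?a * b < ubd w" "?a * b + ?a * b < ubd w" using Suc.prems by auto
    moreover have "Y [?a, b, ?a * b]" using sub a \<open>?a * b < ubd w\<close> by simp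
    moreover have "?a + ?a < ubd w" using Suc.prems by auto
    moreover have "if even a then ?a + ?a = a else Suc (?a + ?a) = a"
      by (cases "even a"; simp; presburger)
    ultimately show "mult_op w Y [a, b, c]"
      unfolding mult_op_pair[OF \<open>b < ubd w\<close>] using ab a Suc.prems
      by (intro disjI2, intro exI[of _ ?a], intro conjI, simp, intro exI[of _ "?a * b"])
        (auto split: if_splits)
  qed
  then show ?case by (simp add: Y_def)
qed

lemma fo_mult: "fo p (\<lambda>w X e. e a * e b = e c)"
proof (rule fo_cong)
  have "map e [0..<3] = [e 0, e 1, e 2]" for e :: "nat \<Rightarrow> nat"
    by (simp add: upt_rec numeral_eq_Suc)
  moreover have "[a, b, c] ! 0 = a" "[a, b, c] ! 1 = b" "[a, b, c] ! 2 = c" for a b c :: nat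
    by simp_all
  ultimately have "fo 3 (\<lambda>w X e. mult_op w X (map e [0..<3]))"
    unfolding mult_op_def by (simp only:) (intro fo_intros)
  \<comment> \<open>\<open>lg w + 1\<close> rounds are needed, but the number of rounds must be a
    multiple of \<open>lg w\<close>.\<close>
  then show "fo p (\<lambda>w X e. (mult_op w ^^ (2 * lg w)) (\<lambda>_. False) (map e [a, b, c]))"
    by (rule fo_fix) simp
next
  fix w :: "bool list" and X :: "nat list \<Rightarrow> bool" and e :: "nat \<Rightarrow> nat"
  assume e: "\<And>v. e v < ubd w"
  have "0 < lg w" using one_less_ubd[of w] by (cases "lg w") auto
  then obtain j where j: "2 * lg w = Suc j" "lg w \<le> j" by (cases "lg w") auto
  have "e a < ubd w" by (rule e)
  also have "\<dots> \<le> 2 ^ j" using j by (intro power_increasing) auto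
  finally show "(mult_op w ^^ (2 * lg w)) (\<lambda>_. False) (map e [a, b, c]) = (e a * e b = e c)"
    unfolding j(1) using mult_op_iter e by simp
qed

lemma fo_in_NC:
  assumes "fo 0 (\<lambda>w X e. Q w)"
  shows "{w. Q w} \<in> NC"
proof -
  obtain f where f: "arity_ok f 0" "\<And>w X e. (\<And>v. e v < ubd w) \<Longrightarrow> eval f w X e = Q w"
    using assms unfolding fo_def by blast
  then have "eval f w (\<lambda>_. False) (\<lambda>_. 0) = Q w" for w by simp
  then show ?thesis using fm_in_NC[OF f(1)] by simp
qed

section \<open>Reachability\<close>

text \<open>The vertices are pairs because the walks of interest run over directed edges of a
  graph.\<close>

definition arcs_rel :: "(bool list \<Rightarrow> nat \<Rightarrow> nat \<Rightarrow> nat \<Rightarrow> nat \<Rightarrow> bool) \<Rightarrow> bool list \<Rightarrow> ((nat \<times> nat) \<times> nat \<times> nat) set"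
  where "arcs_rel St w =
    {((a, b), (c, d)) | a b c d. a < ubd w \<and> b < ubd w \<and> c < ubd w \<and> d < ubd w \<and> St w a b c d}"

text \<open>Path doubling: each round composes the relation with itself.\<close>

definition reach_op ::
    "(bool list \<Rightarrow> nat \<Rightarrow> nat \<Rightarrow> nat \<Rightarrow> nat \<Rightarrow> bool) \<Rightarrow> bool list \<Rightarrow> (nat list \<Rightarrow> bool) \<Rightarrow> nat list \<Rightarrow> bool"
  where "reach_op St w X xs \<longleftrightarrow>
    xs ! 0 = xs ! 2 \<and> xs ! 1 = xs ! 3 \<or> St w (xs ! 0) (xs ! 1) (xs ! 2) (xs ! 3) \<or>
    (\<exists>a'<ubd w. \<exists>b'<ubd w. \<exists>a<ubd w. \<exists>b<ubd w. \<exists>c<ubd w. \<exists>d<ubd w.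
      a = xs ! 0 \<and> b = xs ! 1 \<and> c = xs ! 2 \<and> d = xs ! 3 \<and> X [a, b, a', b'] \<and> X [a', b', c, d])"

lemma nth4: "[a, b, c, d] ! 0 = a" "[a, b, c, d] ! 1 = b" "[a, b, c, d] ! 2 = c" "[a, b, c, d] ! 3 = d"
  by simp_all

lemma reach_op_iter:
  assumes "a < ubd w" "b < ubd w" "c < ubd w" "d < ubd w"
  shows "(reach_op St w ^^ Suc j) (\<lambda>_. False) [a, b, c, d] \<longleftrightarrow>
    (\<exists>m\<le>2 ^ j. ((a, b), (c, d)) \<in> arcs_rel St w ^^ m)"
  using assms
proof (induction j arbitrary: a b c d)
  case 0
  have "(\<exists>m\<le>1. ((a, b), (c, d)) \<in> arcs_rel St w ^^ m) \<longleftrightarrow>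
      (a, b) = (c, d) \<or> ((a, b), (c, d)) \<in> arcs_rel St w"
    by (auto simp: le_Suc_eq)
  then show ?case using 0 by (auto simp: reach_op_def arcs_rel_def nth4)
next
  case (Suc j)
  define R where "R = arcs_rel St w"
  define Y where "Y = (reach_op St w ^^ Suc j) (\<lambda>_. False)"
  have IH: "Y [a, b, c, d] \<longleftrightarrow> (\<exists>m\<le>2 ^ j. ((a, b), (c, d)) \<in> R ^^ m)"
    if "a < ubd w" "b < ubd w" "c < ubd w" "d < ubd w" for a b c d
    unfolding Y_def R_def using Suc.IH that .
  have "reach_op St w Y [a, b, c, d] \<longleftrightarrow> (\<exists>m\<le>2 ^ Suc j. ((a, b), (c, d)) \<in> R ^^ m)"
  proof
    assume "reach_op St w Y [a, b, c, d]"
    then consider "(a, b) = (c, d)" | "((a, b), (c, d)) \<in> R"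
      | a' b' where "a' < ubd w" "b' < ubd w" "Y [a, b, a', b']" "Y [a', b', c, d]"
      using Suc.prems by (auto simp: reach_op_def R_def arcs_rel_def nth4)
    then show "\<exists>m\<le>2 ^ Suc j. ((a, b), (c, d)) \<in> R ^^ m"
    proof cases
      case 1
      then show ?thesis by (intro exI[of _ 0]) auto
    next
      case 2
      then show ?thesis by (intro exI[of _ 1]) auto
    next
      case 3
      then obtain m m' where "m \<le> 2 ^ j" "((a, b), (a', b')) \<in> R ^^ m" "m' \<le> 2 ^ j"
        "((a', b'), (c, d)) \<in> R ^^ m'"
        using IH Suc.prems by auto
      then show ?thesis by (intro exI[of _ "m + m'"]) (auto simp: relpow_add)
    qed
  next
    assume "\<exists>m\<le>2 ^ Suc j. ((a, b), (c, d)) \<in> R ^^ m"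
    then obtain m where m: "m \<le> 2 ^ Suc j" "((a, b), (c, d)) \<in> R ^^ m" by blast
    define m1 where "m1 = min m (2 ^ j)"
    define m2 where "m2 = m - m1"
    have "m = m1 + m2" "m1 \<le> 2 ^ j" "m2 \<le> 2 ^ j" using m by (auto simp: m1_def m2_def)
    then obtain a' b' where 1: "((a, b), (a', b')) \<in> R ^^ m1" "((a', b'), (c, d)) \<in> R ^^ m2"
      using m by (auto simp: relpow_add)
    have "a' < ubd w \<and> b' < ubd w"
    proof (cases m1)
      case 0
      then show ?thesis using 1 Suc.prems by auto
    next
      case (Suc i)
      then show ?thesis using 1(1) by (auto simp: R_def arcs_rel_def)
    qed
    then show "reach_op St w Y [a, b, c, d]"
      using IH[of a b a' b'] IH[of a' b' c d] 1 \<open>m1 \<le> 2 ^ j\<close> \<open>m2 \<le> 2 ^ j\<close> Suc.prems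
      unfolding reach_op_def nth4
      by (intro disjI2) (rule exI[of _ a'], rule conjI, simp, rule exI[of _ b'], auto)
  qed
  then show ?case by (simp add: Y_def R_def)
qed

text \<open>A reachable vertex is reached in at most as many steps as there are arcs, hence at most
  \<open>2 ^ (4 * lg w)\<close>. This takes \<open>4 * lg w\<close> doublings and one initial round,
  together at most \<open>5 * lg w\<close>.\<close>

lemma reach_op_rtrancl:
  assumes "a < ubd w" "b < ubd w" "c < ubd w" "d < ubd w"
  shows "(reach_op St w ^^ (5 * lg w)) (\<lambda>_. False) [a, b, c, d] \<longleftrightarrow>
    ((a, b), (c, d)) \<in> (arcs_rel St w)\<^sup>*"
proof -
  let ?D = "({..<ubd w} \<times> {..<ubd w}) \<times> {..<ubd w} \<times> {..<ubd w}"
  have sub: "arcs_rel St w \<subseteq> ?D" by (auto simp: arcs_rel_def)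
  then have fin: "finite (arcs_rel St w)" by (rule finite_subset) auto
  have "card (arcs_rel St w) \<le> card ?D" using sub by (intro card_mono) auto
  also have "card ?D = 2 ^ (4 * lg w)"
  proof -
    have "4 * lg w = (lg w + lg w) + (lg w + lg w)" by simp
    then show ?thesis by (simp only: card_cartesian_product card_lessThan power_add)
  qed
  finally have card: "card (arcs_rel St w) \<le> 2 ^ (4 * lg w)" .
  have "0 < lg w" using one_less_ubd[of w] by (cases "lg w") auto
  then obtain j where j: "5 * lg w = Suc j" "4 * lg w \<le> j" by (cases "lg w") auto
  have "(2::nat) ^ (4 * lg w) \<le> 2 ^ j" using j by (intro power_increasing) auto
  with card have "card (arcs_rel St w) \<le> 2 ^ j" by linarith
  then have "((a, b), (c, d)) \<in> (arcs_rel St w)\<^sup>* \<longleftrightarrow> (\<exists>m\<le>2 ^ j. ((a, b), (c, d)) \<in> arcs_rel St w ^^ m)"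
    using rtrancl_finite_eq_relpow[OF fin] relpow_imp_rtrancl[of "((a, b), (c, d))" _ "arcs_rel St w"]
    by (auto intro: order_trans)
  then show ?thesis unfolding j(1) reach_op_iter[OF assms] ..
qed

lemma fo_reach:
  assumes "\<And>p a b c d. fo p (\<lambda>w X e. St w (e a) (e b) (e c) (e d))"
  shows "fo p (\<lambda>w X e. ((e a, e b), (e c, e d)) \<in> (arcs_rel St w)\<^sup>*)"
proof (rule fo_cong)
  have "map e [0..<4] = [e 0, e 1, e 2, e 3]" for e :: "nat \<Rightarrow> nat"
    by (simp add: upt_rec numeral_eq_Suc)
  then have "fo 4 (\<lambda>w X e. reach_op St w X (map e [0..<4]))"
    unfolding reach_op_def by (simp only: nth4) (intro fo_intros assms)
  then show "fo p (\<lambda>w X e. (reach_op St w ^^ (5 * lg w)) (\<lambda>_. False) (map e [a, b, c, d]))"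
    by (rule fo_fix) simp
qed (use reach_op_rtrancl in simp)

section \<open>Derivation trees of polynomial size\<close>

text \<open>
  \<open>X c a\<close> says that \<open>c\<close> can be derived from the hypothesis \<open>a\<close>, where \<open>t\<close> is a trivial fact, so
  that \<open>X c t\<close> says that \<open>c\<close> can be derived.  Splitting a derivation tree or a tree with
  a hole in the middle halves the sizes, so the number of rounds is logarithmic in the number of leaves.
\<close>

locale derivation =
  fixes D :: "'f set" and B :: "'f \<Rightarrow> bool" and ru :: "'f \<Rightarrow> 'f \<Rightarrow> 'f \<Rightarrow> bool" and t :: 'f
begin

text \<open>Derive \<open>c\<close> from an inner node \<open>v\<close>, apply a rule at
  \<open>v\<close>, derive one premise outright and the other from \<open>a\<close>. For
  \<open>a = t\<close> both premises are derived outright, so one clause serves trees and trees with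
  a hole.\<close>

definition pebble :: "('f \<Rightarrow> 'f \<Rightarrow> bool) \<Rightarrow> 'f \<Rightarrow> 'f \<Rightarrow> bool" where
  "pebble X c a \<longleftrightarrow> c = a \<or> a = t \<and> B c \<or>
    (\<exists>v\<in>D. \<exists>p\<in>D. \<exists>q\<in>D. X c v \<and> (ru v p q \<or> ru v q p) \<and> X q t \<and> X p a)"

abbreviation "rounds j \<equiv> (pebble ^^ j) (\<lambda>_ _. False)"

text \<open>The number counts leaves; in \<open>hole\<close>, the hole itself is not
  counted.\<close>

inductive der :: "'f \<Rightarrow> nat \<Rightarrow> bool" where
  der_base: "c \<in> D \<Longrightarrow> B c \<Longrightarrow> der c 1"
| der_rule: "c \<in> D \<Longrightarrow> ru c p q \<or> ru c q p \<Longrightarrow> der p m \<Longrightarrow> der q m' \<Longrightarrow> der c (m + m')"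

inductive hole :: "'f \<Rightarrow> 'f \<Rightarrow> nat \<Rightarrow> bool" where
  hole_refl: "c \<in> D \<Longrightarrow> hole c c 0"
| hole_rule: "c \<in> D \<Longrightarrow> ru c p q \<or> ru c q p \<Longrightarrow> hole p a m \<Longrightarrow> der q m' \<Longrightarrow> hole c a (m + m')"

lemma der_D: "der c m \<Longrightarrow> c \<in> D" and der_pos: "der c m \<Longrightarrow> 0 < m"
  by (induction rule: der.induct) auto

lemma hole_D: "hole c a m \<Longrightarrow> c \<in> D \<and> a \<in> D"
  by (induction rule: hole.induct) auto

text \<open>Descend into a premise with more than \<open>s\<close> leaves as long as there is one.
  The node where this stops has more than \<open>s\<close> leaves, but each premise has at most
  \<open>s\<close>. If \<open>m \<le> 2 * s\<close>, fewer than \<open>s\<close> leaves remain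
  outside it.\<close>

lemma split_der:
  assumes "der c m" "0 < s" "s < m"
  shows "\<exists>v p q m0 m1 m2. hole c v m0 \<and> (ru v p q \<or> ru v q p) \<and> der p m1 \<and> der q m2 \<and>
    m1 \<le> s \<and> m2 \<le> s \<and> s < m1 + m2 \<and> m = m0 + (m1 + m2)"
  using assms
proof (induction rule: der.induct)
  case (der_base c)
  then show ?case by simp
next
  case (der_rule c p q m m')
  consider "m \<le> s" "m' \<le> s" | "s < m" | "s < m'" by linarith
  then show ?case
  proof cases
    case 1
    then show ?thesis using der_rule hole_refl by (metis add_0)
  next
    case 2
    then obtain v p' q' m0 m1 m2 where *: "hole p v m0" "ru v p' q' \<or> ru v q' p'" "der p' m1" "der q' m2"
      "m1 \<le> s" "m2 \<le> s" "s < m1 + m2" "m = m0 + (m1 + m2)"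
      using der_rule by blast
    have "hole c v (m0 + m')" using * der_rule by (intro hole_rule)
    moreover have "m + m' = (m0 + m') + (m1 + m2)" using * by simp
    ultimately show ?thesis using * by blast
  next
    case 3
    then obtain v p' q' m0 m1 m2 where *: "hole q v m0" "ru v p' q' \<or> ru v q' p'" "der p' m1" "der q' m2"
      "m1 \<le> s" "m2 \<le> s" "s < m1 + m2" "m' = m0 + (m1 + m2)"
      using der_rule by blast
    have "hole c v (m0 + m)" using * der_rule by (intro hole_rule[of _ q p]) auto
    moreover have "m + m' = (m0 + m) + (m1 + m2)" using * by simp
    ultimately show ?thesis using * by blast
  qed
qed

text \<open>Here the descent must follow the path to the hole, so the premise \<open>q\<close>
  beside the path can have more than \<open>s\<close> leaves.\<close>

lemma split_hole:
  assumes "hole c a m" "s < m"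
  shows "\<exists>v p q m0 m1 m2. hole c v m0 \<and> (ru v p q \<or> ru v q p) \<and> hole p a m1 \<and> der q m2 \<and>
    m1 \<le> s \<and> s < m1 + m2 \<and> m = m0 + (m1 + m2)"
  using assms
proof (induction rule: hole.induct)
  case (hole_refl c)
  then show ?case by simp
next
  case (hole_rule c p q a m m')
  show ?case
  proof (cases "m \<le> s")
    case True
    then show ?thesis using hole_rule hole.hole_refl by (metis add_0)
  next
    case False
    then obtain v p' q' m0 m1 m2 where *: "hole p v m0" "ru v p' q' \<or> ru v q' p'" "hole p' a m1" "der q' m2"
      "m1 \<le> s" "s < m1 + m2" "m = m0 + (m1 + m2)"
      using hole_rule by (metis not_le)
    have "hole c v (m0 + m')" using * hole_rule by (intro hole.hole_rule)
    moreover have "m + m' = (m0 + m') + (m1 + m2)" using * by simp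
    ultimately show ?thesis using * by blast
  qed
qed

lemma pebble_mono: "X \<le> Y \<Longrightarrow> pebble X \<le> pebble Y"
  unfolding pebble_def le_fun_def le_bool_def by blast

lemma rounds_mono: "i \<le> j \<Longrightarrow> rounds i \<le> rounds j"
proof (rule lift_Suc_mono_le)
  show "rounds j \<le> rounds (Suc j)" for j
  proof (induction j)
    case (Suc j)
    then show ?case using pebble_mono by simp
  qed (simp add: le_fun_def)
qed

text \<open>Two rounds per doubling of the size. Trees come first; trees with a hole need one more
  round, because splitting them can leave a side tree of full size, which the first of the two
  rounds has already settled.\<close>

lemma rounds_complete:
  "(der c m \<longrightarrow> m \<le> 2 ^ j \<longrightarrow> rounds (2 * j + 1) c t) \<and>
   (hole c a m \<longrightarrow> m \<le> 2 ^ j \<longrightarrow> rounds (2 * j + 2) c a)"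
proof (induction j arbitrary: c a m)
  case 0
  have 1: "rounds 1 c t" if "der c m" "m \<le> 1" for c m
    using that(1)
  proof cases
    case der_base
    then show ?thesis by (simp add: pebble_def)
  next
    case (der_rule p q m1 m2)
    then have "0 < m1" "0 < m2" using der_pos by blast+
    then show ?thesis using that(2) der_rule by simp
  qed
  have "rounds (Suc 1) c a" if "hole c a m" "m \<le> 1" for c a m
    using that(1)
  proof cases
    case hole_refl
    then show ?thesis by (simp add: pebble_def)
  next
    case (hole_rule p q m1 m2)
    have "0 < m2" using hole_rule der_pos by blast
    then have "m1 = 0" "m2 = 1" using that(2) hole_rule by auto
    have "p = a" using hole_rule(4) \<open>m1 = 0\<close> by cases (auto dest: der_pos)
    moreover have "rounds 1 q t" using 1 hole_rule \<open>m2 = 1\<close> by simp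
    moreover have "rounds 1 c c" "rounds 1 a a" by (simp_all add: pebble_def)
    moreover have "q \<in> D" "a \<in> D" "c \<in> D" using hole_rule der_D hole_D by auto
    ultimately have "pebble (rounds 1) c a"
      using hole_rule unfolding pebble_def[of "rounds 1"] by blast
    then show ?thesis by simp
  qed
  with 1 show ?case by (simp add: numeral_2_eq_2)
next
  case (Suc j)
  let ?s = "2 ^ j :: nat"
  have mono: "rounds i c a \<Longrightarrow> i \<le> i' \<Longrightarrow> rounds i' c a" for i i' c a
    using rounds_mono[of i i'] by (auto simp: le_fun_def)
  have 1: "rounds (2 * j + 3) c t" if d: "der c m" "m \<le> 2 ^ Suc j" for c m
  proof (cases "m \<le> ?s")
    case True
    then show ?thesis using Suc that mono[of "2 * j + 1" c t "2 * j + 3"] by auto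
  next
    case False
    then have sm: "?s < m" by simp
    obtain v p q m0 m1 m2 where *: "hole c v m0" "ru v p q \<or> ru v q p" "der p m1" "der q m2"
      "m1 \<le> ?s" "m2 \<le> ?s" "?s < m1 + m2" "m = m0 + (m1 + m2)"
      using split_der[OF d(1) zero_less_power[OF zero_less_numeral] sm] by blast
    let ?X = "rounds (2 * j + 2)"
    have "m0 \<le> ?s" using * d by simp
    then have "?X c v" using Suc * by blast
    moreover have "?X p t" "?X q t"
      using Suc * mono[of "2 * j + 1" _ t "2 * j + 2"] by auto
    moreover have "v \<in> D" "p \<in> D" "q \<in> D" using * hole_D der_D by auto
    ultimately have "pebble ?X c t" using *(2) unfolding pebble_def[of ?X] by blast
    then show ?thesis by (simp add: numeral_3_eq_3)
  qed
  have "rounds (2 * j + 4) c a" if d: "hole c a m" "m \<le> 2 ^ Suc j" for c a m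
  proof (cases "m \<le> ?s")
    case True
    then show ?thesis using Suc that mono[of "2 * j + 2" c a "2 * j + 4"] by auto
  next
    case False
    then have sm: "?s < m" by simp
    obtain v p q m0 m1 m2 where *: "hole c v m0" "ru v p q \<or> ru v q p" "hole p a m1" "der q m2"
      "m1 \<le> ?s" "?s < m1 + m2" "m = m0 + (m1 + m2)"
      using split_hole[OF d(1) sm] by blast
    let ?X = "rounds (2 * j + 3)"
    have "m0 \<le> ?s" using * d by simp
    then have "?X c v" "?X p a"
      using Suc * mono[of "2 * j + 2" _ _ "2 * j + 3"] by auto
    moreover have "?X q t" using * d by (intro 1[of q m2]) auto
    moreover have "v \<in> D" "p \<in> D" "q \<in> D" using * hole_D der_D by auto
    ultimately have "pebble ?X c a" using *(2) unfolding pebble_def[of ?X] by blast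
    then show ?thesis by (simp add: numeral_eq_Suc)
  qed
  with 1 show ?case by (simp add: algebra_simps numeral_eq_Suc)
qed

text \<open>An entry for \<open>c\<close> and \<open>a\<close> means that validity passes from
  \<open>a\<close> to \<open>c\<close>, and \<open>pebble\<close> composes such
  implications.\<close>

lemma rounds_sound:
  assumes "rounds j c a" "val a" "val t" "\<And>c. B c \<Longrightarrow> val c"
    "\<And>c p q. ru c p q \<Longrightarrow> val p \<Longrightarrow> val q \<Longrightarrow> val c"
  shows "val c"
  using assms(1,2)
proof (induction j arbitrary: c a)
  case (Suc j)
  then have "pebble (rounds j) c a" by simp
  then consider "c = a" | "B c"
    | v p q where "rounds j c v" "ru v p q \<or> ru v q p" "rounds j q t" "rounds j p a"
    unfolding pebble_def by blast
  then show ?case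
  proof cases
    case 3
    then have "val p" "val q" using Suc assms(3) by blast+
    then have "val v" using 3 assms(5) by blast
    then show ?thesis using 3 Suc.IH by blast
  qed (use Suc assms in auto)
qed simp

end

section \<open>The pebble game on quadruples as a formula\<close>

type_synonym quad = "nat \<times> nat \<times> nat \<times> nat"

definition quads :: "bool list \<Rightarrow> quad set" where
  "quads w = {..<ubd w} \<times> {..<ubd w} \<times> {..<ubd w} \<times> {..<ubd w}"

text \<open>A sentinel inside the universe. It cannot be confused with endpoints of arcs, which are
  smaller than the torus size and hence than \<open>length w\<close>.\<close>

abbreviation trivial :: "bool list \<Rightarrow> quad" where
  "trivial w \<equiv> (length w, length w, length w, length w)"

definition pebble_op ::
    "(bool list \<Rightarrow> quad \<Rightarrow> bool) \<Rightarrow> (bool list \<Rightarrow> quad \<Rightarrow> quad \<Rightarrow> quad \<Rightarrow> bool) \<Rightarrow>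
      bool list \<Rightarrow> (nat list \<Rightarrow> bool) \<Rightarrow> nat list \<Rightarrow> bool" where
  "pebble_op B ru w X xs \<longleftrightarrow>
    xs ! 0 = xs ! 4 \<and> xs ! 1 = xs ! 5 \<and> xs ! 2 = xs ! 6 \<and> xs ! 3 = xs ! 7 \<or>
    (xs ! 4 = length w \<and> xs ! 5 = length w \<and> xs ! 6 = length w \<and> xs ! 7 = length w \<and>
      B w (xs ! 0, xs ! 1, xs ! 2, xs ! 3)) \<or>
    (\<exists>v<ubd w. \<exists>v'<ubd w. \<exists>v''<ubd w. \<exists>v'''<ubd w.
      X [xs ! 0, xs ! 1, xs ! 2, xs ! 3, v, v', v'', v'''] \<and>
      (\<exists>p<ubd w. \<exists>p'<ubd w. \<exists>p''<ubd w. \<exists>p'''<ubd w.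
     \<exists>q<ubd w. \<exists>q'<ubd w. \<exists>q''<ubd w. \<exists>q'''<ubd w. \<exists>t<ubd w. t = length w \<and>
      (ru w (v, v', v'', v''') (p, p', p'', p''') (q, q', q'', q''') \<or>
       ru w (v, v', v'', v''') (q, q', q'', q''') (p, p', p'', p''')) \<and>
      X [q, q', q'', q''', t, t, t, t] \<and> X [p, p', p'', p''', xs ! 4, xs ! 5, xs ! 6, xs ! 7]))"

lemma nth8:
  "[a, b, c, d, e, f, g, h] ! 0 = a" "[a, b, c, d, e, f, g, h] ! 1 = b"
  "[a, b, c, d, e, f, g, h] ! 2 = c" "[a, b, c, d, e, f, g, h] ! 3 = d"
  "[a, b, c, d, e, f, g, h] ! 4 = e" "[a, b, c, d, e, f, g, h] ! 5 = f"
  "[a, b, c, d, e, f, g, h] ! 6 = g" "[a, b, c, d, e, f, g, h] ! 7 = h"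
  by simp_all

definition derivable ::
    "(bool list \<Rightarrow> quad \<Rightarrow> bool) \<Rightarrow> (bool list \<Rightarrow> quad \<Rightarrow> quad \<Rightarrow> quad \<Rightarrow> bool) \<Rightarrow> bool list \<Rightarrow> quad \<Rightarrow> bool"
  where "derivable B ru w c \<longleftrightarrow>
    (derivation.pebble (quads w) (B w) (ru w) (trivial w) ^^ (3 * lg w)) (\<lambda>_ _. False) c (trivial w)"

lemma pebble_op_iter:
  assumes "c \<in> quads w" "a \<in> quads w"
  shows "(pebble_op B ru w ^^ j) (\<lambda>_. False)
      (case (c, a) of ((c1, c2, c3, c4), (a1, a2, a3, a4)) \<Rightarrow> [c1, c2, c3, c4, a1, a2, a3, a4]) \<longleftrightarrow>
    (derivation.pebble (quads w) (B w) (ru w) (trivial w) ^^ j) (\<lambda>_ _. False) c a"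
  using assms
proof (induction j arbitrary: c a)
  case (Suc j)
  define Y where "Y = (pebble_op B ru w ^^ j) (\<lambda>_. False)"
  define Z where "Z = (derivation.pebble (quads w) (B w) (ru w) (trivial w) ^^ j) (\<lambda>_ _. False)"
  obtain c1 c2 c3 c4 where c: "c = (c1, c2, c3, c4)" by (cases c)
  obtain a1 a2 a3 a4 where a: "a = (a1, a2, a3, a4)" by (cases a)
  have t: "length w < ubd w" using length_less_ubd[of w] by simp
  have YZ: "Y [c1, c2, c3, c4, a1, a2, a3, a4] \<longleftrightarrow> Z (c1, c2, c3, c4) (a1, a2, a3, a4)"
    if "c1 < ubd w" "c2 < ubd w" "c3 < ubd w" "c4 < ubd w" "a1 < ubd w" "a2 < ubd w" "a3 < ubd w" "a4 < ubd w"
    for c1 c2 c3 c4 a1 a2 a3 a4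
    using Suc.IH[of "(c1, c2, c3, c4)" "(a1, a2, a3, a4)"] that by (simp add: Y_def Z_def quads_def)
  have ca: "c1 < ubd w" "c2 < ubd w" "c3 < ubd w" "c4 < ubd w" "a1 < ubd w" "a2 < ubd w" "a3 < ubd w" "a4 < ubd w"
    using Suc.prems by (auto simp: c a quads_def)
  have "pebble_op B ru w Y [c1, c2, c3, c4, a1, a2, a3, a4] \<longleftrightarrow>
      derivation.pebble (quads w) (B w) (ru w) (trivial w) Z c a"
    unfolding pebble_op_def derivation.pebble_def nth8 c a quads_def
    using t ca by (simp add: Bex_def YZ cong: conj_cong)
  then show ?case by (simp add: Y_def Z_def c a)
qed simp

lemma fo_derivable:
  assumes "\<And>p a b c d. fo p (\<lambda>w X e. B w (e a, e b, e c, e d))"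
    and "\<And>p a b c d a' b' c' d' a'' b'' c'' d''.
      fo p (\<lambda>w X e. ru w (e a, e b, e c, e d) (e a', e b', e c', e d') (e a'', e b'', e c'', e d''))"
  shows "fo p (\<lambda>w X e. derivable B ru w (e a, e b, e c, e d))"
proof (rule fo_cong)
  have m: "map e [0..<8] = [e 0, e 1, e 2, e 3, e 4, e 5, e 6, e 7]" for e :: "nat \<Rightarrow> nat"
    by (simp add: upt_rec numeral_eq_Suc)
  have 8: "fo 8 (\<lambda>w X e. pebble_op B ru w X (map e [0..<8]))"
    unfolding pebble_op_def m by (simp only: nth8) (intro fo_intros assms)
  have fix8: "fo q (\<lambda>w X e. (pebble_op B ru w ^^ (3 * lg w)) (\<lambda>_. False) [e a, e b, e c, e d, e t, e t, e t, e t])"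
    for q a b c d t
    using fo_fix[OF 8, of "[a, b, c, d, t, t, t, t]" q 3] by simp
  show "fo p (\<lambda>w X e. \<exists>t<ubd w. t = length w \<and>
      (pebble_op B ru w ^^ (3 * lg w)) (\<lambda>_. False) [e a, e b, e c, e d, t, t, t, t])"
    by (intro fo_intros fix8)
next
  fix w :: "bool list" and X :: "nat list \<Rightarrow> bool" and e :: "nat \<Rightarrow> nat"
  assume "\<And>v. e v < ubd w"
  then show "(\<exists>t<ubd w. t = length w \<and>
      (pebble_op B ru w ^^ (3 * lg w)) (\<lambda>_. False) [e a, e b, e c, e d, t, t, t, t]) \<longleftrightarrow>
      derivable B ru w (e a, e b, e c, e d)"
    using length_less_ubd[of w] pebble_op_iter[where c = "(e a, e b, e c, e d)" and a = "trivial w" and j = "3 * lg w"]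
    by (simp add: derivable_def quads_def)
qed

text \<open>\<open>2 ^ lg w\<close> leaves take \<open>2 * lg w + 1\<close> rounds, which
  \<open>3 * lg w\<close> covers as \<open>lg w\<close> is positive.\<close>

lemma derivable_complete:
  assumes "derivation.der (quads w) (B w) (ru w) c m" "m \<le> ubd w"
  shows "derivable B ru w c"
proof -
  have "0 < lg w" using one_less_ubd[of w] by (cases "lg w") auto
  then have "2 * lg w + 1 \<le> 3 * lg w" by simp
  note mono = derivation.rounds_mono[OF this]
  have "(derivation.pebble (quads w) (B w) (ru w) (trivial w) ^^ (2 * lg w + 1)) (\<lambda>_ _. False) c (trivial w)"
    using derivation.rounds_complete[where j = "lg w", THEN conjunct1, THEN mp, OF assms(1), THEN mp, OF assms(2)] .
  then show ?thesis
    unfolding derivable_def by (rule le_boolD[OF le_funD[OF le_funD[OF mono]], THEN mp])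
qed

lemma derivable_sound:
  assumes "derivable B ru w c" "val (trivial w)" "\<And>c. B w c \<Longrightarrow> val c"
    "\<And>c p q. ru w c p q \<Longrightarrow> val p \<Longrightarrow> val q \<Longrightarrow> val c"
  shows "val c"
  by (rule derivation.rounds_sound[where val = val, OF assms(1)[unfolded derivable_def]]) (fact assms)+

section \<open>Instability and threshold closure\<close>

definition closed_under :: "'c set \<Rightarrow> ('c \<Rightarrow> 'c set) \<Rightarrow> nat \<Rightarrow> 'c set \<Rightarrow> bool" where
  "closed_under V nb k C \<longleftrightarrow> (\<forall>v\<in>V. k \<le> card (nb v \<inter> C) \<longrightarrow> v \<in> C)"

text \<open>With at most \<open>k2 + 1\<close> neighbors, a cell with more than \<open>k2\<close>
  active neighbors has no inactive one. This is a bound and not an equality, so that tori with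
  coinciding neighbors are included.\<close>

locale torus =
  fixes A :: "'c life_like" and n k1 k2 :: nat
  assumes birth: "birth A = {k1..k2}" "k1 \<le> k2"
    and nbrs_G: "u \<in> G A n \<Longrightarrow> nbrs A n u \<subseteq> G A n"
    and nbrs_sym: "u \<in> G A n \<Longrightarrow> v \<in> nbrs A n u \<Longrightarrow> u \<in> nbrs A n v"
    and card_nbrs: "u \<in> G A n \<Longrightarrow> card (nbrs A n u) \<le> Suc k2"
begin

abbreviation "V \<equiv> G A n"
abbreviation "nb \<equiv> nbrs A n"

lemma finite_nb: "u \<in> V \<Longrightarrow> finite (nb u)"
  using nbrs_G finite_subset by blast

definition active :: "('c \<Rightarrow> bool) \<Rightarrow> 'c set" where
  "active x = {v \<in> V. x v}"

lemma local_rule_iff: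
  "u \<in> V \<Longrightarrow> local_rule A n x u \<longleftrightarrow> x u \<or> card (nb u \<inter> active x) \<in> {k1..k2}"
proof -
  assume u: "u \<in> V"
  then have "nb u \<inter> active x = nb u \<inter> {v. x v}" using nbrs_G by (auto simp: active_def)
  moreover have "(\<Sum>w\<in>nb u. of_bool (x w)) = card (nb u \<inter> {v. x v})"
    using finite_nb[OF u] by simp
  ultimately show ?thesis by (simp add: local_rule_def birth)
qed

text \<open>The cells that really change, in their order; idle updates and the division into blocks
  are forgotten.\<close>

inductive activation :: "('c \<Rightarrow> bool) \<Rightarrow> 'c list \<Rightarrow> bool" for x where
  activation_Nil: "activation x []"
| activation_snoc: "activation x vs \<Longrightarrow> v \<in> V \<Longrightarrow> v \<notin> active x \<union> set vs \<Longrightarrow>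
    card (nb v \<inter> (active x \<union> set vs)) \<in> {k1..k2} \<Longrightarrow> activation x (vs @ [v])"

lemma activation_props: "activation x vs \<Longrightarrow> distinct vs \<and> set vs \<subseteq> V \<and> set vs \<inter> active x = {}"
  by (induction rule: activation.induct) auto

lemma activation_take: "activation x vs \<Longrightarrow> activation x (take i vs)"
proof (induction rule: activation.induct)
  case (activation_snoc vs v)
  then show ?case by (cases "i \<le> length vs") (auto intro: activation.intros)
qed (simp add: activation_Nil)

lemma activation_nth:
  "activation x vs \<Longrightarrow> i < length vs \<Longrightarrow>
    card (nb (vs ! i) \<inter> (active x \<union> set (take i vs))) \<in> {k1..k2}"
proof (induction rule: activation.induct)
  case (activation_snoc vs v)
  then show ?case by (cases "i < length vs") (auto simp: nth_append less_Suc_eq)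
qed simp

lemma async_run_active:
  assumes "update_scheme A n \<sigma>"
  shows "\<exists>vs. activation x vs \<and> active (async_run A n \<sigma> x t) = active x \<union> set vs"
proof (induction t)
  case 0
  then show ?case by (intro exI[of _ "[]"]) (auto intro: activation_Nil)
next
  case (Suc t)
  then obtain vs where vs: "activation x vs" "active (async_run A n \<sigma> x t) = active x \<union> set vs" by blast
  let ?y = "async_run A n \<sigma> x t" and ?v = "\<sigma> (Suc t)"
  have v: "?v \<in> V" using assms by (auto simp: update_scheme_def)
  have upd: "active (async_run A n \<sigma> x (Suc t)) =
      (if local_rule A n ?y ?v then insert ?v (active ?y) else active ?y)"
    using v by (auto simp: active_def Let_def local_rule_def)
  show ?case
  proof (cases "local_rule A n ?y ?v \<and> ?v \<notin> active ?y")
    case True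
    then have "activation x (vs @ [?v])"
      using vs v local_rule_iff[OF v, of ?y] by (intro activation_snoc) (auto simp: active_def)
    moreover have "active (async_run A n \<sigma> x (Suc t)) = active x \<union> set (vs @ [?v])"
      unfolding upd using True vs(2) by auto
    ultimately show ?thesis by blast
  next
    case False
    then have "active (async_run A n \<sigma> x (Suc t)) = active x \<union> set vs"
      unfolding upd using vs(2) by auto
    then show ?thesis using vs(1) by blast
  qed
qed

text \<open>A cell is activated at most once, so the activations fit into a first block that starts
  with \<open>vs\<close>; this block is then repeated. \<open>vs \<noteq> []\<close> makes the grid
  nonempty, which the remainder modulo its size requires.\<close>

lemma activation_run:
  assumes "activation x vs" "vs \<noteq> []"
  shows "\<exists>\<sigma>. update_scheme A n \<sigma> \<and>
    (\<forall>i\<le>length vs. active (async_run A n \<sigma> x i) = active x \<union> set (take i vs))"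
proof -
  obtain r where r: "distinct r" "set r = V - set vs"
    using finite_distinct_list[of "V - set vs"] by auto
  define ps where "ps = vs @ r"
  have ps: "distinct ps" "set ps = V" using r activation_props[OF assms(1)] by (auto simp: ps_def)
  then have len: "length ps = card V" by (metis distinct_card)
  define N where "N = card V"
  have N: "0 < N" using assms(2) len by (simp add: N_def flip: len) (simp add: ps_def)
  define \<sigma> where "\<sigma> t = ps ! ((t - 1) mod N)" for t
  have "bij_betw \<sigma> {b * N + 1..(b + 1) * N} V" for b
  proof -
    have 1: "bij_betw (\<lambda>t. t - (b * N + 1)) {b * N + 1..(b + 1) * N} {..<N}"
      by (rule bij_betw_byWitness[where f' = "\<lambda>t. t + (b * N + 1)"]) (use N in auto)
    have 2: "bij_betw ((!) ps) {..<N} V" using ps len by (intro bij_betw_nth) (auto simp: N_def)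
    have "\<sigma> t = ps ! (t - (b * N + 1))" if "t \<in> {b * N + 1..(b + 1) * N}" for t
    proof -
      have "t - 1 = b * N + (t - (b * N + 1))" "t - (b * N + 1) < N"
        using that N by (auto simp: algebra_simps)
      then have "(t - 1) mod N = t - (b * N + 1)" by (metis mod_less mod_mult_self3)
      then show ?thesis by (simp add: \<sigma>_def)
    qed
    then show ?thesis
      using bij_betw_trans[OF 1 2] by (subst bij_betw_cong[where g = "(!) ps \<circ> (\<lambda>t. t - (b * N + 1))"]) auto
  qed
  moreover have "range \<sigma> \<subseteq> V" using N ps len by (auto simp: \<sigma>_def N_def intro!: nth_mem)
  ultimately have scheme: "update_scheme A n \<sigma>" by (simp add: update_scheme_def N_def)
  have "active (async_run A n \<sigma> x i) = active x \<union> set (take i vs)" if "i \<le> length vs" for i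
    using that
  proof (induction i)
    case (Suc i)
    have "length vs \<le> N" using len by (simp add: ps_def N_def)
    then have \<sigma>: "\<sigma> (Suc i) = vs ! i" using Suc by (simp add: \<sigma>_def ps_def nth_append)
    let ?y = "async_run A n \<sigma> x i"
    have IH: "active ?y = active x \<union> set (take i vs)" using Suc by simp
    have v: "vs ! i \<in> V" using activation_props[OF assms(1)] Suc.prems by (auto intro!: subsetD[OF _ nth_mem])
    have "local_rule A n ?y (vs ! i)"
      unfolding local_rule_iff[OF v] IH using activation_nth[OF assms(1), of i] Suc.prems by auto
    then have "active (async_run A n \<sigma> x (Suc i)) = insert (vs ! i) (active ?y)"
      using v by (auto simp: active_def Let_def \<sigma>)
    then show ?case using IH Suc.prems by (simp add: take_Suc_conv_app_nth)
  qed simp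
  then show ?thesis using scheme by blast
qed

lemma unstable_iff_activation:
  assumes "u \<in> V"
  shows "async_unstable A n x u \<longleftrightarrow> (\<exists>vs. activation x vs \<and> u \<in> set vs)"
proof
  assume "async_unstable A n x u"
  then obtain \<sigma> t where \<sigma>: "update_scheme A n \<sigma>" "async_run A n \<sigma> x t u \<noteq> x u"
    by (auto simp: async_unstable_def)
  then show "\<exists>vs. activation x vs \<and> u \<in> set vs"
    using async_run_active[OF \<sigma>(1), of x t] assms by (fastforce simp: active_def)
next
  assume "\<exists>vs. activation x vs \<and> u \<in> set vs"
  then obtain vs where vs: "activation x vs" "u \<in> set vs" by blast
  then obtain \<sigma> where \<sigma>: "update_scheme A n \<sigma>"
    "active (async_run A n \<sigma> x (length vs)) = active x \<union> set vs"
    using activation_run[of x vs] by (metis empty_iff list.set(1) order_refl take_all)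
  moreover have "u \<notin> active x" using vs activation_props by blast
  moreover have "0 < length vs" using vs by auto
  ultimately show "async_unstable A n x u"
    unfolding async_unstable_def using vs assms
    by (intro exI[of _ \<sigma>] conjI exI[of _ "length vs"]) (auto simp: active_def)
qed

text \<open>
  The upper bound \<open>k2\<close> of the rule only excludes cells all of whose neighbors are active, and
  those are of no use to any other cell.  As the number of active neighbors grows in steps of one,
  it only matters for \<open>u\<close> in the initial configuration.
\<close>

theorem unstable_iff_closure:
  assumes u: "u \<in> V"
  shows "async_unstable A n x u \<longleftrightarrow> \<not> x u \<and> card (nb u \<inter> active x) \<le> k2 \<and>
    (\<forall>C. active x \<subseteq> C \<longrightarrow> closed_under V nb k1 C \<longrightarrow> u \<in> C)"
  unfolding unstable_iff_activation[OF u]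
proof safe
  fix vs assume vs: "activation x vs" "u \<in> set vs"
  then show "x u \<Longrightarrow> False" using activation_props u by (fastforce simp: active_def)
  have card_mono': "card (nb v \<inter> Y) \<le> card (nb v \<inter> Z)" if "v \<in> V" "Y \<subseteq> Z" for v Y Z
    using that finite_nb by (intro card_mono) auto
  obtain i where i: "i < length vs" "u = vs ! i" using vs by (metis in_set_conv_nth)
  have "card (nb u \<inter> active x) \<le> card (nb u \<inter> (active x \<union> set (take i vs)))"
    using u by (intro card_mono') auto
  then show "card (nb u \<inter> active x) \<le> k2" using activation_nth[OF vs(1) i(1)] i by auto
  fix C assume C: "active x \<subseteq> C" "closed_under V nb k1 C"
  have "set vs \<subseteq> C"
    using vs(1)
  proof (induction rule: activation.induct)
    case (activation_snoc vs v)
    then have "k1 \<le> card (nb v \<inter> C)"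
      using C card_mono'[of v "active x \<union> set vs" C] by auto
    then show ?case using activation_snoc C by (auto simp: closed_under_def)
  qed simp
  then show "u \<in> C" using vs by blast
next
  assume x: "\<not> x u" and k2: "card (nb u \<inter> active x) \<le> k2"
    and cl: "\<forall>C. active x \<subseteq> C \<longrightarrow> closed_under V nb k1 C \<longrightarrow> u \<in> C"
  show "\<exists>vs. activation x vs \<and> u \<in> set vs"
  proof (rule ccontr)
    assume no: "\<not> ?thesis"
    have "length vs \<le> card V" if "activation x vs" for vs
      using activation_props[OF that] by (metis List.finite_set card_mono distinct_card)
    \<comment> \<open>Activation sequences have distinct cells, so a longest one exists.\<close>
    then have "\<exists>vs. activation x vs \<and> (\<forall>ws. activation x ws \<longrightarrow> length ws \<le> length vs)"
      by (intro ex_has_greatest_nat[of _ "[]" _ "Suc (card V)"]) (auto simp: activation_Nil less_Suc_eq_le)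
    then obtain vs where vs: "activation x vs" "\<And>ws. activation x ws \<Longrightarrow> length ws \<le> length vs"
      by blast
    define Y where "Y = active x \<union> set vs"
    have uY: "u \<notin> Y" using no vs x by (auto simp: Y_def active_def)
    have full: "nb v \<subseteq> Y" if "v \<in> V" "k2 < card (nb v \<inter> Y)" for v
    proof -
      have "card (nb v) \<le> card (nb v \<inter> Y)" using card_nbrs that by force
      then have "nb v \<inter> Y = nb v" using finite_nb that by (intro card_seteq) auto
      then show ?thesis by blast
    qed
    \<comment> \<open>By maximality, a cell outside this set has fewer than \<open>k1\<close>
      neighbors in \<open>Y\<close>. The added cells do not raise this count: their neighbors all
      lie in \<open>Y\<close>, so a cell outside \<open>Y\<close> is not among them.\<close>
    have "closed_under V nb k1 (Y \<union> {v \<in> V. k2 < card (nb v \<inter> Y)})" (is "closed_under V nb k1 ?C")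
      unfolding closed_under_def
    proof (intro ballI impI, rule ccontr)
      fix v assume v: "v \<in> V" "k1 \<le> card (nb v \<inter> ?C)" "v \<notin> ?C"
      have "\<not> k1 \<le> card (nb v \<inter> Y)"
        using vs(2)[of "vs @ [v]"] v activation_snoc[OF vs(1) v(1)] by (auto simp: Y_def)
      then have "nb v \<inter> ?C \<noteq> nb v \<inter> Y" using v(2) by metis
      then obtain w where w: "w \<in> nb v" "w \<in> V" "k2 < card (nb w \<inter> Y)" by auto
      have "v \<in> nb w" using nbrs_sym[OF v(1) w(1)] .
      then show False using full[OF w(2,3)] v(3) by auto
    qed
    moreover have "active x \<subseteq> ?C" by (auto simp: Y_def)
    ultimately have "u \<in> ?C" using cl by blast
    then have big: "k2 < card (nb u \<inter> Y)" using uY by simp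
    \<comment> \<open>\<open>u\<close> can only be missing from \<open>Y\<close> because it has too
      many active neighbors. Their number starts at no more than \<open>k2\<close> and grows by at
      most one, so at some moment it is exactly \<open>k2\<close>, and \<open>u\<close> can be
      activated then.\<close>
    define cnt where "cnt i = card (nb u \<inter> (active x \<union> set (take i vs)))" for i
    have "cnt 0 \<le> k2" using k2 by (simp add: cnt_def)
    moreover have "k2 < cnt (length vs)" using big by (simp add: cnt_def Y_def)
    ultimately obtain i where i: "i < length vs" "cnt i \<le> k2" "k2 < cnt (Suc i)"
      using ex_least_nat_less[of "\<lambda>i. k2 < cnt i" "length vs"] by (metis not_less le_refl)
    have "nb u \<inter> (active x \<union> set (take (Suc i) vs)) \<subseteq> insert (vs ! i) (nb u \<inter> (active x \<union> set (take i vs)))"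
      using i by (auto simp: take_Suc_conv_app_nth)
    then have "cnt (Suc i) \<le> card (insert (vs ! i) (nb u \<inter> (active x \<union> set (take i vs))))"
      unfolding cnt_def using finite_nb[OF u] by (intro card_mono) auto
    also have "\<dots> \<le> Suc (cnt i)" unfolding cnt_def using finite_nb[OF u] by (intro card_insert_le_m1) auto
    finally have "cnt i = k2" using i by simp
    then have "activation x (take i vs @ [u])"
      using u uY birth(2) vs(1) set_take_subset[of i vs]
      by (intro activation_snoc activation_take) (auto simp: cnt_def Y_def)
    then show False using no by auto
  qed
qed

end

section \<open>Subgraphs of minimum degree two\<close>

definition core :: "'a set \<Rightarrow> ('a \<Rightarrow> 'a \<Rightarrow> bool) \<Rightarrow> 'a set \<Rightarrow> bool" where
  "core H N Z \<longleftrightarrow> Z \<subseteq> H \<and> (\<forall>v\<in>Z. \<exists>a\<in>Z. \<exists>b\<in>Z. a \<noteq> b \<and> N v a \<and> N v b)"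

text \<open>A step of the non-backtracking walk, whose states are the directed edges of the graph
  induced on \<open>H\<close>.\<close>

definition turn :: "'a set \<Rightarrow> ('a \<Rightarrow> 'a \<Rightarrow> bool) \<Rightarrow> 'a \<Rightarrow> 'a \<Rightarrow> 'a \<Rightarrow> 'a \<Rightarrow> bool" where
  "turn H N a b c d \<longleftrightarrow> b = c \<and> a \<in> H \<and> b \<in> H \<and> d \<in> H \<and> N a b \<and> N b d \<and> d \<noteq> a"

definition turns :: "'a set \<Rightarrow> ('a \<Rightarrow> 'a \<Rightarrow> bool) \<Rightarrow> (('a \<times> 'a) \<times> 'a \<times> 'a) set" where
  "turns H N = {((a, b), (c, d)) | a b c d. turn H N a b c d}"

text \<open>In a finite relation, an infinite walk from \<open>e\<close> exists iff \<open>e\<close> reaches a cycle.\<close>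

definition endless :: "'b rel \<Rightarrow> 'b \<Rightarrow> bool" where
  "endless R e \<longleftrightarrow> (\<exists>f g. (e, f) \<in> R\<^sup>* \<and> (f, g) \<in> R \<and> (g, f) \<in> R\<^sup>*)"

lemma endless_iff_step: "endless R e \<longleftrightarrow> (\<exists>e'. (e, e') \<in> R \<and> endless R e')"
proof
  assume "endless R e"
  then obtain f g where fg: "(e, f) \<in> R\<^sup>*" "(f, g) \<in> R" "(g, f) \<in> R\<^sup>*" by (auto simp: endless_def)
  show "\<exists>e'. (e, e') \<in> R \<and> endless R e'"
  proof (cases "e = f")
    case True
    then show ?thesis using fg by (auto simp: endless_def)
  next
    case False
    then obtain e' where "(e, e') \<in> R" "(e', f) \<in> R\<^sup>*" using fg(1) by (meson converse_rtranclE)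
    then show ?thesis using fg by (auto simp: endless_def)
  qed
qed (meson converse_rtrancl_into_rtrancl endless_def)

text \<open>Pigeonhole: iterating a choice of successors inside a finite set must repeat a
  state.\<close>

lemma endlessI:
  assumes "finite E" "e \<in> E" "\<And>e. e \<in> E \<Longrightarrow> \<exists>e'\<in>E. (e, e') \<in> R"
  shows "endless R e"
proof -
  obtain s where s: "s e \<in> E \<and> (e, s e) \<in> R" if "e \<in> E" for e using assms(3) by metis
  have E: "(s ^^ i) e \<in> E" for i by (induction i) (use s assms in auto)
  have path: "((s ^^ i) e, (s ^^ (i + k)) e) \<in> R\<^sup>*" for i k
  proof (induction k)
    case (Suc k)
    have "((s ^^ (i + k)) e, (s ^^ (i + Suc k)) e) \<in> R" using s[OF E[of "i + k"]] by simp
    with Suc show ?case by (rule rtrancl_into_rtrancl)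
  qed simp
  have "finite (range (\<lambda>i. (s ^^ i) e))" using E assms(1) by (auto intro: finite_subset)
  then have "\<not> inj (\<lambda>i. (s ^^ i) e)" using finite_imageD infinite_UNIV_nat by blast
  then obtain i j where ij: "i < j" "(s ^^ i) e = (s ^^ j) e"
    unfolding inj_def by (metis linorder_neqE_nat)
  have "(e, (s ^^ i) e) \<in> R\<^sup>*" using path[of 0 i] by simp
  moreover have "((s ^^ i) e, (s ^^ Suc i) e) \<in> R" using s[OF E[of i]] by simp
  moreover have "((s ^^ Suc i) e, (s ^^ i) e) \<in> R\<^sup>*" using path[of "Suc i" "j - Suc i"] ij by simp
  ultimately show ?thesis by (auto simp: endless_def)
qed

text \<open>Inside a core a walk never gets stuck, as every vertex offers an exit other than the
  entrance. Two endless directions at \<open>u\<close> are required: with one alone,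
  \<open>u\<close> could be the tip of a path that leads to a cycle.\<close>

lemma core_iff_endless:
  assumes "finite H" and sym: "\<And>a b. a \<in> H \<Longrightarrow> b \<in> H \<Longrightarrow> N a b \<Longrightarrow> N b a"
  shows "(\<exists>Z. core H N Z \<and> u \<in> Z) \<longleftrightarrow>
    (\<exists>a b. a \<noteq> b \<and> endless (turns H N) (u, a) \<and> endless (turns H N) (u, b))"
proof
  assume "\<exists>Z. core H N Z \<and> u \<in> Z"
  then obtain Z where Z: "core H N Z" "u \<in> Z" by blast
  define E where "E = {(a, b). a \<in> Z \<and> b \<in> Z \<and> N a b}"
  have "Z \<subseteq> H" using Z by (simp add: core_def)
  then have "E \<subseteq> H \<times> H" by (auto simp: E_def)
  then have fin: "finite E" using assms(1) finite_subset by blast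
  have step: "\<exists>e'\<in>E. (e, e') \<in> turns H N" if e: "e \<in> E" for e
  proof -
    obtain a b where ab: "e = (a, b)" "a \<in> Z" "b \<in> Z" "N a b" using e by (auto simp: E_def)
    then obtain c d where "c \<in> Z" "d \<in> Z" "c \<noteq> d" "N b c" "N b d" using Z unfolding core_def by blast
    then obtain r where r: "r \<in> Z" "N b r" "r \<noteq> a" by metis
    then have "((a, b), (b, r)) \<in> turns H N" "(b, r) \<in> E"
      using ab \<open>Z \<subseteq> H\<close> by (auto simp: turns_def turn_def E_def)
    then show ?thesis using ab by blast
  qed
  have "endless (turns H N) e" if "e \<in> E" for e by (rule endlessI[OF fin that step])
  moreover obtain a b where "a \<in> Z" "b \<in> Z" "a \<noteq> b" "N u a" "N u b" using Z unfolding core_def by blast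
  ultimately show "\<exists>a b. a \<noteq> b \<and> endless (turns H N) (u, a) \<and> endless (turns H N) (u, b)"
    using Z by (auto simp: E_def)
next
  let ?R = "turns H N"
  assume u: "\<exists>a b. a \<noteq> b \<and> endless ?R (u, a) \<and> endless ?R (u, b)"
  define Z where "Z = {v. \<exists>a b. a \<noteq> b \<and> endless ?R (v, a) \<and> endless ?R (v, b)}"
  have arc: "v \<in> H \<and> a \<in> H \<and> N v a" if "endless ?R (v, a)" for v a
    using that by (subst (asm) endless_iff_step) (auto simp: turns_def turn_def)
  \<comment> \<open>From \<open>a\<close> one endless walk continues the given one without returning
    to \<open>v\<close>; the other turns back to \<open>v\<close> and leaves along
    \<open>b\<close>.\<close>
  have next_in: "a \<in> Z" if ab: "a \<noteq> b" "endless ?R (v, a)" "endless ?R (v, b)" for v a b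
  proof -
    obtain r where r: "r \<noteq> v" "endless ?R (a, r)"
      using ab(2) by (subst (asm) endless_iff_step) (auto simp: turns_def turn_def)
    have "N a v" using arc[OF ab(2)] sym by blast
    then have "((a, v), (v, b)) \<in> ?R"
      using arc[OF ab(2)] arc[OF ab(3)] ab(1) by (auto simp: turns_def turn_def)
    then have "endless ?R (a, v)" using ab(3) endless_iff_step by metis
    then show ?thesis using r by (auto simp: Z_def)
  qed
  have "core H N Z"
    unfolding core_def
  proof (intro conjI ballI subsetI)
    show "v \<in> H" if "v \<in> Z" for v using that arc by (auto simp: Z_def)
  next
    fix v assume "v \<in> Z"
    then obtain a b where ab: "a \<noteq> b" "endless ?R (v, a)" "endless ?R (v, b)" by (auto simp: Z_def)
    then have "a \<in> Z" "b \<in> Z" using next_in[of a b v] next_in[of b a v] by auto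
    then show "\<exists>a\<in>Z. \<exists>b\<in>Z. a \<noteq> b \<and> N v a \<and> N v b" using ab arc by blast
  qed
  then show "\<exists>Z. core H N Z \<and> u \<in> Z" using u by (auto simp: Z_def)
qed

text \<open>With degree \<open>k1 + 1\<close>, having fewer than \<open>k1\<close> neighbors in a
  set means having at least two outside it. So complements of closed sets are cores, and
  conversely.\<close>

lemma (in torus) closure_iff_core:
  assumes deg: "\<And>v. v \<in> V \<Longrightarrow> card (nb v) = Suc k1" and "u \<in> V"
  shows "(\<forall>C. active x \<subseteq> C \<longrightarrow> closed_under V nb k1 C \<longrightarrow> u \<in> C) \<longleftrightarrow>
    \<not> (\<exists>Z. core (V - active x) (\<lambda>v a. a \<in> nb v) Z \<and> u \<in> Z)"
proof -
  have split: "card (nb v \<inter> C) + card (nb v - C) = Suc k1" if "v \<in> V" for v C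
    using card_Int_Diff[OF finite_nb[OF that]] deg[OF that] by metis
  show ?thesis
  proof safe
    fix Z assume cl: "\<forall>C. active x \<subseteq> C \<longrightarrow> closed_under V nb k1 C \<longrightarrow> u \<in> C"
      and Z: "core (V - active x) (\<lambda>v a. a \<in> nb v) Z" "u \<in> Z"
    have "v \<notin> Z" if v: "v \<in> V" "k1 \<le> card (nb v \<inter> - Z)" for v
    proof
      assume "v \<in> Z"
      then obtain a b where ab: "a \<in> Z" "b \<in> Z" "a \<noteq> b" "a \<in> nb v" "b \<in> nb v"
        using Z unfolding core_def by blast
      then have "card {a, b} \<le> card (nb v - - Z)" using finite_nb[OF v(1)] by (intro card_mono) auto
      then show False using split[OF v(1), of "- Z"] v ab by auto
    qed
    then have "closed_under V nb k1 (- Z)" by (auto simp: closed_under_def)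
    moreover have "active x \<subseteq> - Z" using Z by (auto simp: core_def)
    ultimately show False using cl Z by blast
  next
    fix C assume no: "\<nexists>Z. core (V - active x) (\<lambda>v a. a \<in> nb v) Z \<and> u \<in> Z"
      and C: "active x \<subseteq> C" "closed_under V nb k1 C"
    show "u \<in> C"
    proof (rule ccontr)
      assume "u \<notin> C"
      have "core (V - active x) (\<lambda>v a. a \<in> nb v) (V - C)"
        unfolding core_def
      proof (intro conjI ballI)
        show "V - C \<subseteq> V - active x" using C by auto
        fix v assume v: "v \<in> V - C"
        then have "\<not> k1 \<le> card (nb v \<inter> C)" using C by (auto simp: closed_under_def)
        then have "2 \<le> card (nb v - C)" using split[of v C] v by auto
        then obtain a b where "a \<in> nb v - C" "b \<in> nb v - C" "a \<noteq> b"
          using card_le_Suc0_iff_eq[of "nb v - C"] finite_nb[of v] v by auto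
        then show "\<exists>a\<in>V - C. \<exists>b\<in>V - C. a \<noteq> b \<and> a \<in> nb v \<and> b \<in> nb v"
          using nbrs_G v by blast
      qed
      then show False using no \<open>u \<notin> C\<close> assms(2) by blast
    qed
  qed
qed

text \<open>A word refers to cells by their positions in the cell list. Distinctness of the list
  keeps two chosen neighbors different in both directions of the translation.\<close>

lemma core_index:
  assumes "distinct cs" "c < length cs"
  shows "(\<exists>Z. core (set cs \<inter> - X) (\<lambda>v a. a \<in> nb v) Z \<and> cs ! c \<in> Z) \<longleftrightarrow>
    (\<exists>Z. core {d. d < length cs \<and> cs ! d \<notin> X} (\<lambda>d d'. cs ! d' \<in> nb (cs ! d)) Z \<and> c \<in> Z)"
proof safe
  fix Z assume Z: "core (set cs \<inter> - X) (\<lambda>v a. a \<in> nb v) Z" "cs ! c \<in> Z"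
  have "core {d. d < length cs \<and> cs ! d \<notin> X} (\<lambda>d d'. cs ! d' \<in> nb (cs ! d)) {d. d < length cs \<and> cs ! d \<in> Z}"
    unfolding core_def
  proof (intro conjI ballI)
    fix d assume "d \<in> {d. d < length cs \<and> cs ! d \<in> Z}"
    then obtain a b where ab: "a \<in> Z" "b \<in> Z" "a \<noteq> b" "a \<in> nb (cs ! d)" "b \<in> nb (cs ! d)"
      using Z unfolding core_def by blast
    have "a \<in> set cs" "b \<in> set cs" using ab Z by (auto simp: core_def)
    then obtain i j where "a = cs ! i" "i < length cs" "b = cs ! j" "j < length cs"
      unfolding in_set_conv_nth by blast
    with ab show "\<exists>a\<in>{d. d < length cs \<and> cs ! d \<in> Z}. \<exists>b\<in>{d. d < length cs \<and> cs ! d \<in> Z}.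
        a \<noteq> b \<and> cs ! a \<in> nb (cs ! d) \<and> cs ! b \<in> nb (cs ! d)"
      by (intro bexI[of _ i] bexI[of _ j]) auto
  qed (use Z in \<open>auto simp: core_def\<close>)
  then show "\<exists>Z. core {d. d < length cs \<and> cs ! d \<notin> X} (\<lambda>d d'. cs ! d' \<in> nb (cs ! d)) Z \<and> c \<in> Z"
    using Z assms(2) by blast
next
  fix Z assume Z: "core {d. d < length cs \<and> cs ! d \<notin> X} (\<lambda>d d'. cs ! d' \<in> nb (cs ! d)) Z" "c \<in> Z"
  have "core (set cs \<inter> - X) (\<lambda>v a. a \<in> nb v) ((!) cs ` Z)"
    unfolding core_def
  proof (intro conjI ballI)
    fix v assume "v \<in> (!) cs ` Z"
    then obtain d where d: "v = cs ! d" "d \<in> Z" by blast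
    then obtain a b where ab: "a \<in> Z" "b \<in> Z" "a \<noteq> b" "cs ! a \<in> nb v" "cs ! b \<in> nb v"
      using Z unfolding core_def by blast
    moreover have "a < length cs" "b < length cs" using ab Z by (auto simp: core_def)
    then have "cs ! a \<noteq> cs ! b" using assms(1) ab by (simp add: nth_eq_iff_index_eq)
    ultimately show "\<exists>a\<in>(!) cs ` Z. \<exists>b\<in>(!) cs ` Z. a \<noteq> b \<and> a \<in> nb v \<and> b \<in> nb v" by blast
  qed (use Z in \<open>auto simp: core_def\<close>)
  then show "\<exists>Z. core (set cs \<inter> - X) (\<lambda>v a. a \<in> nb v) Z \<and> cs ! c \<in> Z" using Z by blast
qed

section \<open>Rules activated by two neighbors on the square grid\<close>

definition nxt :: "nat \<Rightarrow> nat \<Rightarrow> nat \<Rightarrow> bool" where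
  "nxt n p q \<longleftrightarrow> p < n \<and> q < n \<and> (Suc p = q \<or> Suc p = n \<and> q = 0)"

definition adj :: "nat \<Rightarrow> nat \<Rightarrow> nat \<Rightarrow> bool" where
  "adj n p q \<longleftrightarrow> nxt n p q \<or> nxt n q p"

definition conn :: "nat \<Rightarrow> nat set \<Rightarrow> bool" where
  "conn n X \<longleftrightarrow> (\<forall>Y\<subseteq>X. Y \<noteq> {} \<longrightarrow> (\<forall>p\<in>Y. \<forall>q\<in>X. adj n p q \<longrightarrow> q \<in> Y) \<longrightarrow> Y = X)"

text \<open>From \<open>s\<close> upwards to \<open>e\<close>, wrapping around if
  \<open>e < s\<close>. The full cycle has several descriptions, so \<open>merge\<close> below
  compares arcs as sets. As in \<open>nxt\<close>, \<open>mod\<close> is avoided to ease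
  definability.\<close>

definition arc :: "nat \<Rightarrow> nat \<Rightarrow> nat \<Rightarrow> nat set" where
  "arc n s e = {p. p < n \<and> (if s \<le> e then s \<le> p \<and> p \<le> e else s \<le> p \<or> p \<le> e)}"

definition fill :: "nat \<Rightarrow> nat set \<Rightarrow> nat set" where
  "fill n X = X \<union> {p. \<exists>a\<in>X. \<exists>b\<in>X. a \<noteq> b \<and> adj n p a \<and> adj n p b}"

lemma adj_sym: "adj n p q \<longleftrightarrow> adj n q p"
  by (auto simp: adj_def)

lemma adj_less: "adj n p q \<Longrightarrow> p < n \<and> q < n"
  by (auto simp: adj_def nxt_def)

lemma adj_neq: "2 \<le> n \<Longrightarrow> adj n p q \<Longrightarrow> p \<noteq> q"
  by (auto simp: adj_def nxt_def)

lemma adj_two: "adj n p a \<Longrightarrow> adj n p b \<Longrightarrow> adj n p c \<Longrightarrow> a \<noteq> b \<Longrightarrow> c = a \<or> c = b"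
  by (auto simp: adj_def nxt_def)

lemma nxt_inj: "nxt n p q \<Longrightarrow> nxt n p' q \<Longrightarrow> p = p'"
  by (auto simp: nxt_def)

lemma connI:
  assumes "\<And>Y y. Y \<subseteq> X \<Longrightarrow> y \<in> Y \<Longrightarrow> (\<And>p q. p \<in> Y \<Longrightarrow> q \<in> X \<Longrightarrow> adj n p q \<Longrightarrow> q \<in> Y) \<Longrightarrow> X \<subseteq> Y"
  shows "conn n X"
  unfolding conn_def using assms by (metis ex_in_conv subset_antisym)

lemma connD:
  assumes "conn n X" "y \<in> X" "P y" "\<And>p q. p \<in> X \<Longrightarrow> P p \<Longrightarrow> q \<in> X \<Longrightarrow> adj n p q \<Longrightarrow> P q" "x \<in> X"
  shows "P x"
proof -
  have "{p \<in> X. P p} = X"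
    using assms(1)[unfolded conn_def, rule_format, of "{p \<in> X. P p}"] assms(2-4) by blast
  then show ?thesis using assms(5) by blast
qed

lemma conn_Un:
  assumes "conn n X" "conn n X'" "p \<in> X" "p \<in> X'"
  shows "conn n (X \<union> X')"
proof (rule connI)
  fix Y y assume Y: "Y \<subseteq> X \<union> X'" "y \<in> Y"
    and cl: "\<And>p q. p \<in> Y \<Longrightarrow> q \<in> X \<union> X' \<Longrightarrow> adj n p q \<Longrightarrow> q \<in> Y"
  have 1: "X \<subseteq> Y" if "z \<in> X" "z \<in> Y" for z
    using connD[OF assms(1), of z "\<lambda>q. q \<in> Y"] that cl by blast
  have 2: "X' \<subseteq> Y" if "z \<in> X'" "z \<in> Y" for z
    using connD[OF assms(2), of z "\<lambda>q. q \<in> Y"] that cl by blast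
  show "X \<union> X' \<subseteq> Y" using 1 2 Y assms(3,4) by blast
qed

lemma conn_insert:
  assumes "conn n X" "v \<in> X \<or> (\<exists>a\<in>X. adj n v a)"
  shows "conn n (insert v X)"
proof (cases "v \<in> X")
  case False
  then obtain a where a: "a \<in> X" "adj n v a" using assms by blast
  show ?thesis
  proof (rule connI)
    fix Y y assume Y: "Y \<subseteq> insert v X" "y \<in> Y"
      and cl: "\<And>p q. p \<in> Y \<Longrightarrow> q \<in> insert v X \<Longrightarrow> adj n p q \<Longrightarrow> q \<in> Y"
    have 1: "X \<subseteq> Y" if "z \<in> X" "z \<in> Y" for z
      using connD[OF assms(1), of z "\<lambda>q. q \<in> Y"] that cl by blast
    have "\<exists>z. z \<in> X \<and> z \<in> Y" using Y a cl by blast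
    then have "X \<subseteq> Y" using 1 by blast
    moreover have "v \<in> Y" using cl[of a v] a adj_sym \<open>X \<subseteq> Y\<close> by blast
    ultimately show "insert v X \<subseteq> Y" by blast
  qed
qed (use assms in \<open>simp add: insert_absorb\<close>)

lemma conn_fill:
  assumes "conn n X"
  shows "conn n (fill n X)"
proof (rule connI)
  fix Y y assume Y: "Y \<subseteq> fill n X" "y \<in> Y"
    and cl: "\<And>p q. p \<in> Y \<Longrightarrow> q \<in> fill n X \<Longrightarrow> adj n p q \<Longrightarrow> q \<in> Y"
  have sub: "X \<subseteq> fill n X" by (auto simp: fill_def)
  have 1: "X \<subseteq> Y" if "z \<in> X" "z \<in> Y" for z
    using connD[OF assms, of z "\<lambda>q. q \<in> Y"] that cl sub by blast
  have near: "p \<in> X \<or> (\<exists>a\<in>X. adj n p a)" if "p \<in> fill n X" for p using that by (auto simp: fill_def)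
  have "\<exists>z. z \<in> X \<and> z \<in> Y" using Y near[of y] cl sub by blast
  then have "X \<subseteq> Y" using 1 by blast
  then show "fill n X \<subseteq> Y" using near cl adj_sym by blast
qed

text \<open>A filled point has both of its neighbors in \<open>X\<close> already, so it cannot help
  any point outside \<open>X\<close>.\<close>

lemma fill_fill: "fill n (fill n X) = fill n X"
proof
  show "fill n (fill n X) \<subseteq> fill n X"
  proof
    fix p assume "p \<in> fill n (fill n X)"
    then consider "p \<in> fill n X"
      | a b where "a \<in> fill n X" "b \<in> fill n X" "a \<noteq> b" "adj n p a" "adj n p b"
      unfolding fill_def[of n "fill n X"] by blast
    then show "p \<in> fill n X"
    proof cases
      case 2
      have *: "c \<in> X \<or> p \<in> X" if c: "c \<in> fill n X" "adj n p c" for c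
      proof (rule ccontr)
        assume no: "\<not> (c \<in> X \<or> p \<in> X)"
        then obtain c1 c2 where "c1 \<in> X" "c2 \<in> X" "c1 \<noteq> c2" "adj n c c1" "adj n c c2"
          using c by (auto simp: fill_def)
        then show False using adj_two[of n c c1 c2 p] c adj_sym no by metis
      qed
      show ?thesis using *[of a] *[of b] 2 by (auto simp: fill_def)
    qed
  qed
qed (auto simp: fill_def)

lemma arc_image:
  assumes "s < n" "l < n"
  shows "(\<lambda>t. (s + t) mod n) ` {..l} = arc n s ((s + l) mod n)"
proof -
  have m: "(s + t) mod n = (if s + t < n then s + t else s + t - n)" if "t < n" for t
    using that assms by (simp add: mod_if)
  show ?thesis
  proof (intro set_eqI iffI)
    fix p assume "p \<in> (\<lambda>t. (s + t) mod n) ` {..l}"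
    then obtain t where "t \<le> l" "p = (s + t) mod n" by auto
    then show "p \<in> arc n s ((s + l) mod n)"
      using assms m[of t] m[of l] by (auto simp: arc_def split: if_splits)
  next
    fix p assume p: "p \<in> arc n s ((s + l) mod n)"
    define t where "t = (if s \<le> p then p - s else p + n - s)"
    have "p < n" using p by (simp add: arc_def)
    then have "t < n" "(s + t) mod n = p" using assms by (auto simp: t_def m)
    moreover have "t \<le> l" using p assms m[of l] by (auto simp: arc_def t_def split: if_splits)
    ultimately show "p \<in> (\<lambda>t. (s + t) mod n) ` {..l}" by (metis atMost_iff imageI)
  qed
qed

lemma nxt_mod: "p < n \<Longrightarrow> nxt n p (Suc p mod n)"
  by (auto simp: nxt_def mod_Suc)

lemma arc_end:
  fixes s e n :: nat
  assumes "s < n" "e < n"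
  obtains l where "l < n" "e = (s + l) mod n"
proof
  show "(e + n - s) mod n < n" using assms by simp
  show "e = (s + (e + n - s) mod n) mod n" using assms by (simp add: mod_add_right_eq)
qed

lemma conn_arc:
  assumes "s < n" "e < n"
  shows "conn n (arc n s e)"
proof -
  obtain l where l: "l < n" "e = (s + l) mod n" using arc_end assms by blast
  define f where "f t = (s + t) mod n" for t
  have step: "adj n (f t) (f (Suc t))" for t
    using nxt_mod[of "f t" n] assms by (simp add: adj_def f_def mod_Suc_eq)
  have "conn n (f ` {..l})"
  proof (rule connI)
    fix Y y assume Y: "Y \<subseteq> f ` {..l}" "y \<in> Y"
      and cl: "\<And>p q. p \<in> Y \<Longrightarrow> q \<in> f ` {..l} \<Longrightarrow> adj n p q \<Longrightarrow> q \<in> Y"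
    then obtain t where t: "t \<le> l" "f t \<in> Y" by blast
    have up: "f (t + i) \<in> Y" if "t + i \<le> l" for i
      using that
    proof (induction i)
      case (Suc i)
      then have "f (t + i) \<in> Y" by simp
      then have "f (Suc (t + i)) \<in> Y" by (rule cl[OF _ _ step]) (use Suc.prems in auto)
      then show ?case by simp
    qed (use t in simp)
    have down: "f (t - i) \<in> Y" if "i \<le> t" for i
      using that
    proof (induction i)
      case (Suc i)
      then have "Suc (t - Suc i) = t - i" by simp
      then have "adj n (f (t - i)) (f (t - Suc i))" using step[of "t - Suc i"] adj_sym by metis
      moreover have "f (t - i) \<in> Y" using Suc by simp
      moreover have "f (t - Suc i) \<in> f ` {..l}" using t by auto
      ultimately show ?case using cl by blast
    qed (use t in simp)
    show "f ` {..l} \<subseteq> Y"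
    proof
      fix p assume "p \<in> f ` {..l}"
      then obtain i where i: "i \<le> l" "p = f i" by blast
      show "p \<in> Y" using up[of "i - t"] down[of "t - i"] i by (cases "t \<le> i") auto
    qed
  qed
  then show ?thesis unfolding f_def using arc_image[OF assms(1) l(1)] l(2) by simp
qed

text \<open>If every point of \<open>X\<close> has its predecessor in \<open>X\<close>, then
  \<open>X\<close> is the whole cycle. Otherwise start at a point without one and go upwards until
  \<open>X\<close> is left; this run has no neighbor in the rest of \<open>X\<close>.\<close>

lemma conn_is_arc:
  assumes X: "conn n X" "X \<noteq> {}" "X \<subseteq> {..<n}"
  shows "\<exists>s<n. \<exists>e<n. X = arc n s e"
proof (cases "\<exists>s\<in>X. \<forall>p. nxt n p s \<longrightarrow> p \<notin> X")
  case False
  obtain x where x: "x \<in> X" "x < n" using X by auto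
  have "\<exists>p. nxt n p s" if "s < n" for s
    using that by (cases s) (auto simp: nxt_def intro!: exI[of _ "n - 1"])
  have bwd: "p \<in> X" if ps: "nxt n p s" "s \<in> X" for p s
  proof -
    obtain p' where "nxt n p' s" "p' \<in> X" using False ps(2) by blast
    then show ?thesis using nxt_inj[OF ps(1)] by metis
  qed
  have down: "x - i \<in> X" if "i \<le> x" for i
    using that
  proof (induction i)
    case (Suc i)
    show ?case by (rule bwd[of _ "x - i"]) (use Suc x in \<open>auto simp: nxt_def\<close>)
  qed (use x in simp)
  have "0 \<in> X" using down[of x] by simp
  have "n - 1 \<in> X" by (rule bwd[of _ 0]) (use x \<open>0 \<in> X\<close> in \<open>auto simp: nxt_def\<close>)
  have all: "n - 1 - i \<in> X" if "i \<le> n - 1" for i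
    using that
  proof (induction i)
    case (Suc i)
    show ?case by (rule bwd[of _ "n - 1 - i"]) (use Suc x in \<open>auto simp: nxt_def\<close>)
  qed (use \<open>n - 1 \<in> X\<close> in simp)
  have "p \<in> X" if "p < n" for p using all[of "n - 1 - p"] that by simp
  then have "X = arc n 0 (n - 1)" using X by (auto simp: arc_def)
  moreover have "0 < n" "n - 1 < n" using x by auto
  ultimately show ?thesis by blast
next
  case True
  then obtain s where s: "s \<in> X" "\<And>p. nxt n p s \<Longrightarrow> p \<notin> X" by blast
  then have sn: "s < n" using X by auto
  define f where "f t = (s + t) mod n" for t
  have step: "nxt n (f t) (f (Suc t))" for t
    using nxt_mod[of "f t" n] sn by (simp add: f_def mod_Suc_eq)
  have "f n = s" using sn by (simp add: f_def)
  \<comment> \<open>The last point before the run would return to \<open>s\<close> is the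
    predecessor of \<open>s\<close>, so the run ends in time.\<close>
  then have "f (n - 1) \<notin> X" using step[of "n - 1"] sn s by simp
  moreover have "f 0 = s" using sn by (simp add: f_def)
  ultimately obtain k where k: "k < n - 1" "\<And>i. i \<le> k \<Longrightarrow> f i \<in> X" "f (Suc k) \<notin> X"
    using ex_least_nat_less[of "\<lambda>t. f t \<notin> X" "n - 1"] s by auto
  have "f ` {..k} = X"
  proof (rule X(1)[unfolded conn_def, rule_format])
    fix p q assume p: "p \<in> f ` {..k}" and q: "q \<in> X" "adj n p q"
    obtain t where t: "t \<le> k" "p = f t" using p by blast
    show "q \<in> f ` {..k}"
    proof (cases "nxt n p q")
      case True
      then have "q = f (Suc t)" using step[of t] t by (auto simp: nxt_def)
      then show ?thesis using t k q by (metis atMost_iff imageI le_Suc_eq le_antisym not_less_eq_eq)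
    next
      case False
      then have q': "nxt n q p" using q by (simp add: adj_def)
      show ?thesis
      proof (cases t)
        case 0
        then show ?thesis using q' t s q \<open>f 0 = s\<close> by auto
      next
        case (Suc i)
        then have "q = f i" using step[of i] t q' by (auto simp: nxt_def)
        then show ?thesis using Suc t by auto
      qed
    qed
  qed (use k in auto)
  then have "X = arc n s ((s + k) mod n)"
    using arc_image[OF sn, of k] k unfolding f_def by simp
  moreover have "(s + k) mod n < n" using sn by simp
  ultimately show ?thesis using sn by blast
qed

section \<open>Stable sets and the merging of rectangles\<close>

definition neighbor :: "nat \<Rightarrow> nat \<times> nat \<Rightarrow> nat \<times> nat \<Rightarrow> bool" where
  "neighbor n v a \<longleftrightarrow> fst v < n \<and> snd v < n \<and> fst a < n \<and> snd a < n \<and>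
    (adj n (fst v) (fst a) \<and> snd a = snd v \<or> fst a = fst v \<and> adj n (snd v) (snd a))"

definition stable :: "nat \<Rightarrow> (nat \<times> nat) set \<Rightarrow> bool" where
  "stable n C \<longleftrightarrow> (\<forall>v a b. neighbor n v a \<longrightarrow> neighbor n v b \<longrightarrow> a \<noteq> b \<longrightarrow> a \<in> C \<longrightarrow> b \<in> C \<longrightarrow> v \<in> C)"

fun rect :: "nat \<Rightarrow> quad \<Rightarrow> (nat \<times> nat) set" where
  "rect n (s, e, s', e') = arc n s e \<times> arc n s' e'"

fun valid :: "nat \<Rightarrow> quad \<Rightarrow> bool" where
  "valid n (s, e, s', e') \<longleftrightarrow> s < n \<and> e < n \<and> s' < n \<and> e' < n"

definition single :: "nat \<Rightarrow> (nat \<times> nat) set \<Rightarrow> quad \<Rightarrow> bool" where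
  "single n X r \<longleftrightarrow> (case r of (s, e, s', e') \<Rightarrow> s < n \<and> s' < n \<and> e = s \<and> e' = s' \<and> (s, s') \<in> X)"

text \<open>
  \<open>fill\<close> closes the gap of an arc that misses a single point, whose two neighbors lie in the arc.
\<close>

definition merge :: "nat \<Rightarrow> quad \<Rightarrow> quad \<Rightarrow> quad \<Rightarrow> bool" where
  "merge n r p q \<longleftrightarrow> valid n r \<and> valid n p \<and> valid n q \<and>
    (case (r, p, q) of ((s, e, s', e'), (ps, pe, ps', pe'), (qs, qe, qs', qe')) \<Rightarrow>
      \<exists>v v' a a' b b'. neighbor n (v, v') (a, a') \<and> neighbor n (v, v') (b, b') \<and> (a, a') \<noteq> (b, b') \<and>
        (a, a') \<in> rect n p \<and> (b, b') \<in> rect n q \<and>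
        arc n s e = fill n (insert v (arc n ps pe \<union> arc n qs qe)) \<and>
        arc n s' e' = fill n (insert v' (arc n ps' pe' \<union> arc n qs' qe')))"

lemma stable_swap: "stable n C \<Longrightarrow> stable n (prod.swap ` C)"
proof -
  have "neighbor n (prod.swap v) (prod.swap a) \<longleftrightarrow> neighbor n v a" for v a
    by (auto simp: neighbor_def)
  moreover have "v \<in> prod.swap ` C \<longleftrightarrow> prod.swap v \<in> C" for v
    by (metis image_iff swap_swap)
  ultimately show "stable n C \<Longrightarrow> stable n (prod.swap ` C)"
    unfolding stable_def by (metis swap_swap)
qed

text \<open>Next to a line contained in \<open>C\<close>, one point of the parallel line suffices:
  the points beside it have it and a point of the full line as neighbors, and so on along the
  connected set \<open>J\<close>.\<close>

lemma spread:
  assumes n: "2 \<le> n" and C: "stable n C" and J: "conn n J" "J \<subseteq> {..<n}" "{i} \<times> J \<subseteq> C"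
    and i: "adj n i i'" and q: "q \<in> J" "(i', q) \<in> C"
  shows "{i'} \<times> J \<subseteq> C"
proof -
  have "(i', x) \<in> C" if "x \<in> J" for x
  proof (rule connD[OF J(1) q(1) _ _ that])
    show "(i', q) \<in> C" by (rule q(2))
    fix p q assume pq: "p \<in> J" "(i', p) \<in> C" "q \<in> J" "adj n p q"
    have "neighbor n (i', q) (i', p)" "neighbor n (i', q) (i, q)"
      using i pq adj_less J(2) by (auto simp: neighbor_def adj_sym)
    moreover have "(i', p) \<noteq> (i, q)" using adj_neq[OF n i] by simp
    moreover have "(i, q) \<in> C" using J(3) pq by auto
    ultimately show "(i', q) \<in> C" using C pq(2) unfolding stable_def by blast
  qed
  then show ?thesis by auto
qed

text \<open>The point lies in the rectangle or directly beside it, so at most one of the two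
  insertions is proper, and that one is an instance of \<open>spread\<close>.\<close>

lemma extend:
  assumes n: "2 \<le> n" and C: "stable n C"
    and IJ: "conn n I" "I \<subseteq> {..<n}" "conn n J" "J \<subseteq> {..<n}" "I \<times> J \<subseteq> C"
    and v: "neighbor n (v, v') (a, a')" "(a, a') \<in> I \<times> J" "(v, v') \<in> C"
  shows "insert v I \<times> insert v' J \<subseteq> C \<and> conn n (insert v I) \<and> conn n (insert v' J)"
proof (cases "a' = v'")
  case True
  have 1: "insert v I \<times> J \<subseteq> C \<and> conn n (insert v I)"
  proof (cases "v \<in> I")
    case True
    then show ?thesis using IJ by (simp add: insert_absorb)
  next
    case False
    then have "adj n v a" using v True by (auto simp: neighbor_def)
    moreover have "{v} \<times> J \<subseteq> C"
      using spread[OF n C IJ(3,4), of a v v'] v True IJ(5) \<open>adj n v a\<close> adj_sym by auto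
    ultimately show ?thesis using IJ v by (auto intro!: conn_insert)
  qed
  moreover have "insert v' J = J" using v True by auto
  ultimately show ?thesis using IJ by simp
next
  case False
  then have av: "a = v" "adj n v' a'" using v by (auto simp: neighbor_def)
  have "{v'} \<times> I \<subseteq> prod.swap ` C"
  proof (rule spread[OF n stable_swap[OF C] IJ(1,2)])
    show "{a'} \<times> I \<subseteq> prod.swap ` C" using IJ(5) v by force
    show "adj n a' v'" using av adj_sym by blast
    show "v \<in> I" using v av by simp
    show "(v', v) \<in> prod.swap ` C" using v by force
  qed
  then have "I \<times> {v'} \<subseteq> C" by auto
  moreover have "conn n (insert v' J)" using IJ v av by (intro conn_insert) auto
  moreover have "insert v I = I" using v av by auto
  ultimately show ?thesis using IJ by auto
qed

text \<open>The two rectangles share a point. The line of the second one through this point spreads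
  along \<open>I\<close>, because the first one provides a starting point on each parallel
  line.\<close>

lemma join_aux:
  assumes n: "2 \<le> n" and C: "stable n C"
    and conn: "conn n I" "conn n J'" "J' \<subseteq> {..<n}"
    and sub: "I \<times> J \<subseteq> C" "I' \<times> J' \<subseteq> C" and v: "v \<in> I" "v \<in> I'" "v' \<in> J" "v' \<in> J'"
  shows "I \<times> J' \<subseteq> C"
proof -
  have "{x} \<times> J' \<subseteq> C" if "x \<in> I" for x
  proof (rule connD[OF conn(1) v(1) _ _ that])
    show "{v} \<times> J' \<subseteq> C" using sub v by auto
    fix p q assume "p \<in> I" "{p} \<times> J' \<subseteq> C" "q \<in> I" "adj n p q"
    then show "{q} \<times> J' \<subseteq> C" using spread[OF n C conn(2,3), of p q v'] sub v by auto
  qed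
  then show ?thesis by auto
qed

lemma fill_rect:
  assumes C: "stable n C" "I \<times> J \<subseteq> C" "I \<subseteq> {..<n}" "J \<subseteq> {..<n}"
  shows "fill n I \<times> fill n J \<subseteq> C"
proof -
  have 1: "fill n I \<times> J \<subseteq> C"
  proof safe
    fix p q assume p: "p \<in> fill n I" and q: "q \<in> J"
    show "(p, q) \<in> C"
    proof (cases "p \<in> I")
      case False
      then obtain a b where "a \<in> I" "b \<in> I" "a \<noteq> b" "adj n p a" "adj n p b"
        using p by (auto simp: fill_def)
      then have "neighbor n (p, q) (a, q)" "neighbor n (p, q) (b, q)" "(a, q) \<in> C" "(b, q) \<in> C"
        using q C adj_less by (auto simp: neighbor_def)
      then show ?thesis using C(1) \<open>a \<noteq> b\<close> unfolding stable_def by blast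
    qed (use C q in auto)
  qed
  have lt: "fill n I \<subseteq> {..<n}" using C(3) adj_less by (auto simp: fill_def)
  show ?thesis
  proof safe
    fix p q assume p: "p \<in> fill n I" and q: "q \<in> fill n J"
    show "(p, q) \<in> C"
    proof (cases "q \<in> J")
      case False
      then obtain a b where "a \<in> J" "b \<in> J" "a \<noteq> b" "adj n q a" "adj n q b"
        using q by (auto simp: fill_def)
      then have "neighbor n (p, q) (p, a)" "neighbor n (p, q) (p, b)" "(p, a) \<in> C" "(p, b) \<in> C"
        using p 1 lt adj_less by (auto simp: neighbor_def)
      then show ?thesis using C(1) \<open>a \<noteq> b\<close> unfolding stable_def by blast
    qed (use 1 p in auto)
  qed
qed

lemma arc_subset: "arc n s e \<subseteq> {..<n}"
  by (auto simp: arc_def)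

text \<open>The cell between the rectangles lies in \<open>C\<close>, and both rectangles extend to
  contain it. As they now share a point, the two mixed products lie in \<open>C\<close> too, and
  single missing lines are filled last.\<close>

lemma merge_sound:
  assumes n: "2 \<le> n" and C: "stable n C" and m: "merge n r p q"
    and pq: "rect n p \<subseteq> C" "rect n q \<subseteq> C"
  shows "rect n r \<subseteq> C"
proof -
  obtain s e s' e' where r: "r = (s, e, s', e')" by (cases r)
  obtain ps pe ps' pe' where p: "p = (ps, pe, ps', pe')" by (cases p)
  obtain qs qe qs' qe' where q: "q = (qs, qe, qs', qe')" by (cases q)
  let ?I = "arc n ps pe" and ?J = "arc n ps' pe'" and ?I' = "arc n qs qe" and ?J' = "arc n qs' qe'"
  obtain v v' a a' b b' where *: "neighbor n (v, v') (a, a')" "neighbor n (v, v') (b, b')"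
    "(a, a') \<noteq> (b, b')" "(a, a') \<in> ?I \<times> ?J" "(b, b') \<in> ?I' \<times> ?J'"
    "arc n s e = fill n (insert v (?I \<union> ?I'))" "arc n s' e' = fill n (insert v' (?J \<union> ?J'))"
    using m unfolding merge_def r p q rect.simps prod.case by blast
  have val: "ps < n" "pe < n" "ps' < n" "pe' < n" "qs < n" "qe < n" "qs' < n" "qe' < n"
    using m by (auto simp: merge_def p q)
  have sub: "?I \<times> ?J \<subseteq> C" "?I' \<times> ?J' \<subseteq> C" using pq by (simp_all add: p q)
  have v: "(v, v') \<in> C" using *(1-5) sub C unfolding stable_def by blast
  have vn: "v < n" "v' < n" using * by (auto simp: neighbor_def)
  have 1: "insert v ?I \<times> insert v' ?J \<subseteq> C" "conn n (insert v ?I)" "conn n (insert v' ?J)"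
    using extend[OF n C conn_arc arc_subset conn_arc arc_subset sub(1) *(1,4) v] val by auto
  have 2: "insert v ?I' \<times> insert v' ?J' \<subseteq> C" "conn n (insert v ?I')" "conn n (insert v' ?J')"
    using extend[OF n C conn_arc arc_subset conn_arc arc_subset sub(2) *(2,5) v] val by auto
  have lt: "insert v ?I \<subseteq> {..<n}" "insert v ?I' \<subseteq> {..<n}" "insert v' ?J \<subseteq> {..<n}" "insert v' ?J' \<subseteq> {..<n}"
    using arc_subset vn by auto
  have "insert v ?I \<times> insert v' ?J' \<subseteq> C"
    by (rule join_aux[OF n C 1(2) 2(3) lt(4) 1(1) 2(1), of v v']) auto
  moreover have "insert v ?I' \<times> insert v' ?J \<subseteq> C"
    by (rule join_aux[OF n C 2(2) 1(3) lt(3) 2(1) 1(1), of v v']) auto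
  ultimately have "insert v (?I \<union> ?I') \<times> insert v' (?J \<union> ?J') \<subseteq> C"
    using 1(1) 2(1) by blast
  from fill_rect[OF C this] show ?thesis using lt by (simp add: r *)
qed

text \<open>In each coordinate both arcs contain that of \<open>v\<close> or a neighbor of it, so
  adding it links them into a connected set, again an arc. That the result is closed under
  \<open>fill\<close> is kept for cells with both active neighbors in one rectangle.\<close>

lemma merge_exists:
  assumes n: "2 \<le> n" and val: "valid n p" "valid n q"
    and v: "neighbor n v a" "neighbor n v b" "a \<noteq> b" "a \<in> rect n p" "b \<in> rect n q"
  shows "\<exists>r. merge n r p q \<and> rect n p \<union> rect n q \<subseteq> rect n r \<and>
    (case r of (s, e, s', e') \<Rightarrow> fill n (arc n s e) = arc n s e \<and> fill n (arc n s' e') = arc n s' e')"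
proof -
  obtain ps pe ps' pe' where p: "p = (ps, pe, ps', pe')" by (cases p)
  obtain qs qe qs' qe' where q: "q = (qs, qe, qs', qe')" by (cases q)
  obtain x x' where x: "v = (x, x')" by (cases v)
  have one: "\<exists>s<n. \<exists>e<n. arc n s e = fill n (insert x (arc n i j \<union> arc n i' j'))"
    if ij: "i < n" "j < n" "i' < n" "j' < n" and x: "x < n" "x \<in> arc n i j \<or> (\<exists>c\<in>arc n i j. adj n x c)"
      "x \<in> arc n i' j' \<or> (\<exists>c\<in>arc n i' j'. adj n x c)" for x i j i' j'
  proof -
    have "conn n (insert x (arc n i j) \<union> insert x (arc n i' j'))"
      using ij x by (intro conn_Un[of _ _ _ x] conn_insert conn_arc) auto
    then have "conn n (fill n (insert x (arc n i j \<union> arc n i' j')))"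
      by (intro conn_fill) (simp add: Un_commute insert_commute)
    moreover have "fill n (insert x (arc n i j \<union> arc n i' j')) \<subseteq> {..<n}"
      using x arc_subset adj_less by (auto simp: fill_def)
    ultimately show ?thesis using conn_is_arc[of n "fill n (insert x (arc n i j \<union> arc n i' j'))"]
      by (auto simp: fill_def) metis
  qed
  have vn: "x < n" "x' < n" using v by (auto simp: neighbor_def x)
  have near: "x \<in> arc n ps pe \<or> (\<exists>c\<in>arc n ps pe. adj n x c)"
    "x \<in> arc n qs qe \<or> (\<exists>c\<in>arc n qs qe. adj n x c)"
    "x' \<in> arc n ps' pe' \<or> (\<exists>c\<in>arc n ps' pe'. adj n x' c)"
    "x' \<in> arc n qs' qe' \<or> (\<exists>c\<in>arc n qs' qe'. adj n x' c)"
    using v by (auto simp: p q x neighbor_def)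
  obtain s e where se: "s < n" "e < n" "arc n s e = fill n (insert x (arc n ps pe \<union> arc n qs qe))"
    using one[of ps pe qs qe x] val vn near unfolding p q valid.simps by blast
  obtain s' e' where se': "s' < n" "e' < n" "arc n s' e' = fill n (insert x' (arc n ps' pe' \<union> arc n qs' qe'))"
    using one[of ps' pe' qs' qe' x'] val vn near unfolding p q valid.simps by blast
  obtain a1 a2 b1 b2 where ab: "a = (a1, a2)" "b = (b1, b2)" by (metis prod.exhaust)
  have "merge n (s, e, s', e') p q"
    unfolding merge_def p q prod.case valid.simps
    using se se' val[unfolded p q valid.simps] v[unfolded x ab p q] by blast
  moreover have "rect n p \<union> rect n q \<subseteq> rect n (s, e, s', e')"
    by (auto simp: p q se se' fill_def)
  moreover have "fill n (arc n s e) = arc n s e" "fill n (arc n s' e') = arc n s' e'"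
    by (simp_all add: se se' fill_fill)
  ultimately show ?thesis by (intro exI[of _ "(s, e, s', e')"]) auto
qed

text \<open>Only an inequality, because \<open>r\<close> may already be in \<open>F\<close> and its
  old weight is then overwritten.\<close>

lemma sum_merge_le:
  fixes f :: "'a \<Rightarrow> nat"
  assumes "finite F" "p \<in> F" "q \<in> F" "p \<noteq> q"
  shows "sum (f(r := f p + f q)) (insert r (F - {p, q})) \<le> sum f F"
proof -
  have "sum (f(r := f p + f q)) (insert r (F - {p, q})) =
      f p + f q + sum (f(r := f p + f q)) (F - {p, q} - {r})"
    using assms(1) by (subst sum.insert_remove) auto
  also have "sum (f(r := f p + f q)) (F - {p, q} - {r}) = sum f (F - {p, q} - {r})"
    by (rule sum.cong) auto
  also have "\<dots> \<le> sum f (F - {p, q})" using assms(1) by (intro sum_mono2) auto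
  also have "f p + f q + sum f (F - {p, q}) = sum f F"
  proof -
    have "sum f F = sum f (F - {p, q}) + sum f {p, q}"
      using assms by (intro sum.subset_diff) auto
    then show ?thesis using assms(4) by simp
  qed
  finally show ?thesis by simp
qed

text \<open>
  Merge rectangles for as long as possible, starting with the active cells.  The derivations of the
  rectangles present at any time use disjoint sets of active cells, so they stay small.
\<close>

theorem rect_complete:
  assumes n: "2 \<le> n" and X: "finite X" "X \<subseteq> {..<n} \<times> {..<n}"
    and D: "{..<n} \<times> {..<n} \<times> {..<n} \<times> {..<n} \<subseteq> D"
    and u: "\<And>C. X \<subseteq> C \<Longrightarrow> stable n C \<Longrightarrow> u \<in> C"
  shows "\<exists>r m. derivation.der D (single n X) (merge n) r m \<and> valid n r \<and> u \<in> rect n r \<and> m \<le> card X"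
proof -
  define der where "der = derivation.der D (single n X) (merge n)"
  define full where "full r = (valid n r \<and>
    (case r of (s, e, s', e') \<Rightarrow> fill n (arc n s e) = arc n s e \<and> fill n (arc n s' e') = arc n s' e'))" for r
  \<comment> \<open>Disjointness of the leaves is recorded only through their number: the weights
    \<open>f r\<close> are leaf counts with sum at most \<open>card X\<close>.\<close>
  define ok where "ok F f \<longleftrightarrow> finite F \<and> (\<forall>r\<in>F. der r (f r) \<and> full r) \<and> sum f F \<le> card X \<and>
    X \<subseteq> (\<Union>r\<in>F. rect n r)" for F f
  have "ok ((\<lambda>(i, j). (i, i, j, j)) ` X) (\<lambda>_. 1)"
  proof -
    have "der (i, i, j, j) 1 \<and> full (i, i, j, j) \<and> (i, j) \<in> rect n (i, i, j, j)" if "(i, j) \<in> X" for i j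
    proof -
      have ij: "i < n" "j < n" using X that by auto
      have "arc n k k = {k}" if "k < n" for k using that by (auto simp: arc_def)
      moreover have "fill n {k} = {k}" for k by (auto simp: fill_def)
      ultimately have "full (i, i, j, j)" "(i, j) \<in> rect n (i, i, j, j)" using ij by (auto simp: full_def)
      moreover have "der (i, i, j, j) 1"
        unfolding der_def using that ij D by (intro derivation.der_base) (auto simp: single_def)
      ultimately show ?thesis by simp
    qed
    moreover have "card ((\<lambda>(i, j). (i, i, j, j)) ` X) \<le> card X" using X by (intro card_image_le)
    ultimately show ?thesis using X(1) by (fastforce simp: ok_def)
  qed
  then have "\<exists>k F f. ok F f \<and> card F = k" by blast
  \<comment> \<open>A family with fewest rectangles cannot be merged further, since merging replaces
    two rectangles by one.\<close>
  then obtain F f where F: "ok F f" "\<And>F' f'. ok F' f' \<Longrightarrow> card F \<le> card F'"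
    using exists_least_iff[of "\<lambda>k. \<exists>F f. ok F f \<and> card F = k"] by (metis not_le)
  have "stable n (\<Union>r\<in>F. rect n r)"
    unfolding stable_def
  proof (intro allI impI, rule ccontr)
    fix v a b
    assume v: "neighbor n v a" "neighbor n v b" "a \<noteq> b" "v \<notin> (\<Union>r\<in>F. rect n r)"
      and "a \<in> (\<Union>r\<in>F. rect n r)" "b \<in> (\<Union>r\<in>F. rect n r)"
    then obtain p q where pq: "p \<in> F" "q \<in> F" "a \<in> rect n p" "b \<in> rect n q" by blast
    show False
    proof (cases "p = q")
      case True
      obtain s e s' e' where p: "p = (s, e, s', e')" by (cases p)
      have "full p" using F(1) pq by (simp add: ok_def)
      then have fl: "fill n (arc n s e) = arc n s e" "fill n (arc n s' e') = arc n s' e'"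
        by (simp_all add: full_def p)
      have ab: "fst a \<in> arc n s e" "snd a \<in> arc n s' e'" "fst b \<in> arc n s e" "snd b \<in> arc n s' e'"
        using pq True by (auto simp: p)
      \<comment> \<open>Each coordinate of \<open>v\<close> is shared with \<open>a\<close> or
        \<open>b\<close>, or else lies between two different points of the same arc.\<close>
      have "fst v \<in> fill n (arc n s e)" "snd v \<in> fill n (arc n s' e')"
        using v(1-3) ab unfolding neighbor_def fill_def prod_eq_iff by auto
      then have "v \<in> rect n p" using fl by (cases v) (simp add: p)
      then show False using v(4) pq by blast
    next
      case False
      have val: "valid n p" "valid n q" "der p (f p)" "der q (f q)"
        using F(1) pq by (auto simp: ok_def full_def)
      have "\<exists>r. merge n r p q \<and> rect n p \<union> rect n q \<subseteq> rect n r \<and> full r"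
        using merge_exists[OF n val(1,2) v(1-3) pq(3,4)] unfolding full_def merge_def by blast
      then obtain r where r: "merge n r p q" "rect n p \<union> rect n q \<subseteq> rect n r" "full r" by blast
      have "r \<in> D" using r(3) D by (cases r) (auto simp: full_def)
      then have "der r (f p + f q)"
        using val r(1) unfolding der_def by (intro derivation.der_rule) auto
      moreover have "(\<Union>t\<in>F. rect n t) \<subseteq> (\<Union>t\<in>insert r (F - {p, q}). rect n t)"
        using r(2) by blast
      moreover have "sum (f(r := f p + f q)) (insert r (F - {p, q})) \<le> card X"
        using F(1) pq False by (intro order_trans[OF sum_merge_le]) (auto simp: ok_def)
      ultimately have "ok (insert r (F - {p, q})) (f(r := f p + f q))"
        using F(1) r(3) unfolding ok_def by (intro conjI) (simp, simp, assumption, blast)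
      then have "card F \<le> card (insert r (F - {p, q}))" by (rule F(2))
      also have "\<dots> \<le> Suc (card (F - {p, q}))" by (rule card_insert_le_m1) auto
      also have "card (F - {p, q}) = card F - 2"
        using pq False F(1) by (subst card_Diff_subset) (auto simp: ok_def)
      finally show False
        using pq False F(1) card_mono[of F "{p, q}"] by (auto simp: ok_def)
    qed
  qed
  moreover have "X \<subseteq> (\<Union>r\<in>F. rect n r)" using F(1) by (simp add: ok_def)
  ultimately have "u \<in> (\<Union>r\<in>F. rect n r)" using u by blast
  then obtain r where r: "r \<in> F" "u \<in> rect n r" by blast
  moreover have "f r \<le> card X"
    using F(1) r member_le_sum[of r F f] by (auto simp: ok_def)
  moreover have "der r (f r)" "valid n r" using F(1) r by (simp_all add: ok_def full_def)
  ultimately show ?thesis unfolding der_def by blast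
qed

section \<open>Instances as words\<close>

definition first_zero :: "bool list \<Rightarrow> nat \<Rightarrow> bool" where
  "first_zero w n \<longleftrightarrow> n < length w \<and> \<not> w ! n \<and> (\<forall>m<n. w ! m)"

text \<open>Bit \<open>d\<close> after the unary prefix and its end marker. With
  \<open>n + l\<close> for \<open>n\<close>, the same predicate reads the indicator vector of the
  cell.\<close>

definition act :: "bool list \<Rightarrow> nat \<Rightarrow> nat \<Rightarrow> bool" where
  "act w n d \<longleftrightarrow> n + 1 + d < length w \<and> w ! (n + 1 + d)"

definition parsed :: "(nat \<Rightarrow> nat) \<Rightarrow> bool list \<Rightarrow> nat \<Rightarrow> nat \<Rightarrow> nat \<Rightarrow> bool" where
  "parsed L w n l c \<longleftrightarrow> first_zero w n \<and> L n = l \<and> length w = n + 1 + l + l \<and> c < l \<and>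
    (\<forall>d<l. act w (n + l) d \<longleftrightarrow> d = c)"

lemma first_zero_unique: "first_zero w n \<Longrightarrow> first_zero w m \<Longrightarrow> m = n"
  by (metis first_zero_def linorder_neqE_nat)

lemma first_zero_less: "first_zero w n \<Longrightarrow> n < ubd w"
  using length_less_ubd[of w] by (simp add: first_zero_def)

text \<open>The unary prefix ends at the first zero, and \<open>n\<close> fixes the boundaries of
  the blocks. So a word determines its instance up to the states of cells off the grid, and three
  numbers are enough to describe the decoding.\<close>

lemma AsyncUnstability_iff:
  assumes dist: "\<And>n. distinct (cells A n)" and len: "\<And>n. length (cells A n) = L n"
    and cong: "\<And>n x y u. u \<in> G A n \<Longrightarrow> (\<And>v. v \<in> G A n \<Longrightarrow> x v = y v) \<Longrightarrow>
      async_unstable A n x u = async_unstable A n y u"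
    and \<Phi>: "\<And>w n c x. parsed L w n (L n) c \<Longrightarrow> (\<And>d. d < L n \<Longrightarrow> x (cells A n ! d) = act w n d) \<Longrightarrow>
      async_unstable A n x (cells A n ! c) = \<Phi> w n (L n) c"
  shows "w \<in> AsyncUnstability A \<longleftrightarrow> (\<exists>n<ubd w. \<exists>l<ubd w. \<exists>c<ubd w. parsed L w n l c \<and> \<Phi> w n l c)"
proof
  assume "w \<in> AsyncUnstability A"
  then obtain n x u where w: "w = encode_instance A n x u" "u \<in> G A n" "async_unstable A n x u"
    by (auto simp: AsyncUnstability_def)
  obtain c where c: "c < L n" "cells A n ! c = u" using w(2) len by (metis in_set_conv_nth)
  have 1: "w ! m" if "m < n" for m using that by (simp add: w encode_instance_def nth_append)
  have 2: "\<not> w ! n" by (simp add: w encode_instance_def nth_append)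
  have lw: "length w = n + 1 + L n + L n" by (simp add: w encode_instance_def len)
  have 3: "act w n d \<longleftrightarrow> x (cells A n ! d)" if "d < L n" for d
    using that by (simp add: act_def lw) (simp add: w encode_instance_def nth_append len)
  have 4: "act w (n + L n) d \<longleftrightarrow> cells A n ! d = u" if "d < L n" for d
    using that by (simp add: act_def lw) (simp add: w encode_instance_def nth_append len)
  have "cells A n ! d = u \<longleftrightarrow> d = c" if "d < L n" for d
    using that c dist[of n] len[of n] nth_eq_iff_index_eq[of "cells A n" d c] by auto
  then have p: "parsed L w n (L n) c" using 1 2 4 c by (simp add: parsed_def first_zero_def lw)
  moreover have "\<Phi> w n (L n) c" using \<Phi>[OF p, of x] 3 w(3) c by simp
  moreover have "n < ubd w" "L n < ubd w" "c < ubd w" using length_less_ubd[of w] c lw by auto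
  ultimately show "\<exists>n<ubd w. \<exists>l<ubd w. \<exists>c<ubd w. parsed L w n l c \<and> \<Phi> w n l c" by blast
next
  assume "\<exists>n<ubd w. \<exists>l<ubd w. \<exists>c<ubd w. parsed L w n l c \<and> \<Phi> w n l c"
  then obtain n c where p: "parsed L w n (L n) c" "\<Phi> w n (L n) c" by (auto simp: parsed_def)
  \<comment> \<open>Cells off the grid are set to inactive.\<close>
  define x where "x v \<longleftrightarrow> (\<exists>d<L n. cells A n ! d = v \<and> act w n d)" for v
  have eq: "cells A n ! d = cells A n ! d' \<longleftrightarrow> d = d'" if "d < L n" "d' < L n" for d d'
    using that dist[of n] len[of n] by (simp add: nth_eq_iff_index_eq)
  have x: "x (cells A n ! d) = act w n d" if "d < L n" for d
    using that eq by (auto simp: x_def)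
  have c: "c < L n" using p by (simp add: parsed_def)
  have lw: "length w = n + 1 + L n + L n" using p by (simp add: parsed_def)
  have "w = encode_instance A n x (cells A n ! c)"
  proof (rule nth_equalityI)
    show "length w = length (encode_instance A n x (cells A n ! c))"
      by (simp add: lw encode_instance_def len)
    fix i assume i: "i < length w"
    consider "i < n" | "i = n" | d where "i = n + 1 + d" "d < L n" | d where "i = n + L n + 1 + d" "d < L n"
    proof -
      assume h: "i < n \<Longrightarrow> thesis" "i = n \<Longrightarrow> thesis" "\<And>d. i = n + 1 + d \<Longrightarrow> d < L n \<Longrightarrow> thesis"
        "\<And>d. i = n + L n + 1 + d \<Longrightarrow> d < L n \<Longrightarrow> thesis"
      show thesis using h(1,2) h(3)[of "i - n - 1"] h(4)[of "i - n - L n - 1"] i lw by linarith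
    qed
    then show "w ! i = encode_instance A n x (cells A n ! c) ! i"
    proof cases
      case 1
      then show ?thesis using p by (simp add: parsed_def first_zero_def encode_instance_def nth_append)
    next
      case 2
      then show ?thesis using p by (simp add: parsed_def first_zero_def encode_instance_def nth_append)
    next
      case 3
      then have "w ! i = act w n d" by (simp add: act_def lw)
      then show ?thesis using 3 x by (simp add: encode_instance_def nth_append len)
    next
      case 4
      then have "w ! i = act w (n + L n) d" by (simp add: act_def lw)
      also have "\<dots> \<longleftrightarrow> d = c" using p 4 by (simp add: parsed_def)
      finally show ?thesis using 4 eq c by (simp add: encode_instance_def nth_append len)
    qed
  qed
  moreover have "async_unstable A n x (cells A n ! c)" using \<Phi>[OF p(1), of x] x p(2) by simp
  moreover have "cells A n ! c \<in> G A n" using c len by simp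
  ultimately show "w \<in> AsyncUnstability A" by (auto simp: AsyncUnstability_def)
qed

lemma (in torus) unstable_cong:
  assumes "u \<in> V" "\<And>v. v \<in> V \<Longrightarrow> x v = y v"
  shows "async_unstable A n x u = async_unstable A n y u"
proof -
  have "active x = active y" using assms by (auto simp: active_def)
  then show ?thesis using unstable_iff_closure[OF assms(1)] assms by metis
qed

section \<open>Definability of well-formed instances\<close>

lemma fo_ex_less [fo_intros]:
  assumes "fo p (\<lambda>w X e. Q w X (\<lambda>i. e (Suc i)) (e 0))"
  shows "fo p (\<lambda>w X e. \<exists>x<e n. Q w X e x)"
proof (rule fo_cong)
  show "fo p (\<lambda>w X e. \<exists>x<ubd w. x < e n \<and> Q w X e x)" by (intro fo_intros assms)
qed (metis order.strict_trans)

lemma fo_all_less [fo_intros]: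
  assumes "fo p (\<lambda>w X e. Q w X (\<lambda>i. e (Suc i)) (e 0))"
  shows "fo p (\<lambda>w X e. \<forall>x<e n. Q w X e x)"
  using fo_not[OF fo_ex_less[OF fo_not[OF assms], of n]] by simp

lemma fo_ge_const [fo_intros]: "fo p (\<lambda>w X e. k \<le> e a)"
proof (rule fo_cong)
  show "fo p (\<lambda>w X e. \<exists>x<ubd w. x = k \<and> x \<le> e a)" by (intro fo_intros)
qed (metis order.strict_trans1)

lemma fo_const [fo_intros]: "fo p (\<lambda>w X e. b)"
  using fo_eq[of p 0 0] fo_not[OF fo_eq[of p 0 0]] by (cases b) simp_all

lemma fo_less_length [fo_intros]: "fo p (\<lambda>w X e. e a < length w)"
proof (rule fo_cong)
  show "fo p (\<lambda>w X e. \<exists>x<ubd w. x = length w \<and> e a < x)" by (intro fo_intros)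
qed (use length_less_ubd in \<open>auto intro: Suc_lessD\<close>)

lemma fo_first_zero [fo_intros]: "fo p (\<lambda>w X e. first_zero w (e a))"
proof (rule fo_cong)
  show "fo p (\<lambda>w X e. e a < length w \<and> \<not> (e a < length w \<and> w ! e a) \<and>
      (\<forall>m<e a. m < length w \<and> w ! m))"
    by (intro fo_intros fo_bit)
qed (auto simp: first_zero_def)

lemma fo_act [fo_intros]: "fo p (\<lambda>w X e. act w (e a) (e b))"
proof (rule fo_cong)
  show "fo p (\<lambda>w X e. \<exists>s<ubd w. \<exists>q<ubd w. e a + e b = s \<and> Suc s = q \<and> q < length w \<and> w ! q)"
    by (intro fo_intros fo_bit)
next
  fix w :: "bool list" and e :: "nat \<Rightarrow> nat"
  show "(\<exists>s<ubd w. \<exists>q<ubd w. e a + e b = s \<and> Suc s = q \<and> q < length w \<and> w ! q) = act w (e a) (e b)"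
    using length_less_ubd[of w] by (auto simp: act_def)
qed

lemma fo_parsed:
  assumes "\<And>p a b. fo p (\<lambda>w X e. L (e a) = e b)"
  shows "fo p (\<lambda>w X e. parsed L w (e a) (e b) (e c))"
proof (rule fo_cong)
  show "fo p (\<lambda>w X e. first_zero w (e a) \<and> L (e a) = e b \<and>
      (\<exists>s<ubd w. \<exists>t<ubd w. \<exists>q<ubd w. e a + e b = s \<and> s + e b = t \<and> Suc t = q \<and> q = length w \<and>
        e c < e b \<and> (\<forall>d<e b. act w s d \<longleftrightarrow> d = e c)))"
    by (intro fo_intros assms)
next
  fix w :: "bool list" and e :: "nat \<Rightarrow> nat"
  show "(first_zero w (e a) \<and> L (e a) = e b \<and>
      (\<exists>s<ubd w. \<exists>t<ubd w. \<exists>q<ubd w. e a + e b = s \<and> s + e b = t \<and> Suc t = q \<and> q = length w \<and>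
        e c < e b \<and> (\<forall>d<e b. act w s d \<longleftrightarrow> d = e c))) = parsed L w (e a) (e b) (e c)"
    using length_less_ubd[of w] by (auto simp: parsed_def)
qed

lemma AsyncUnstability_in_NC:
  assumes "\<And>n. distinct (cells A n)" "\<And>n. length (cells A n) = L n"
    and "\<And>n x y u. u \<in> G A n \<Longrightarrow> (\<And>v. v \<in> G A n \<Longrightarrow> x v = y v) \<Longrightarrow>
      async_unstable A n x u = async_unstable A n y u"
    and "\<And>w n c x. parsed L w n (L n) c \<Longrightarrow> (\<And>d. d < L n \<Longrightarrow> x (cells A n ! d) = act w n d) \<Longrightarrow>
      async_unstable A n x (cells A n ! c) = \<Phi> w n (L n) c"
    and "\<And>p a b. fo p (\<lambda>w X e. L (e a) = e b)"
    and "\<And>p a b c. fo p (\<lambda>w X e. \<Phi> w (e a) (e b) (e c))"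
  shows "AsyncUnstability A \<in> NC"
proof -
  have "AsyncUnstability A = {w. \<exists>n<ubd w. \<exists>l<ubd w. \<exists>c<ubd w. parsed L w n l c \<and> \<Phi> w n l c}"
    using AsyncUnstability_iff[of A L \<Phi>, OF assms(1-4)] by blast
  moreover have "fo 0 (\<lambda>w X e. \<exists>n<ubd w. \<exists>l<ubd w. \<exists>c<ubd w. parsed L w n l c \<and> \<Phi> w n l c)"
    by (intro fo_intros fo_parsed assms(5,6))
  ultimately show ?thesis using fo_in_NC by simp
qed

section \<open>Definability of the core\<close>

text \<open>The size \<open>n\<close> is read off the word again, because the body of a fixed point
  sees only its arguments and these are taken by the two edges.\<close>

definition turn_step :: "(nat \<Rightarrow> nat) \<Rightarrow> (nat \<Rightarrow> nat \<Rightarrow> nat \<Rightarrow> bool) \<Rightarrow> bool list \<Rightarrow> nat \<Rightarrow> nat \<Rightarrow> nat \<Rightarrow> nat \<Rightarrow> bool"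
  where "turn_step L N w a b c d \<longleftrightarrow>
    (\<exists>n<ubd w. \<exists>l<ubd w. first_zero w n \<and> L n = l \<and> turn {i. i < l \<and> \<not> act w n i} (N n) a b c d)"

definition endless_arc :: "(nat \<Rightarrow> nat) \<Rightarrow> (nat \<Rightarrow> nat \<Rightarrow> nat \<Rightarrow> bool) \<Rightarrow> bool list \<Rightarrow> nat \<Rightarrow> nat \<Rightarrow> bool" where
  "endless_arc L N w a b \<longleftrightarrow>
    (\<exists>c<ubd w. \<exists>d<ubd w. \<exists>c'<ubd w. \<exists>d'<ubd w.
      ((a, b), (c, d)) \<in> (arcs_rel (turn_step L N) w)\<^sup>* \<and> turn_step L N w c d c' d' \<and>
      ((c', d'), (c, d)) \<in> (arcs_rel (turn_step L N) w)\<^sup>*)"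

text \<open>From size \<open>m\<close> on, all neighbors are distinct; below it no cell has as many
  as \<open>k1\<close> neighbors, so nothing changes. \<open>exact\<close> stands for
  \<open>k2 = k1\<close>, where \<open>u\<close> also needs an inactive neighbor at the
  start.\<close>

definition core_formula ::
    "(nat \<Rightarrow> nat) \<Rightarrow> (nat \<Rightarrow> nat \<Rightarrow> nat \<Rightarrow> bool) \<Rightarrow> nat \<Rightarrow> bool \<Rightarrow> bool list \<Rightarrow> nat \<Rightarrow> nat \<Rightarrow> nat \<Rightarrow> bool" where
  "core_formula L N m exact w n l c \<longleftrightarrow> m \<le> n \<and> \<not> act w n c \<and>
    (exact \<longrightarrow> (\<exists>d<l. N n c d \<and> \<not> act w n d)) \<and>
    \<not> (\<exists>a<ubd w. \<exists>b<ubd w. a \<noteq> b \<and> endless_arc L N w c a \<and> endless_arc L N w c b)"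

lemma fo_core_formula:
  assumes L: "\<And>p a b. fo p (\<lambda>w X e. L (e a) = e b)"
    and N: "\<And>p a b c. fo p (\<lambda>w X e. N (e a) (e b) (e c))"
  shows "fo p (\<lambda>w X e. core_formula L N m exact w (e a) (e b) (e c))"
proof -
  have step: "fo p (\<lambda>w X e. turn_step L N w (e a) (e b) (e c) (e d))" for p a b c d
    unfolding turn_step_def turn_def mem_Collect_eq by (intro fo_intros L N)
  have "fo p (\<lambda>w X e. endless_arc L N w (e a) (e b))" for p a b
    unfolding endless_arc_def by (intro fo_intros fo_reach step)
  then show ?thesis unfolding core_formula_def by (intro fo_intros N)
qed

lemma endless_arc_iff:
  assumes "first_zero w n" "L n < ubd w"
  shows "endless_arc L N w a b \<longleftrightarrow> endless (turns {i. i < L n \<and> \<not> act w n i} (N n)) (a, b)"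
proof -
  have step: "turn_step L N w a b c d \<longleftrightarrow> turn {i. i < L n \<and> \<not> act w n i} (N n) a b c d" for a b c d
  proof -
    have "first_zero w n' \<longleftrightarrow> n' = n" for n' using assms(1) first_zero_unique by blast
    then show ?thesis using assms(2) first_zero_less[OF assms(1)] by (auto simp: turn_step_def)
  qed
  have "arcs_rel (turn_step L N) w = turns {i. i < L n \<and> \<not> act w n i} (N n)"
    using assms(2) by (auto simp: arcs_rel_def turns_def step turn_def)
  note R = this
  show ?thesis
  proof
    assume "endless_arc L N w a b"
    then show "endless (turns {i. i < L n \<and> \<not> act w n i} (N n)) (a, b)"
      unfolding endless_arc_def endless_def R step by (auto simp: turns_def)
  next
    assume "endless (turns {i. i < L n \<and> \<not> act w n i} (N n)) (a, b)"
    then obtain c d c' d' where *: "((a, b), (c, d)) \<in> (arcs_rel (turn_step L N) w)\<^sup>*"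
      "turn_step L N w c d c' d'" "((c', d'), (c, d)) \<in> (arcs_rel (turn_step L N) w)\<^sup>*"
      unfolding endless_def R step by (auto simp: turns_def)
    then have "c < ubd w" "d < ubd w" "c' < ubd w" "d' < ubd w"
      using assms(2) by (auto simp: step turn_def)
    then show "endless_arc L N w a b" using * unfolding endless_arc_def by blast
  qed
qed

lemma core_cong:
  assumes "\<And>a b. a \<in> H \<Longrightarrow> b \<in> H \<Longrightarrow> N a b = N' a b"
  shows "core H N Z = core H N' Z"
proof (cases "Z \<subseteq> H")
  case True
  then have "N a b = N' a b" if "a \<in> Z" "b \<in> Z" for a b using assms that by blast
  then show ?thesis unfolding core_def by (metis (no_types, opaque_lifting))
qed (simp add: core_def)

lemma (in torus) unstable_iff_core_formula:
  assumes dist: "distinct (cells A n)" and len: "length (cells A n) = L n"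
    and N: "\<And>c d. c < L n \<Longrightarrow> d < L n \<Longrightarrow> N n c d \<longleftrightarrow> cells A n ! d \<in> nb (cells A n ! c)"
    and deg: "\<And>v. v \<in> V \<Longrightarrow> if m \<le> n then card (nb v) = Suc k1 else card (nb v) < k1"
    and k2: "k2 = k1 \<and> exact \<or> k2 = Suc k1 \<and> \<not> exact"
    and p: "parsed L w n (L n) c" and x: "\<And>d. d < L n \<Longrightarrow> x (cells A n ! d) = act w n d"
  shows "async_unstable A n x (cells A n ! c) = core_formula L N m exact w n (L n) c"
proof -
  let ?u = "cells A n ! c"
  have c: "c < L n" and fz: "first_zero w n" using p by (auto simp: parsed_def)
  have Lw: "L n < ubd w" using p length_less_ubd[of w] by (simp add: parsed_def)
  have u: "?u \<in> V" using c len by simp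
  show ?thesis
  proof (cases "m \<le> n")
    case False
    \<comment> \<open>On a small torus no cell reaches the threshold, so the initial configuration
      is already closed.\<close>
    have "closed_under V nb k1 (active x)"
      unfolding closed_under_def
    proof (intro ballI impI)
      fix v assume v: "v \<in> V" "k1 \<le> card (nb v \<inter> active x)"
      have "card (nb v \<inter> active x) \<le> card (nb v)" using finite_nb v(1) by (intro card_mono) auto
      then show "v \<in> active x" using deg[OF v(1)] False v(2) by auto
    qed
    then have "\<not> async_unstable A n x ?u"
      using unstable_iff_closure[OF u, of x] by (auto simp: active_def)
    then show ?thesis using False by (simp add: core_formula_def)
  next
    case True
    then have deg': "card (nb v) = Suc k1" if "v \<in> V" for v using deg[OF that] by simp
    let ?H = "{i. i < L n \<and> \<not> act w n i}"
    have H: "{d. d < length (cells A n) \<and> cells A n ! d \<notin> active x} = ?H"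
      using x len by (auto simp: active_def)
    have "(\<exists>Z. core (V - active x) (\<lambda>v a. a \<in> nb v) Z \<and> ?u \<in> Z) \<longleftrightarrow>
        (\<exists>Z. core ?H (\<lambda>d d'. cells A n ! d' \<in> nb (cells A n ! d)) Z \<and> c \<in> Z)"
      using core_index[OF dist, of c "active x" nb] c len unfolding H by (simp add: Diff_eq)
    also have "\<dots> \<longleftrightarrow> (\<exists>Z. core ?H (N n) Z \<and> c \<in> Z)"
    proof -
      have "core ?H (\<lambda>d d'. cells A n ! d' \<in> nb (cells A n ! d)) Z \<longleftrightarrow> core ?H (N n) Z" for Z
        by (rule core_cong) (use N in auto)
      then show ?thesis by simp
    qed
    also have "\<dots> \<longleftrightarrow> (\<exists>a b. a \<noteq> b \<and> endless (turns ?H (N n)) (c, a) \<and> endless (turns ?H (N n)) (c, b))"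
    proof (rule core_iff_endless)
      fix a b assume "a \<in> ?H" "b \<in> ?H" "N n a b"
      then show "N n b a" using N nbrs_sym len by auto
    qed simp
    also have "\<dots> \<longleftrightarrow> (\<exists>a<ubd w. \<exists>b<ubd w. a \<noteq> b \<and> endless_arc L N w c a \<and> endless_arc L N w c b)"
    proof -
      have "a < ubd w" if "endless (turns ?H (N n)) (c, a)" for a
        using that Lw by (subst (asm) endless_iff_step) (auto simp: turns_def turn_def)
      then show ?thesis unfolding endless_arc_iff[where L = L and n = n and N = N, OF fz Lw] by blast
    qed
    finally have e: "(\<exists>Z. core (V - active x) (\<lambda>v a. a \<in> nb v) Z \<and> ?u \<in> Z) \<longleftrightarrow>
        (\<exists>a<ubd w. \<exists>b<ubd w. a \<noteq> b \<and> endless_arc L N w c a \<and> endless_arc L N w c b)" .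
    have "(\<forall>C. active x \<subseteq> C \<longrightarrow> closed_under V nb k1 C \<longrightarrow> ?u \<in> C) \<longleftrightarrow>
        \<not> (\<exists>Z. core (V - active x) (\<lambda>v a. a \<in> nb v) Z \<and> ?u \<in> Z)"
      by (rule closure_iff_core[OF deg' u])
    then have cl: "(\<forall>C. active x \<subseteq> C \<longrightarrow> closed_under V nb k1 C \<longrightarrow> ?u \<in> C) \<longleftrightarrow>
        \<not> (\<exists>a<ubd w. \<exists>b<ubd w. a \<noteq> b \<and> endless_arc L N w c a \<and> endless_arc L N w c b)"
      unfolding e .
    \<comment> \<open>The degree is \<open>k1 + 1\<close>, so this bound excludes at most the case
      that all neighbors are active, and nothing if \<open>k2 = k1 + 1\<close>.\<close>
    have "card (nb ?u \<inter> active x) \<le> k2 \<longleftrightarrow> (exact \<longrightarrow> (\<exists>d<L n. N n c d \<and> \<not> act w n d))"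
    proof -
      have le: "card (nb ?u \<inter> active x) \<le> Suc k1"
        using deg'[OF u] card_mono[OF finite_nb[OF u], of "nb ?u \<inter> active x"] by auto
      have "card (nb ?u \<inter> active x) = Suc k1 \<longleftrightarrow> nb ?u \<subseteq> active x"
        using deg'[OF u] finite_nb[OF u] card_subset_eq[OF finite_nb[OF u], of "nb ?u \<inter> active x"]
        by (metis inf.absorb_iff1 inf_le1)
      also have "\<dots> \<longleftrightarrow> \<not> (\<exists>d<L n. N n c d \<and> \<not> act w n d)"
      proof -
        have "\<exists>d<L n. v = cells A n ! d" if "v \<in> nb ?u" for v
          using nbrs_G[OF u] that len by (metis in_set_conv_nth subsetD)
        then show ?thesis using N[OF c] x len by (fastforce simp: active_def)
      qed
      finally show ?thesis using le k2 by auto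
    qed
    then show ?thesis
      using unstable_iff_closure[OF u, of x] cl x[OF c] True by (simp add: core_formula_def)
  qed
qed

section \<open>The two grids\<close>

lemma nxt_iff:
  "i < n \<Longrightarrow> nxt n i k \<longleftrightarrow> k = (i + 1) mod n" "i < n \<Longrightarrow> nxt n k i \<longleftrightarrow> k = (i + n - 1) mod n"
  by (simp_all only: mod_pred mod_succ nxt_def) (auto split: if_splits)

lemma sq_nbrs_iff: "i < n \<Longrightarrow> j < n \<Longrightarrow> a \<in> sq_nbrs n (i, j) \<longleftrightarrow> neighbor n (i, j) a"
  by (cases a) (auto simp: neighbor_def adj_def nxt_iff simp del: add_is_1)

lemma neighbor_sym: "neighbor n v a \<longleftrightarrow> neighbor n a v"
  by (auto simp: neighbor_def adj_sym)

lemma G_S [simp]: "G (S k1 k2) n = {..<n} \<times> {..<n}" and nbrs_S [simp]: "nbrs (S k1 k2) = sq_nbrs"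
  by (auto simp: S_def)

lemma card_sq_nbrs_le: "card (sq_nbrs n v) \<le> 4"
proof (cases v)
  case (Pair i j)
  have "card (set [((i + 1) mod n, j), ((i + n - 1) mod n, j), (i, (j + 1) mod n), (i, (j + n - 1) mod n)]) \<le> 4"
    by (rule order_trans[OF card_length]) simp
  then show ?thesis by (simp add: Pair)
qed

text \<open>The two neighbors along each axis coincide, so at most two are left.\<close>

lemma card_sq_nbrs_small:
  assumes "n < 3" "i < n" "j < n"
  shows "card (sq_nbrs n (i, j)) < 3"
proof -
  have "(x + n - 1) mod n = (x + 1) mod n" if "x < n" for x
    using that assms(1) by (simp only: mod_pred mod_succ) auto
  then have "sq_nbrs n (i, j) = set [((i + 1) mod n, j), (i, (j + 1) mod n)]" using assms by auto
  then show ?thesis using card_length[of "[((i + 1) mod n, j), (i, (j + 1) mod n)]"] by simp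
qed

lemma torus_S: "k1 \<le> k2 \<Longrightarrow> 3 \<le> k2 \<Longrightarrow> torus (S k1 k2) n k1 k2"
proof
  assume "3 \<le> k2"
  then show "card (nbrs (S k1 k2) n u) \<le> Suc k2" for u using card_sq_nbrs_le[of n u] by simp
  show "nbrs (S k1 k2) n u \<subseteq> G (S k1 k2) n" if "u \<in> G (S k1 k2) n" for u
    by (cases u) (use that in \<open>auto simp: sq_nbrs_iff neighbor_def simp del: sq_nbrs.simps\<close>)
  show "u \<in> nbrs (S k1 k2) n v" if "u \<in> G (S k1 k2) n" "v \<in> nbrs (S k1 k2) n u" for u v
  proof -
    have "neighbor n u v" using that sq_nbrs_iff[of "fst u" n "snd u" v] by auto
    then have "neighbor n v u" using neighbor_sym by blast
    then have "neighbor n v u" "fst v < n" "snd v < n" by (simp_all add: neighbor_def)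
    then show ?thesis using sq_nbrs_iff[of "fst v" n "snd v" u] by simp
  qed
qed (auto simp: S_def)

section \<open>Numbering of the square grid, and threshold three\<close>

definition index :: "nat \<Rightarrow> nat \<Rightarrow> nat \<Rightarrow> nat \<Rightarrow> bool" where
  "index n i j c \<longleftrightarrow> i < n \<and> j < n \<and> i * n + j = c"

lemma index_exists: "c < n * n \<Longrightarrow> \<exists>i j. index n i j c"
  by (intro exI[of _ "c div n"] exI[of _ "c mod n"])
    (auto simp: index_def less_mult_imp_div_less intro!: mod_less_divisor gr0I)

lemma index_less: "index n i j c \<Longrightarrow> c < n * n"
proof -
  assume "index n i j c"
  then have "i + 1 \<le> n" "c < (i + 1) * n" by (auto simp: index_def)
  moreover have "(i + 1) * n \<le> n * n" using \<open>i + 1 \<le> n\<close> by (rule mult_le_mono1)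
  ultimately show ?thesis by linarith
qed

lemma cells_S: "index n i j c \<Longrightarrow> cells (S k1 k2) n ! c = (i, j)"
  using index_less[of n i j c] by (auto simp: S_def product_nth index_def)

lemma length_cells_S: "length (cells (S k1 k2) n) = n * n"
  by (simp add: S_def)

lemma distinct_cells_S: "distinct (cells (S k1 k2) n)"
  by (simp add: S_def distinct_product)

definition sq_adj :: "nat \<Rightarrow> nat \<Rightarrow> nat \<Rightarrow> bool" where
  "sq_adj n c d \<longleftrightarrow> (\<exists>i<n. \<exists>j<n. \<exists>i'<n. \<exists>j'<n. index n i j c \<and> index n i' j' d \<and>
    (adj n i i' \<and> j' = j \<or> i' = i \<and> adj n j j'))"

lemma sq_adj_iff:
  assumes "c < n * n" "d < n * n"
  shows "sq_adj n c d \<longleftrightarrow> cells (S k1 k2) n ! d \<in> nbrs (S k1 k2) n (cells (S k1 k2) n ! c)"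
proof -
  obtain i j i' j' where ij: "index n i j c" "index n i' j' d" using assms index_exists by meson
  have less: "i < n" "j < n" "i' < n" "j' < n" using ij by (auto simp: index_def)
  have "index n x y c \<longleftrightarrow> x = i \<and> y = j" "index n x y d \<longleftrightarrow> x = i' \<and> y = j'" for x y
    using cells_S[of n x y c k1 k2] cells_S[of n x y d k1 k2] cells_S[OF ij(1)] cells_S[OF ij(2)] ij by auto
  then show ?thesis
    using less by (auto simp: sq_adj_def cells_S[OF ij(1)] cells_S[OF ij(2)] sq_nbrs_iff neighbor_def
        simp del: sq_nbrs.simps)
qed

lemma fo_nxt [fo_intros]: "fo p (\<lambda>w X e. nxt (e n) (e a) (e b))"
  unfolding nxt_def by (intro fo_intros)

lemma fo_adj [fo_intros]: "fo p (\<lambda>w X e. adj (e n) (e a) (e b))"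
  unfolding adj_def by (intro fo_intros)

lemma fo_index [fo_intros]: "fo p (\<lambda>w X e. index (e n) (e i) (e j) (e c))"
proof (rule fo_cong)
  show "fo p (\<lambda>w X e. e i < e n \<and> e j < e n \<and> (\<exists>m<ubd w. e i * e n = m \<and> m + e j = e c))"
    by (intro fo_intros fo_mult)
next
  fix w :: "bool list" and e :: "nat \<Rightarrow> nat"
  assume "\<And>v. e v < ubd w"
  then have "e c < ubd w" .
  then show "(e i < e n \<and> e j < e n \<and> (\<exists>m<ubd w. e i * e n = m \<and> m + e j = e c)) =
      index (e n) (e i) (e j) (e c)"
    by (auto simp: index_def)
qed

lemma fo_sq_adj [fo_intros]: "fo p (\<lambda>w X e. sq_adj (e n) (e c) (e d))"
  unfolding sq_adj_def by (intro fo_intros)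

lemma fo_square: "fo p (\<lambda>w X e. e a * e a = e b)"
  by (rule fo_mult)

lemma S3_in_NC:
  assumes "k2 = 3 \<and> exact \<or> k2 = 4 \<and> \<not> exact"
  shows "AsyncUnstability (S 3 k2) \<in> NC"
proof -
  interpret torus "S 3 k2" n 3 k2 for n using assms by (intro torus_S) auto
  show ?thesis
  proof (rule AsyncUnstability_in_NC[where L = "\<lambda>n. n * n" and
        \<Phi> = "core_formula (\<lambda>n. n * n) sq_adj 3 exact"])
    fix w n c and x :: "nat \<times> nat \<Rightarrow> bool"
    assume "parsed (\<lambda>n. n * n) w n (n * n) c" "\<And>d. d < n * n \<Longrightarrow> x (cells (S 3 k2) n ! d) = act w n d"
    then show "async_unstable (S 3 k2) n x (cells (S 3 k2) n ! c) =
        core_formula (\<lambda>n. n * n) sq_adj 3 exact w n (n * n) c"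
      using assms
      by (intro unstable_iff_core_formula distinct_cells_S length_cells_S sq_adj_iff)
        (auto simp: card_sq_nbrs card_sq_nbrs_small not_le simp del: sq_nbrs.simps)
  next
    fix n u and x y :: "nat \<times> nat \<Rightarrow> bool"
    assume "u \<in> G (S 3 k2) n" "\<And>v. v \<in> G (S 3 k2) n \<Longrightarrow> x v = y v"
    then show "async_unstable (S 3 k2) n x u = async_unstable (S 3 k2) n y u" by (rule unstable_cong)
  qed (intro distinct_cells_S length_cells_S fo_square fo_core_formula fo_sq_adj)+
qed

section \<open>Definability of the merging of rectangles, and threshold two\<close>

lemma fo_arc [fo_intros]: "fo p (\<lambda>w X e. e x \<in> arc (e n) (e s) (e t))"
  unfolding arc_def mem_Collect_eq by (intro fo_intros)

text \<open>The set equation of \<open>merge\<close> in one coordinate, spelled out over the points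
  of the cycle.\<close>

definition arc_merge :: "nat \<Rightarrow> nat \<Rightarrow> nat \<Rightarrow> nat \<Rightarrow> nat \<Rightarrow> nat \<Rightarrow> nat \<Rightarrow> nat \<Rightarrow> bool" where
  "arc_merge n s e v a b c d \<longleftrightarrow>
    (\<forall>x<n. x \<in> arc n s e \<longleftrightarrow> (x = v \<or> x \<in> arc n a b \<or> x \<in> arc n c d) \<or>
      (\<exists>y<n. \<exists>z<n. (y = v \<or> y \<in> arc n a b \<or> y \<in> arc n c d) \<and> (z = v \<or> z \<in> arc n a b \<or> z \<in> arc n c d) \<and>
        y \<noteq> z \<and> adj n x y \<and> adj n x z))"

lemma arc_merge_iff:
  assumes "v < n"
  shows "arc_merge n s e v a b c d \<longleftrightarrow> arc n s e = fill n (insert v (arc n a b \<union> arc n c d))"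
proof -
  have "fill n (insert v (arc n a b \<union> arc n c d)) \<subseteq> {..<n}"
    using assms arc_subset adj_less by (auto simp: fill_def)
  then have "arc n s e = fill n (insert v (arc n a b \<union> arc n c d)) \<longleftrightarrow>
      (\<forall>x<n. x \<in> arc n s e \<longleftrightarrow> x \<in> fill n (insert v (arc n a b \<union> arc n c d)))"
    using arc_subset[of n s e] by blast
  moreover have "x \<in> fill n K \<longleftrightarrow> x \<in> K \<or> (\<exists>y<n. \<exists>z<n. y \<in> K \<and> z \<in> K \<and> y \<noteq> z \<and> adj n x y \<and> adj n x z)" for x K
    unfolding fill_def using adj_less by blast
  then have "x \<in> fill n (insert v (arc n a b \<union> arc n c d)) \<longleftrightarrow>
      (x = v \<or> x \<in> arc n a b \<or> x \<in> arc n c d) \<or>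
      (\<exists>y<n. \<exists>z<n. (y = v \<or> y \<in> arc n a b \<or> y \<in> arc n c d) \<and> (z = v \<or> z \<in> arc n a b \<or> z \<in> arc n c d) \<and>
        y \<noteq> z \<and> adj n x y \<and> adj n x z)" for x
    by simp
  ultimately show ?thesis unfolding arc_merge_def by presburger
qed

lemma fo_arc_merge [fo_intros]:
  "fo p (\<lambda>w X e. arc_merge (e n) (e s) (e t) (e v) (e a) (e b) (e c) (e d))"
  unfolding arc_merge_def by (intro fo_intros)

definition active_cells :: "bool list \<Rightarrow> nat \<Rightarrow> (nat \<times> nat) set" where
  "active_cells w n = {(i, j). i < n \<and> j < n \<and> act w n (i * n + j)}"

definition start_rect :: "bool list \<Rightarrow> quad \<Rightarrow> bool" where
  "start_rect w r \<longleftrightarrow> (\<exists>n. first_zero w n \<and> single n (active_cells w n) r)"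

definition merge_rect :: "bool list \<Rightarrow> quad \<Rightarrow> quad \<Rightarrow> quad \<Rightarrow> bool" where
  "merge_rect w r p q \<longleftrightarrow> (\<exists>n. first_zero w n \<and> merge n r p q)"

lemma fo_start_rect: "fo p (\<lambda>w X e. start_rect w (e a, e b, e c, e d))"
proof (rule fo_cong)
  show "fo p (\<lambda>w X e. \<exists>n<ubd w. first_zero w n \<and> e a < n \<and> e c < n \<and> e b = e a \<and> e d = e c \<and>
      (\<exists>k<ubd w. index n (e a) (e c) k \<and> act w n k))"
    by (intro fo_intros)
next
  fix w :: "bool list" and e :: "nat \<Rightarrow> nat"
  have "k < ubd w" if "act w n k" for n k using that length_less_ubd[of w] by (simp add: act_def)
  then have "(\<exists>k<ubd w. index n i j k \<and> act w n k) \<longleftrightarrow> i < n \<and> j < n \<and> act w n (i * n + j)" for n i j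
    by (auto simp: index_def)
  then show "(\<exists>n<ubd w. first_zero w n \<and> e a < n \<and> e c < n \<and> e b = e a \<and> e d = e c \<and>
      (\<exists>k<ubd w. index n (e a) (e c) k \<and> act w n k)) = start_rect w (e a, e b, e c, e d)"
    using first_zero_less[of w] by (simp add: start_rect_def single_def active_cells_def) blast
qed

lemma neighbor_less: "neighbor n (v, v') (a, a') \<Longrightarrow> v < n \<and> v' < n \<and> a < n \<and> a' < n"
  by (simp add: neighbor_def)

lemma fo_neighbor [fo_intros]: "fo p (\<lambda>w X e. neighbor (e n) (e a, e b) (e c, e d))"
  unfolding neighbor_def fst_conv snd_conv by (intro fo_intros)

text \<open>\<open>neighbor\<close> forces all witnesses below \<open>n\<close>, so the unbounded
  quantifiers of \<open>merge\<close> become bounded.\<close>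

lemma merge_iff:
  "merge n (s, e, s', e') (ps, pe, ps', pe') (qs, qe, qs', qe') \<longleftrightarrow>
    (s < n \<and> e < n \<and> s' < n \<and> e' < n) \<and> (ps < n \<and> pe < n \<and> ps' < n \<and> pe' < n) \<and>
    (qs < n \<and> qe < n \<and> qs' < n \<and> qe' < n) \<and>
    (\<exists>v<n. \<exists>v'<n. \<exists>a<n. \<exists>a'<n. \<exists>b<n. \<exists>b'<n.
      neighbor n (v, v') (a, a') \<and> neighbor n (v, v') (b, b') \<and> \<not> (a = b \<and> a' = b') \<and>
      a \<in> arc n ps pe \<and> a' \<in> arc n ps' pe' \<and> b \<in> arc n qs qe \<and> b' \<in> arc n qs' qe' \<and>
      arc_merge n s e v ps pe qs qe \<and> arc_merge n s' e' v' ps' pe' qs' qe')"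
proof -
  have "neighbor n (v, v') (a, a') \<and> neighbor n (v, v') (b, b') \<and> (a, a') \<noteq> (b, b') \<and>
      (a, a') \<in> arc n ps pe \<times> arc n ps' pe' \<and> (b, b') \<in> arc n qs qe \<times> arc n qs' qe' \<and>
      arc n s e = fill n (insert v (arc n ps pe \<union> arc n qs qe)) \<and>
      arc n s' e' = fill n (insert v' (arc n ps' pe' \<union> arc n qs' qe')) \<longleftrightarrow>
    v < n \<and> v' < n \<and> a < n \<and> a' < n \<and> b < n \<and> b' < n \<and>
      neighbor n (v, v') (a, a') \<and> neighbor n (v, v') (b, b') \<and> \<not> (a = b \<and> a' = b') \<and>
      a \<in> arc n ps pe \<and> a' \<in> arc n ps' pe' \<and> b \<in> arc n qs qe \<and> b' \<in> arc n qs' qe' \<and>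
      arc_merge n s e v ps pe qs qe \<and> arc_merge n s' e' v' ps' pe' qs' qe'" for v v' a a' b b'
  proof (cases "neighbor n (v, v') (a, a') \<and> neighbor n (v, v') (b, b')")
    case True
    then have "v < n" "v' < n" "a < n" "a' < n" "b < n" "b' < n" using neighbor_less by blast+
    then show ?thesis using True by (simp add: arc_merge_iff)
  next
    case False
    then show ?thesis by blast
  qed
  note key = this
  show ?thesis unfolding merge_def prod.case valid.simps rect.simps key by (intro conj_cong refl) simp
qed

lemma fo_merge_rect:
  "fo p (\<lambda>w X e. merge_rect w (e a, e b, e c, e d) (e a', e b', e c', e d') (e a'', e b'', e c'', e d''))"
proof (rule fo_cong)
  show "fo p (\<lambda>w X e. \<exists>n<ubd w. first_zero w n \<and>
      merge n (e a, e b, e c, e d) (e a', e b', e c', e d') (e a'', e b'', e c'', e d''))"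
    unfolding merge_iff by (intro fo_intros)
qed (use first_zero_less in \<open>auto simp: merge_rect_def\<close>)

text \<open>For \<open>n < 2\<close> there is at most one cell and hence never two active neighbors.
  \<open>bounded\<close> stands for \<open>k2 = 3\<close>: with four distinct neighbors it requires
  an inactive one, while for \<open>n = 2\<close> a cell has fewer than three neighbors and the
  bound always holds.\<close>

definition rect_formula :: "bool \<Rightarrow> bool list \<Rightarrow> nat \<Rightarrow> nat \<Rightarrow> nat \<Rightarrow> bool" where
  "rect_formula bounded w n l c \<longleftrightarrow> 2 \<le> n \<and> \<not> act w n c \<and>
    (bounded \<longrightarrow> n = 2 \<or> (\<exists>d<l. sq_adj n c d \<and> \<not> act w n d)) \<and>
    (\<exists>i<n. \<exists>j<n. index n i j c \<and> (\<exists>s<n. \<exists>e<n. \<exists>s'<n. \<exists>e'<n.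
      derivable start_rect merge_rect w (s, e, s', e') \<and> i \<in> arc n s e \<and> j \<in> arc n s' e'))"

lemma fo_rect_formula: "fo p (\<lambda>w X e. rect_formula bounded w (e a) (e b) (e c))"
  unfolding rect_formula_def by (intro fo_intros fo_derivable fo_start_rect fo_merge_rect)

lemma closed_iff_stable:
  assumes "2 \<le> n"
  shows "closed_under ({..<n} \<times> {..<n}) (sq_nbrs n) 2 C \<longleftrightarrow> stable n C"
proof -
  have "2 \<le> card (sq_nbrs n v \<inter> C) \<longleftrightarrow> (\<exists>a b. neighbor n v a \<and> neighbor n v b \<and> a \<noteq> b \<and> a \<in> C \<and> b \<in> C)"
    if "v \<in> {..<n} \<times> {..<n}" for v
  proof -
    have fin: "finite (sq_nbrs n v \<inter> C)" by (cases v) auto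
    have "2 \<le> card (sq_nbrs n v \<inter> C) \<longleftrightarrow> \<not> card (sq_nbrs n v \<inter> C) \<le> Suc 0" by auto
    also have "\<dots> \<longleftrightarrow> (\<exists>a b. a \<in> sq_nbrs n v \<and> b \<in> sq_nbrs n v \<and> a \<noteq> b \<and> a \<in> C \<and> b \<in> C)"
      unfolding card_le_Suc0_iff_eq[OF fin] by blast
    finally show ?thesis using that by (cases v) (simp add: sq_nbrs_iff del: sq_nbrs.simps)
  qed
  then have "closed_under ({..<n} \<times> {..<n}) (sq_nbrs n) 2 C \<longleftrightarrow> (\<forall>v\<in>{..<n} \<times> {..<n}.
      (\<exists>a b. neighbor n v a \<and> neighbor n v b \<and> a \<noteq> b \<and> a \<in> C \<and> b \<in> C) \<longrightarrow> v \<in> C)"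
    unfolding closed_under_def by (intro ball_cong) auto
  moreover have "v \<in> {..<n} \<times> {..<n}" if "neighbor n v a" for v a
    using that by (cases v) (simp add: neighbor_def)
  ultimately show ?thesis unfolding stable_def by blast
qed

text \<open>Stable sets are closed under merging. Conversely, a derivation from
  \<open>rect_complete\<close> has at most one leaf per active cell, hence at most
  \<open>n * n\<close> leaves, few enough for the pebble game.\<close>

lemma derivable_rect_iff:
  assumes fz: "first_zero w n" and n: "2 \<le> n" "n * n < ubd w"
  shows "(\<exists>r. derivable start_rect merge_rect w r \<and> valid n r \<and> u \<in> rect n r) \<longleftrightarrow>
    (\<forall>C. active_cells w n \<subseteq> C \<longrightarrow> stable n C \<longrightarrow> u \<in> C)"
proof -
  have fz': "first_zero w n' \<longleftrightarrow> n' = n" for n' using fz first_zero_unique by blast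
  have start: "start_rect w = single n (active_cells w n)" and mrg: "merge_rect w = merge n"
    by (auto simp: fun_eq_iff start_rect_def merge_rect_def fz')
  have X: "active_cells w n \<subseteq> {..<n} \<times> {..<n}" by (auto simp: active_cells_def)
  then have fin: "finite (active_cells w n)" by (rule finite_subset) simp
  have nw: "n < ubd w" using fz by (rule first_zero_less)
  show ?thesis
  proof safe
    fix r C
    assume r: "derivable start_rect merge_rect w r" "valid n r" "u \<in> rect n r"
      and C: "active_cells w n \<subseteq> C" "stable n C"
    \<comment> \<open>Guarded by \<open>valid\<close>, the invariant holds vacuously for the trivial
      fact, whose entries exceed \<open>n\<close>.\<close>
    have "valid n r \<longrightarrow> rect n r \<subseteq> C"
    proof (rule derivable_sound[OF r(1), where val = "\<lambda>r. valid n r \<longrightarrow> rect n r \<subseteq> C"])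
      show "valid n (trivial w) \<longrightarrow> rect n (trivial w) \<subseteq> C" using fz by (simp add: first_zero_def)
      show "valid n c \<longrightarrow> rect n c \<subseteq> C" if "start_rect w c" for c
      proof -
        have "arc n s s = {s}" if "s < n" for s using that by (auto simp: arc_def)
        then show ?thesis using that C(1) by (cases c) (auto simp: start single_def)
      qed
      show "valid n c \<longrightarrow> rect n c \<subseteq> C"
        if "merge_rect w c p q" "valid n p \<longrightarrow> rect n p \<subseteq> C" "valid n q \<longrightarrow> rect n q \<subseteq> C" for c p q
        using that merge_sound[OF n(1) C(2), of c p q] by (auto simp: mrg merge_def)
    qed
    then show "u \<in> C" using r by blast
  next
    assume u: "\<forall>C. active_cells w n \<subseteq> C \<longrightarrow> stable n C \<longrightarrow> u \<in> C"
    have "{..<n} \<times> {..<n} \<times> {..<n} \<times> {..<n} \<subseteq> quads w" using nw by (auto simp: quads_def)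
    from rect_complete[OF n(1) fin X this, of u] u
    obtain r m where r: "derivation.der (quads w) (single n (active_cells w n)) (merge n) r m"
      "valid n r" "u \<in> rect n r" "m \<le> card (active_cells w n)" by blast
    have "card (active_cells w n) \<le> card ({..<n} \<times> {..<n})" using X by (intro card_mono) auto
    then have "m \<le> ubd w" using r(4) n(2) by (simp add: card_cartesian_product)
    then have "derivable start_rect merge_rect w r"
      using r(1) by (intro derivable_complete[of _ _ _ _ m]) (simp_all add: start mrg)
    then show "\<exists>r. derivable start_rect merge_rect w r \<and> valid n r \<and> u \<in> rect n r" using r by blast
  qed
qed

lemma S2_in_NC:
  assumes "k2 = 3 \<and> bounded \<or> k2 = 4 \<and> \<not> bounded"
  shows "AsyncUnstability (S 2 k2) \<in> NC"
proof -
  interpret torus "S 2 k2" n 2 k2 for n using assms by (intro torus_S) auto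
  show ?thesis
  proof (rule AsyncUnstability_in_NC[where L = "\<lambda>n. n * n" and \<Phi> = "rect_formula bounded"])
    fix w n c and x :: "nat \<times> nat \<Rightarrow> bool"
    assume p: "parsed (\<lambda>n. n * n) w n (n * n) c"
      and x: "\<And>d. d < n * n \<Longrightarrow> x (cells (S 2 k2) n ! d) = act w n d"
    have fz: "first_zero w n" and c: "c < n * n" and lw: "n * n < ubd w"
      using p length_less_ubd[of w] by (auto simp: parsed_def)
    obtain i j where ij: "index n i j c" using index_exists[OF c] by blast
    then have ijn: "i < n" "j < n" by (auto simp: index_def)
    have u: "cells (S 2 k2) n ! c = (i, j)" using cells_S[OF ij] .
    have V: "(i, j) \<in> G (S 2 k2) n" using ijn by simp
    have X: "active n x = active_cells w n"
    proof -
      have "x (i, j) = act w n (i * n + j)" if "i < n" "j < n" for i j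
      proof -
        have ix: "index n i j (i * n + j)" using that by (simp add: index_def)
        show ?thesis using x[OF index_less[OF ix]] cells_S[OF ix] by simp
      qed
      then show ?thesis by (auto simp: active_def active_cells_def)
    qed
    show "async_unstable (S 2 k2) n x (cells (S 2 k2) n ! c) = rect_formula bounded w n (n * n) c"
    proof (cases "2 \<le> n")
      case False
      have "closed_under (G (S 2 k2) n) (nbrs (S 2 k2) n) 2 (active n x)"
        unfolding closed_under_def
      proof (intro ballI impI)
        fix v assume v: "v \<in> G (S 2 k2) n" "2 \<le> card (nbrs (S 2 k2) n v \<inter> active n x)"
        have "card (nbrs (S 2 k2) n v \<inter> active n x) \<le> card (G (S 2 k2) n)"
          using nbrs_G[OF v(1)] by (intro card_mono) auto
        also have "\<dots> \<le> 1" using False by (cases n) (auto simp: card_cartesian_product)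
        finally show "v \<in> active n x" using v(2) by simp
      qed
      then have "\<not> async_unstable (S 2 k2) n x (i, j)"
        using unstable_iff_closure[OF V, of x] by (auto simp: active_def)
      then show ?thesis using False u by (simp add: rect_formula_def)
    next
      case True
      have idx: "index n i' j' c \<longleftrightarrow> i' = i \<and> j' = j" for i' j'
        using cells_S[of n i' j' c 2 k2] u ij by auto
      have "(\<forall>C. active n x \<subseteq> C \<longrightarrow> closed_under (G (S 2 k2) n) (nbrs (S 2 k2) n) 2 C \<longrightarrow> (i, j) \<in> C) \<longleftrightarrow>
          (\<exists>r. derivable start_rect merge_rect w r \<and> valid n r \<and> (i, j) \<in> rect n r)"
        unfolding X derivable_rect_iff[OF fz True lw] by (simp add: closed_iff_stable[OF True])
      also have "\<dots> \<longleftrightarrow> (\<exists>i<n. \<exists>j<n. index n i j c \<and> (\<exists>s<n. \<exists>e<n. \<exists>s'<n. \<exists>e'<n.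
          derivable start_rect merge_rect w (s, e, s', e') \<and> i \<in> arc n s e \<and> j \<in> arc n s' e'))"
        unfolding idx using ijn by auto
      finally have cl: "(\<forall>C. active n x \<subseteq> C \<longrightarrow> closed_under (G (S 2 k2) n) (nbrs (S 2 k2) n) 2 C \<longrightarrow> (i, j) \<in> C) \<longleftrightarrow>
          (\<exists>i<n. \<exists>j<n. index n i j c \<and> (\<exists>s<n. \<exists>e<n. \<exists>s'<n. \<exists>e'<n.
          derivable start_rect merge_rect w (s, e, s', e') \<and> i \<in> arc n s e \<and> j \<in> arc n s' e'))" .
      have "card (nbrs (S 2 k2) n (i, j) \<inter> active n x) \<le> k2 \<longleftrightarrow>
          (bounded \<longrightarrow> n = 2 \<or> (\<exists>d<n * n. sq_adj n c d \<and> \<not> act w n d))"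
      proof -
        let ?B = "nbrs (S 2 k2) n (i, j)"
        have le: "card (?B \<inter> active n x) \<le> card ?B" using finite_nb[OF V] by (intro card_mono) auto
        have full: "card (?B \<inter> active n x) = card ?B \<longleftrightarrow> ?B \<subseteq> active n x"
          using finite_nb[OF V] card_subset_eq[OF finite_nb[OF V], of "?B \<inter> active n x"]
          by (metis inf.absorb_iff1 inf_le1)
        have sub: "?B \<subseteq> active n x \<longleftrightarrow> \<not> (\<exists>d<n * n. sq_adj n c d \<and> \<not> act w n d)"
        proof -
          have "\<exists>d<n * n. v = cells (S 2 k2) n ! d" if "v \<in> ?B" for v
            using nbrs_G[OF V] that length_cells_S[of 2 k2 n] by (metis in_set_conv_nth subsetD)
          then have "?B \<subseteq> active n x \<longleftrightarrow> (\<forall>d<n * n. cells (S 2 k2) n ! d \<in> ?B \<longrightarrow> cells (S 2 k2) n ! d \<in> active n x)"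
            by blast
          moreover have "cells (S 2 k2) n ! d \<in> active n x \<longleftrightarrow> act w n d" if "d < n * n" for d
            using that x[OF that] length_cells_S[of 2 k2 n] nth_mem[of d "cells (S 2 k2) n"]
            unfolding active_def by simp
          moreover have "cells (S 2 k2) n ! d \<in> ?B \<longleftrightarrow> sq_adj n c d" if "d < n * n" for d
            using sq_adj_iff[OF c that, of 2 k2] unfolding u by simp
          ultimately show ?thesis by blast
        qed
        show ?thesis
        proof (cases "n = 2")
          case True
          then show ?thesis using card_sq_nbrs_small[of n i j] ijn le assms by auto
        next
          case False
          then have "card ?B = 4" using card_sq_nbrs[of n i j] ijn \<open>2 \<le> n\<close> by (simp del: sq_nbrs.simps)
          then show ?thesis using le full sub False assms by auto
        qed
      qed
      then show ?thesis
        using unstable_iff_closure[OF V, of x] cl x[OF c] True u by (simp add: rect_formula_def)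
    qed
  next
    fix n u and x y :: "nat \<times> nat \<Rightarrow> bool"
    assume "u \<in> G (S 2 k2) n" "\<And>v. v \<in> G (S 2 k2) n \<Longrightarrow> x v = y v"
    then show "async_unstable (S 2 k2) n x u = async_unstable (S 2 k2) n y u" by (rule unstable_cong)
  qed (intro distinct_cells_S length_cells_S fo_square fo_rect_formula)+
qed

section \<open>The triangular grid\<close>

definition up_down :: "nat \<Rightarrow> nat \<times> nat \<Rightarrow> nat \<times> nat \<Rightarrow> bool" where
  "up_down n a b \<longleftrightarrow> fst a < n \<and> snd a < n \<and> fst b < n \<and> snd b < n \<and>
    (b = a \<or> nxt n (fst b) (fst a) \<and> snd b = snd a \<or> fst b = fst a \<and> nxt n (snd b) (snd a))"

text \<open>In \<open>up_down n a b\<close>, the triangle at \<open>a\<close> has flag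
  \<open>False\<close> and the one at \<open>b\<close> has flag \<open>True\<close>. This one
  relation describes adjacency from both sides and so yields its symmetry.\<close>

lemma tri_nbrs_iff:
  assumes "i < n" "j < n"
  shows "(i', j', b') \<in> tri_nbrs n (i, j, b) \<longleftrightarrow>
    (if b then \<not> b' \<and> up_down n (i', j') (i, j) else b' \<and> up_down n (i, j) (i', j'))"
proof (cases b)
  case True
  then show ?thesis using assms by (auto simp: up_down_def nxt_iff)
next
  case False
  then show ?thesis using assms by (auto simp: up_down_def nxt_iff)
qed

lemma G_T [simp]: "G (T k1 k2) n = {..<n} \<times> {..<n} \<times> UNIV" and nbrs_T [simp]: "nbrs (T k1 k2) = tri_nbrs"
  by (auto simp: T_def)

lemma card_tri_nbrs_le: "card (tri_nbrs n v) \<le> 3"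
proof (cases v)
  case (fields i j b)
  have "card (set [x, y, z]) \<le> 3" for x y z :: "nat \<times> nat \<times> bool"
    by (rule order_trans[OF card_length]) simp
  then show ?thesis by (cases b) (simp_all add: fields)
qed

lemma torus_T:
  assumes "k1 \<le> k2" "2 \<le> k2"
  shows "torus (T k1 k2) n k1 k2"
proof
  show "card (nbrs (T k1 k2) n u) \<le> Suc k2" for u using card_tri_nbrs_le[of n u] assms by simp
  have iff: "v \<in> nbrs (T k1 k2) n u \<longleftrightarrow> (if snd (snd u)
      then \<not> snd (snd v) \<and> up_down n (fst v, fst (snd v)) (fst u, fst (snd u))
      else snd (snd v) \<and> up_down n (fst u, fst (snd u)) (fst v, fst (snd v)))"
    if "u \<in> G (T k1 k2) n" for u v
    using that tri_nbrs_iff[of "fst u" n "fst (snd u)" "fst v" "fst (snd v)" "snd (snd v)" "snd (snd u)"]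
    by (auto simp del: tri_nbrs.simps)
  show sub: "nbrs (T k1 k2) n u \<subseteq> G (T k1 k2) n" if "u \<in> G (T k1 k2) n" for u
  proof
    fix v assume "v \<in> nbrs (T k1 k2) n u"
    then have "fst v < n" "fst (snd v) < n" unfolding iff[OF that] by (auto simp: up_down_def split: if_splits)
    then show "v \<in> G (T k1 k2) n" by (cases v) simp
  qed
  show "u \<in> nbrs (T k1 k2) n v" if "u \<in> G (T k1 k2) n" "v \<in> nbrs (T k1 k2) n u" for u v
  proof -
    have v: "v \<in> G (T k1 k2) n" using sub[OF that(1)] that(2) by blast
    show ?thesis using that(2) unfolding iff[OF that(1)] iff[OF v] by (auto split: if_splits)
  qed
qed (use assms in \<open>auto simp: T_def\<close>)

text \<open>In the cell list the flag varies fastest and \<open>False\<close> comes first, so parity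
  tells the two kinds of triangles apart.\<close>

definition tri_index :: "nat \<Rightarrow> nat \<Rightarrow> nat \<Rightarrow> bool \<Rightarrow> nat \<Rightarrow> bool" where
  "tri_index n i j b c \<longleftrightarrow> i < n \<and> j < n \<and> 2 * (i * n + j) + of_bool b = c"

lemma tri_index_exists: "c < 2 * (n * n) \<Longrightarrow> \<exists>i j b. tri_index n i j b c"
proof -
  assume "c < 2 * (n * n)"
  then have "c div 2 < n * n" by linarith
  then obtain i j where "index n i j (c div 2)" using index_exists by blast
  then have "tri_index n i j (odd c) c" by (cases "odd c") (auto simp: index_def tri_index_def)
  then show ?thesis by blast
qed

lemma cells_T: "tri_index n i j b c \<Longrightarrow> cells (T k1 k2) n ! c = (i, j, b)"
proof -
  assume c: "tri_index n i j b c"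
  then have less: "i * n + j < n * n" "i < n" "j < n" and c': "c = 2 * (i * n + j) + of_bool b"
    using index_less[of n i j "i * n + j"] by (auto simp: tri_index_def index_def)
  have e: "c = i * (n * 2) + (2 * j + of_bool b)" by (simp add: c' algebra_simps)
  have lt: "2 * j + of_bool b < n * 2" using less by (cases b) auto
  have "c < n * (n * 2)" using less(1) by (cases b) (auto simp: c')
  moreover have "c div (n * 2) = i" "c mod (n * 2) = 2 * j + of_bool b" using lt by (simp_all add: e)
  moreover have "(2 * j + of_bool b) div 2 = j" "(2 * j + of_bool b) mod 2 = of_bool b" by (cases b; simp)+
  moreover define ys where "ys = List.product [0..<n] [False, True]"
  have len: "length ys = n * 2" by (simp add: ys_def)
  have "ys ! (2 * j + of_bool b) =
      ([0..<n] ! ((2 * j + of_bool b) div 2), [False, True] ! ((2 * j + of_bool b) mod 2))"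
    using product_nth[of "2 * j + of_bool b" "[0..<n]" "[False, True]"] lt by (simp add: ys_def numeral_2_eq_2)
  then have "ys ! (2 * j + of_bool b) = (j, b)" using less by (cases b) simp_all
  moreover have "c < length [0..<n] * length ys \<Longrightarrow> cells (T k1 k2) n ! c = ([0..<n] ! (c div length ys), ys ! (c mod length ys))"
    unfolding T_def life_like.simps ys_def by (rule product_nth)
  ultimately show ?thesis using less by (simp add: len)
qed

lemma length_cells_T: "length (cells (T k1 k2) n) = 2 * (n * n)"
  by (simp add: T_def)

lemma distinct_cells_T: "distinct (cells (T k1 k2) n)"
  by (simp add: T_def distinct_product)

definition tri_up :: "nat \<Rightarrow> nat \<Rightarrow> nat \<Rightarrow> bool" where
  "tri_up n c d \<longleftrightarrow> (\<exists>i<n. \<exists>j<n. \<exists>i'<n. \<exists>j'<n. tri_index n i j False c \<and> tri_index n i' j' True d \<and>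
    (i' = i \<and> j' = j \<or> nxt n i' i \<and> j' = j \<or> i' = i \<and> nxt n j' j))"

definition tri_adj :: "nat \<Rightarrow> nat \<Rightarrow> nat \<Rightarrow> bool" where
  "tri_adj n c d \<longleftrightarrow> tri_up n c d \<or> tri_up n d c"

lemma tri_adj_iff:
  assumes "c < 2 * (n * n)" "d < 2 * (n * n)"
  shows "tri_adj n c d \<longleftrightarrow> cells (T k1 k2) n ! d \<in> nbrs (T k1 k2) n (cells (T k1 k2) n ! c)"
proof -
  obtain i j b i' j' b' where ij: "tri_index n i j b c" "tri_index n i' j' b' d"
    using assms tri_index_exists by meson
  have less: "i < n" "j < n" "i' < n" "j' < n" using ij by (auto simp: tri_index_def)
  have idx: "tri_index n x y z c \<longleftrightarrow> x = i \<and> y = j \<and> z = b" "tri_index n x y z d \<longleftrightarrow> x = i' \<and> y = j' \<and> z = b'" for x y z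
    using cells_T[of n x y z c k1 k2] cells_T[of n x y z d k1 k2] cells_T[OF ij(1)] cells_T[OF ij(2)] ij by auto
  have "tri_up n c d \<longleftrightarrow> \<not> b \<and> b' \<and> up_down n (i, j) (i', j')"
    "tri_up n d c \<longleftrightarrow> b \<and> \<not> b' \<and> up_down n (i', j') (i, j)"
    using less by (auto simp: tri_up_def up_down_def idx)
  moreover have "cells (T k1 k2) n ! d \<in> nbrs (T k1 k2) n (cells (T k1 k2) n ! c) \<longleftrightarrow>
      (if b then \<not> b' \<and> up_down n (i', j') (i, j) else b' \<and> up_down n (i, j) (i', j'))"
    unfolding cells_T[OF ij(1)] cells_T[OF ij(2)] nbrs_T by (rule tri_nbrs_iff) (use less in auto)
  ultimately show ?thesis by (auto simp: tri_adj_def)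
qed

lemma fo_tri_index [fo_intros]: "fo p (\<lambda>w X e. tri_index (e n) (e i) (e j) b (e c))"
proof (rule fo_cong)
  show "fo p (\<lambda>w X e. \<exists>r<ubd w. \<exists>z<ubd w. index (e n) (e i) (e j) r \<and> r + r = z \<and>
      (if b then Suc z = e c else z = e c))"
    by (intro fo_intros)
next
  fix w :: "bool list" and e :: "nat \<Rightarrow> nat"
  assume "\<And>v. e v < ubd w"
  then have "e c < ubd w" .
  then show "(\<exists>r<ubd w. \<exists>z<ubd w. index (e n) (e i) (e j) r \<and> r + r = z \<and>
      (if b then Suc z = e c else z = e c)) = tri_index (e n) (e i) (e j) b (e c)"
    by (auto simp: index_def tri_index_def)
qed

lemma fo_tri_adj: "fo p (\<lambda>w X e. tri_adj (e n) (e c) (e d))"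
  unfolding tri_adj_def tri_up_def by (intro fo_intros)

lemma fo_double_square: "fo p (\<lambda>w X e. 2 * (e a * e a) = e b)"
proof (rule fo_cong)
  show "fo p (\<lambda>w X e. \<exists>m<ubd w. e a * e a = m \<and> m + m = e b)"
    by (intro fo_intros fo_mult)
next
  fix w :: "bool list" and e :: "nat \<Rightarrow> nat"
  assume "\<And>v. e v < ubd w"
  then have "e b < ubd w" .
  then show "(\<exists>m<ubd w. e a * e a = m \<and> m + m = e b) = (2 * (e a * e a) = e b)" by auto
qed

lemma T2_in_NC:
  assumes "k2 = 2 \<and> exact \<or> k2 = 3 \<and> \<not> exact"
  shows "AsyncUnstability (T 2 k2) \<in> NC"
proof -
  interpret torus "T 2 k2" n 2 k2 for n using assms by (intro torus_T) auto
  have deg: "if 2 \<le> n then card (nbrs (T 2 k2) n v) = Suc 2 else card (nbrs (T 2 k2) n v) < 2"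
    if G: "v \<in> G (T 2 k2) n" for n v
  proof -
    obtain i j b where v: "v = (i, j, b)" "i < n" "j < n" by (cases v) (use G in auto)
    show ?thesis
    proof (cases "2 \<le> n")
      case True
      then show ?thesis using card_tri_nbrs[OF True v(2,3), of b] by (simp add: v del: tri_nbrs.simps)
    next
      case False
      \<comment> \<open>On the torus with a single rhombus the three neighbors coincide, so each
        triangle has one neighbor, below the threshold 2.\<close>
      then have "n = 1" using v by simp
      then show ?thesis using v by (cases b) simp_all
    qed
  qed
  show ?thesis
  proof (rule AsyncUnstability_in_NC[where L = "\<lambda>n. 2 * (n * n)" and
        \<Phi> = "core_formula (\<lambda>n. 2 * (n * n)) tri_adj 2 exact"])
    fix w n c and x :: "nat \<times> nat \<times> bool \<Rightarrow> bool"
    assume "parsed (\<lambda>n. 2 * (n * n)) w n (2 * (n * n)) c"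
      "\<And>d. d < 2 * (n * n) \<Longrightarrow> x (cells (T 2 k2) n ! d) = act w n d"
    then show "async_unstable (T 2 k2) n x (cells (T 2 k2) n ! c) =
        core_formula (\<lambda>n. 2 * (n * n)) tri_adj 2 exact w n (2 * (n * n)) c"
      using assms by (intro unstable_iff_core_formula distinct_cells_T length_cells_T tri_adj_iff deg) auto
  next
    fix n u and x y :: "nat \<times> nat \<times> bool \<Rightarrow> bool"
    assume "u \<in> G (T 2 k2) n" "\<And>v. v \<in> G (T 2 k2) n \<Longrightarrow> x v = y v"
    then show "async_unstable (T 2 k2) n x u = async_unstable (T 2 k2) n y u" by (rule unstable_cong)
  qed (intro distinct_cells_T length_cells_T fo_double_square fo_core_formula fo_tri_adj)+
qed

theorem theorem3:
  "AsyncUnstability (T 2 2) \<in> NC \<and> AsyncUnstability (T 2 3) \<in> NC \<and>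
   AsyncUnstability (S 2 3) \<in> NC \<and> AsyncUnstability (S 2 4) \<in> NC \<and>
   AsyncUnstability (S 3 3) \<in> NC \<and> AsyncUnstability (S 3 4) \<in> NC"
  using T2_in_NC[of 2 True] T2_in_NC[of 3 False] S2_in_NC[of 3 True] S2_in_NC[of 4 False]
    S3_in_NC[of 3 True] S3_in_NC[of 4 False] by simp

end
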